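(* Let $(X,T)$ be a topological dynamical system, let $(Z,S)$ be the maximal equicontinuous factor of $(X,T)$, and let $\pi\colon (X,T)\to(Z,S)$ be the corresponding factor map. Then the following conditions are equivalent: \begin{enumerate} \item $(X,T)$ is mean equicontinuous; \item $\pi$ is Banach proximal; \item $BP(X,T)=P(X,T)=Q(X,T)$; \item for any invariant measures $\mu\in M(X,T)$ and $\nu\in M(Z,S)$ with $\pi(\mu)=\nu$, the map $\pi\colon(X,\mu,T)\to(Z,\nu,S)$ is a measure-theoretic isomorphism; \item $(X,T)$ is equicontinuous in the mean. \end{enumerate}
   Context: A topological dynamical system is a pair $(X,T)$ where $X$ is a non-empty compact metric space with metric $d$ and $T\colon X\to X$ is a continuous map. Write $\mathbb{Z}_+$ for the set of non-negative integers. A factor map $\pi\colon(X,T)\to(Y,S)$ is a continuous surjection $\pi\colon X\to Y$ with $\pi\circ T=S\circ\pi$; then $(Y,S)$ is a factor of $(X,T)$. A system is equicontinuous if for every $\varepsilon>0$ there is $\delta>0$ such that $d(x,y)<\delta$ implies $d(T^nx,T^ny)<\varepsilon$ for all $n\in\mathbb{Z}_+$. The maximal equicontinuous factor of $(X,T)$ is the (unique up to conjugacy) factor $\pi\colon(X,T)\to(Z,S)$ with $(Z,S)$ equicontinuous such that for every factor map $\phi\colon(X,T)\to(W,U)$ with $(W,U)$ equicontinuous there is a factor map $\psi\colon(Z,S)\to(W,U)$ with $\phi=\psi\circ\pi$. $(X,T)$ is mean equicontinuous if for every $\varepsilon>0$ there exists $\delta>0$ such that whenever $d(x,y)<\delta$,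 we have $\limsup_{n\to\infty}\frac1n\sum_{i=0}^{n-1}d(T^ix,T^iy)<\varepsilon$. $(X,T)$ is equicontinuous in the mean if for every $\varepsilon>0$ there exists $\delta>0$ such that $\frac1n\sum_{i=0}^{n-1}d(T^ix,T^iy)<\varepsilon$ for all integers $n\ge1$ and all $x,y\in X$ with $d(x,y)<\delta$. A set $F\subset\mathbb{Z}_+$ has zero Banach density if $\limsup_{N-M\to\infty}\frac{\#(F\cap[M,N])}{N-M+1}=0$ (over integers $0\le M\le N$). $P(X,T)$ is the set of proximal pairs: $(x,y)\in X\times X$ such that for every $\varepsilon>0$ there is a positive integer $n$ with $d(T^nx,T^ny)<\varepsilon$. $BP(X,T)$ is the set of Banach proximal pairs: $(x,y)\in X\times X$ such that for every $\varepsilon>0$, $d(T^nx,T^ny)<\varepsilon$ for all $n\in\mathbb{Z}_+$ except a set of zero Banach density. $Q(X,T)$ is the set of regionally proximal pairs: $(x,y)\in X\times X$ such that for every $\varepsilon>0$ there exist $x',y'\in X$ with $d(x,x')<\varepsilon$, $d(y,y')<\varepsilon$ and a positive integer $n$ with $d(T^nx',T^ny')<\varepsilon$. A factor map $\pi$ is Banach proximal if every pair $(x,y)$ with $\pi(x)=\pi(y)$ is Banach proximal. $M(X,T)$ is the set of $T$-invariant Borel probability measures on $X$, and $\pi(\mu)$ is the push-forward of $\mu$ under $\pi$. That $\pi\colon(X,\mu,T)\to(Z,\nu,S)$ is a measure-theoretic isomorphism means that there are measurable sets $X_0\subset X$, $Z_0\subset Z$ with $TX_0\subset X_0$, $SZ_0\subset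 Z_0$, $\mu(X_0)=\nu(Z_0)=1$ such that $\pi$ restricts to a bijection $X_0\to Z_0$ which is measurable with measurable inverse. *)

theory Defs
  imports "HOL-Probability.Probability"
begin

text \<open>
  Compact metric spaces are compact subsets of a type of class \<open>metric_space\<close> with the
  restricted metric; the values of a map outside the carrier are irrelevant.
\<close>

definition topological_dynamical_system :: "'a::metric_space set \<Rightarrow> ('a \<Rightarrow> 'a) \<Rightarrow> bool" where
  "topological_dynamical_system X T \<longleftrightarrow>
     X \<noteq> {} \<and> compact X \<and> continuous_on X T \<and> T ` X \<subseteq> X"

definition factor_map ::
  "'a::metric_space set \<Rightarrow> ('a \<Rightarrow> 'a) \<Rightarrow> 'b::metric_space set \<Rightarrow> ('b \<Rightarrow> 'b) \<Rightarrow> ('a \<Rightarrow> 'b) \<Rightarrow> bool" where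
  "factor_map X T Y S \<pi> \<longleftrightarrow>
     topological_dynamical_system X T \<and> topological_dynamical_system Y S \<and>
     continuous_on X \<pi> \<and> \<pi> ` X = Y \<and> (\<forall>x\<in>X. \<pi> (T x) = S (\<pi> x))"

definition equicontinuous :: "'a::metric_space set \<Rightarrow> ('a \<Rightarrow> 'a) \<Rightarrow> bool" where
  "equicontinuous X T \<longleftrightarrow>
     (\<forall>\<epsilon>>0. \<exists>\<delta>>0. \<forall>x\<in>X. \<forall>y\<in>X. dist x y < \<delta> \<longrightarrow>
        (\<forall>n. dist ((T ^^ n) x) ((T ^^ n) y) < \<epsilon>))"

text \<open>
  The universal property quantifies over all equicontinuous factors \<open>(W, U)\<close>, but a definition
  cannot quantify over types.  So \<open>W\<close> ranges over the compact subsets of the Banach space of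
  bounded real sequences, into which every compact metric space embeds isometrically (Frechet).
  The lemma \<open>maximal_equicontinuous_factor_universal\<close> below recovers the universal property
  for factors in an arbitrary metric space.
\<close>

definition maximal_equicontinuous_factor ::
  "'a::metric_space set \<Rightarrow> ('a \<Rightarrow> 'a) \<Rightarrow> 'b::metric_space set \<Rightarrow> ('b \<Rightarrow> 'b) \<Rightarrow> ('a \<Rightarrow> 'b) \<Rightarrow> bool" where
  "maximal_equicontinuous_factor X T Z S \<pi> \<longleftrightarrow>
     factor_map X T Z S \<pi> \<and> equicontinuous Z S \<and>
     (\<forall>(W :: (nat \<Rightarrow>\<^sub>C real) set) U \<phi>. factor_map X T W U \<phi> \<and> equicontinuous W U \<longrightarrow>
        (\<exists>\<psi>. factor_map Z S W U \<psi> \<and> (\<forall>x\<in>X. \<phi> x = \<psi> (\<pi> x))))"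

lemma Frechet_embedding:
  fixes W :: "'c::metric_space set"
  assumes "compact W"
  obtains J :: "'c \<Rightarrow> (nat \<Rightarrow>\<^sub>C real)"
  where "\<And>x y. x \<in> W \<Longrightarrow> y \<in> W \<Longrightarrow> dist (J x) (J y) = dist x y"
proof -
  obtain x0 :: 'c where True by blast
  have "\<forall>n. \<exists>k. finite k \<and> W \<subseteq> (\<Union>x\<in>k. ball x (1 / real (Suc n)))"
    using assms unfolding compact_eq_totally_bounded by simp
  then obtain k where k: "\<And>n. finite (k n)" "\<And>n. W \<subseteq> (\<Union>x\<in>k n. ball x (1 / real (Suc n)))"
    by metis
  define D where "D = insert x0 (\<Union>n. k n)"
  have D: "countable D" "D \<noteq> {}"
    unfolding D_def using k(1) by (auto intro: countable_finite)
  define d where "d = from_nat_into D"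
  define f where "f = (\<lambda>x n. dist x (d n) - dist x0 (d n))"
  have f_le: "dist (f x n) (f y n) \<le> dist x y" for x y n
    unfolding f_def dist_real_def using dist_triangle[of x "d n" y] dist_triangle[of y "d n" x]
    by (simp add: dist_commute abs_le_iff)
  have bd: "f x \<in> bcontfun" for x
  proof -
    have "bounded (range (f x))"
      unfolding bounded_iff using f_le[of x _ x0]
      by (auto simp: f_def dist_real_def intro!: exI[of _ "dist x x0"])
    then show ?thesis by (simp add: bcontfun_def)
  qed
  define J where "J = (\<lambda>x. Bcontfun (f x))"
  have J: "apply_bcontfun (J x) = f x" for x
    unfolding J_def using bd by (simp add: Bcontfun_inverse)
  have "dist (J x) (J y) = dist x y" if "x \<in> W" "y \<in> W" for x y
  proof (rule antisym)
    show "dist (J x) (J y) \<le> dist x y"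
      by (rule dist_bound) (simp add: J f_le)
    show "dist x y \<le> dist (J x) (J y)"
    proof (rule field_le_epsilon)
      fix e :: real assume "e > 0"
      then obtain n where n: "1 / real (Suc n) < e / 2"
        using nat_approx_posE[of "e / 2"] by auto
      obtain p where p: "p \<in> k n" "dist p x < 1 / real (Suc n)"
        using k(2)[of n] \<open>x \<in> W\<close> by auto
      have "p \<in> D" using p(1) by (auto simp: D_def)
      then obtain m where m: "d m = p"
        unfolding d_def using D(1) from_nat_into_surj by metis
      have "dist y p - dist x p \<le> dist (f x m) (f y m)"
        by (simp add: f_def m dist_real_def)
      also have "\<dots> \<le> dist (J x) (J y)"
        using dist_bounded[of "J x" m "J y"] by (simp add: J)
      finally have "dist y p - dist x p \<le> dist (J x) (J y)" .
      moreover have "dist x y \<le> dist x p + dist y p"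
        by (rule dist_triangle2)
      ultimately show "dist x y \<le> dist (J x) (J y) + e"
        using p(2) n by (simp add: dist_commute)
    qed
  qed
  then show ?thesis by (rule that)
qed

lemma maximal_equicontinuous_factor_universal:
  fixes W :: "'c::metric_space set"
  assumes mef: "maximal_equicontinuous_factor X T Z S \<pi>"
    and fac: "factor_map X T W U \<phi>" and eq: "equicontinuous W U"
  shows "\<exists>\<psi>. factor_map Z S W U \<psi> \<and> (\<forall>x\<in>X. \<phi> x = \<psi> (\<pi> x))"
proof -
  have W: "W \<noteq> {}" "compact W" "continuous_on W U" "U ` W \<subseteq> W"
    using fac by (auto simp: factor_map_def topological_dynamical_system_def)
  obtain J :: "'c \<Rightarrow> (nat \<Rightarrow>\<^sub>C real)"
    where J: "\<And>x y. x \<in> W \<Longrightarrow> y \<in> W \<Longrightarrow> dist (J x) (J y) = dist x y"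
    using Frechet_embedding[OF W(2)] by blast
  have inj: "inj_on J W"
    using J by (metis dist_eq_0_iff inj_onI)
  define I where "I = the_inv_into W J"
  have IJ: "I (J w) = w" if "w \<in> W" for w
    using that inj by (simp add: I_def the_inv_into_f_f)
  have contJ: "continuous_on W J"
    unfolding continuous_on_iff using J by metis
  have contI: "continuous_on (J ` W) I"
    unfolding continuous_on_iff using J IJ by (metis (no_types, lifting) imageE)
  define U' where "U' = (\<lambda>v. J (U (I v)))"
  have iter: "(U ^^ n) w \<in> W \<and> (U' ^^ n) (J w) = J ((U ^^ n) w)" if "w \<in> W" for w n
    by (induction n) (use that W(4) IJ in \<open>auto simp: U'_def\<close>)
  have I_mem: "I ` (J ` W) = W" using IJ by force
  have "continuous_on (J ` W) (\<lambda>v. U (I v))"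
    by (rule continuous_on_compose2[OF W(3) contI]) (simp add: I_mem)
  then have contU': "continuous_on (J ` W) U'"
    unfolding U'_def
    by (rule continuous_on_compose2[OF contJ]) (use W(4) I_mem in auto)
  have tds: "topological_dynamical_system (J ` W) U'"
    unfolding topological_dynamical_system_def
    using W contJ contU' IJ by (auto simp: U'_def intro: compact_continuous_image)
  have phi: "continuous_on X \<phi>" "\<phi> ` X = W" "\<And>x. x \<in> X \<Longrightarrow> \<phi> (T x) = U (\<phi> x)"
    using fac by (auto simp: factor_map_def)
  have "continuous_on X (\<lambda>x. J (\<phi> x))"
    by (rule continuous_on_compose2[OF contJ phi(1)]) (use phi in auto)
  moreover have "(\<lambda>x. J (\<phi> x)) ` X = J ` W"
    using phi(2) by auto
  moreover have "J (\<phi> (T x)) = U' (J (\<phi> x))" if "x \<in> X" for x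
    using that phi(2,3) by (auto simp: U'_def IJ)
  ultimately have fac': "factor_map X T (J ` W) U' (\<lambda>x. J (\<phi> x))"
    using fac tds by (auto simp: factor_map_def)
  have "equicontinuous (J ` W) U'"
    using eq J iter unfolding equicontinuous_def by simp
  with fac' mef obtain \<psi> where \<psi>: "factor_map Z S (J ` W) U' \<psi>"
    "\<And>x. x \<in> X \<Longrightarrow> J (\<phi> x) = \<psi> (\<pi> x)"
    unfolding maximal_equicontinuous_factor_def by metis
  have psi: "continuous_on Z \<psi>" "\<psi> ` Z = J ` W" "\<And>z. z \<in> Z \<Longrightarrow> \<psi> (S z) = U' (\<psi> z)"
    using \<psi>(1) by (auto simp: factor_map_def)
  have "continuous_on Z (\<lambda>z. I (\<psi> z))"
    by (rule continuous_on_compose2[OF contI psi(1)]) (use psi in auto)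
  moreover have "(\<lambda>z. I (\<psi> z)) ` Z = W"
    using psi(2) I_mem by (metis image_image)
  moreover have "I (\<psi> (S z)) = U (I (\<psi> z))" if z: "z \<in> Z" for z
  proof -
    obtain w where "w \<in> W" "\<psi> z = J w" using psi(2) z by blast
    then show ?thesis using psi(3)[OF z] W(4) IJ by (auto simp: U'_def)
  qed
  ultimately have "factor_map Z S W U (\<lambda>z. I (\<psi> z))"
    using \<psi>(1) fac by (auto simp: factor_map_def)
  moreover have "\<phi> x = I (\<psi> (\<pi> x))" if "x \<in> X" for x
    using \<psi>(2)[OF that] IJ that phi(2) by (metis imageI)
  ultimately show ?thesis by blast
qed

definition mean_equicontinuous :: "'a::metric_space set \<Rightarrow> ('a \<Rightarrow> 'a) \<Rightarrow> bool" where
  "mean_equicontinuous X T \<longleftrightarrow>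
     (\<forall>\<epsilon>::real>0. \<exists>\<delta>>0. \<forall>x\<in>X. \<forall>y\<in>X. dist x y < \<delta> \<longrightarrow>
        limsup (\<lambda>n. ereal (1 / real n * (\<Sum>i<n. dist ((T ^^ i) x) ((T ^^ i) y)))) < ereal \<epsilon>)"

definition equicontinuous_in_the_mean :: "'a::metric_space set \<Rightarrow> ('a \<Rightarrow> 'a) \<Rightarrow> bool" where
  "equicontinuous_in_the_mean X T \<longleftrightarrow>
     (\<forall>\<epsilon>>0. \<exists>\<delta>>0. \<forall>n\<ge>1. \<forall>x\<in>X. \<forall>y\<in>X. dist x y < \<delta> \<longrightarrow>
        1 / real n * (\<Sum>i<n. dist ((T ^^ i) x) ((T ^^ i) y)) < \<epsilon>)"

text \<open>
  The filter expresses \<open>N - M \<rightarrow> \<infinity>\<close> over all pairs \<open>(M, N)\<close>.  Truncated subtraction does no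
  harm, since \<open>N - M \<ge> 1\<close> forces \<open>M < N\<close>.
\<close>

definition zero_Banach_density :: "nat set \<Rightarrow> bool" where
  "zero_Banach_density F \<longleftrightarrow>
     Limsup (filtercomap (\<lambda>(M, N). N - M) at_top)
       (\<lambda>(M, N). ereal (real (card (F \<inter> {M..N})) / real (N - M + 1))) = 0"

definition proximal_pairs :: "'a::metric_space set \<Rightarrow> ('a \<Rightarrow> 'a) \<Rightarrow> ('a \<times> 'a) set" where
  "proximal_pairs X T =
     {(x, y) \<in> X \<times> X. \<forall>\<epsilon>>0. \<exists>n>0. dist ((T ^^ n) x) ((T ^^ n) y) < \<epsilon>}"

definition Banach_proximal_pairs :: "'a::metric_space set \<Rightarrow> ('a \<Rightarrow> 'a) \<Rightarrow> ('a \<times> 'a) set" where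
  "Banach_proximal_pairs X T =
     {(x, y) \<in> X \<times> X. \<forall>\<epsilon>>0. zero_Banach_density {n. \<not> dist ((T ^^ n) x) ((T ^^ n) y) < \<epsilon>}}"

definition regionally_proximal_pairs :: "'a::metric_space set \<Rightarrow> ('a \<Rightarrow> 'a) \<Rightarrow> ('a \<times> 'a) set" where
  "regionally_proximal_pairs X T =
     {(x, y) \<in> X \<times> X. \<forall>\<epsilon>>0. \<exists>x'\<in>X. \<exists>y'\<in>X. dist x x' < \<epsilon> \<and> dist y y' < \<epsilon> \<and>
        (\<exists>n>0. dist ((T ^^ n) x') ((T ^^ n) y') < \<epsilon>)}"

definition Banach_proximal_map ::
  "'a::metric_space set \<Rightarrow> ('a \<Rightarrow> 'a) \<Rightarrow> ('a \<Rightarrow> 'b) \<Rightarrow> bool" where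
  "Banach_proximal_map X T \<pi> \<longleftrightarrow>
     (\<forall>x\<in>X. \<forall>y\<in>X. \<pi> x = \<pi> y \<longrightarrow> (x, y) \<in> Banach_proximal_pairs X T)"

definition invariant_measures :: "'a::metric_space set \<Rightarrow> ('a \<Rightarrow> 'a) \<Rightarrow> 'a measure set" where
  "invariant_measures X T =
     {\<mu>. prob_space \<mu> \<and> sets \<mu> = sets (restrict_space borel X) \<and> distr \<mu> \<mu> T = \<mu>}"

definition measure_theoretic_isomorphism ::
  "'a measure \<Rightarrow> ('a \<Rightarrow> 'a) \<Rightarrow> 'b measure \<Rightarrow> ('b \<Rightarrow> 'b) \<Rightarrow> ('a \<Rightarrow> 'b) \<Rightarrow> bool" where
  "measure_theoretic_isomorphism \<mu> T \<nu> S \<pi> \<longleftrightarrow>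
     (\<exists>X\<^sub>0\<in>sets \<mu>. \<exists>Z\<^sub>0\<in>sets \<nu>.
        T ` X\<^sub>0 \<subseteq> X\<^sub>0 \<and> S ` Z\<^sub>0 \<subseteq> Z\<^sub>0 \<and> emeasure \<mu> X\<^sub>0 = 1 \<and> emeasure \<nu> Z\<^sub>0 = 1 \<and>
        bij_betw \<pi> X\<^sub>0 Z\<^sub>0 \<and>
        \<pi> \<in> measurable (restrict_space \<mu> X\<^sub>0) (restrict_space \<nu> Z\<^sub>0) \<and>
        the_inv_into X\<^sub>0 \<pi> \<in> measurable (restrict_space \<nu> Z\<^sub>0) (restrict_space \<mu> X\<^sub>0))"

end

theory Submission
  imports Defs
begin

text \<open>
  If Birkhoff sums of a nonnegative function are small somewhere along every orbit of a compact set,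
  then cutting orbits into blocks makes them small uniformly, even for orbits that only stay near
  the set.  Applied to the distance on \<open>X \<times> X\<close>, this yields Banach densities from
  mere averages, and it turns Banach proximality of \<open>\<pi>\<close> into equicontinuity in the mean, because
  orbits starting in nearby fibres of \<open>\<pi>\<close> stay near the fibre relation.  Conversely, for a mean
  equicontinuous system the upper mean distance is a continuous \<open>T\<close>-invariant pseudometric; its
  quotient is an isometric factor, so it vanishes on the fibres of \<open>\<pi>\<close>, and it also vanishes on
  regionally proximal pairs.

  For the measure-theoretic condition, a pair in a fibre that is not Banach proximal gives, by the
  Krylov-Bogoliubov argument, an invariant measure on the fibre relation which is not carried by the
  diagonal, and \<open>\<pi>\<close> is not injective almost everywhere for the average of its marginals.  If \<open>\<pi>\<close>
  is Banach proximal, then \<open>x\<close> is, up to a small mean error, a measurable function of \<open>\<pi> x\<close>, and a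
  Borel-Cantelli argument produces a measurable inverse.
\<close>

section \<open>Birkhoff sums and Banach density\<close>

text \<open>The two notions of mean equicontinuity differ by uniformity in time: a small upper limit
  does not tell when the averages become small, so no \<open>\<delta>\<close> serving all
  \<open>n\<close> can be read off. The proof passes through a compact relation of pairs, where one
  good block per point suffices: a strict bound on a Birkhoff sum persists nearby, and this bounds
  the block lengths.

  The equality of the three relations does not mention \<open>\<pi>\<close>. Identifying Q with the
  fibre relation would require a metric on the quotient of \<open>X\<close> by Q; instead, closeness
  of pairs to Q is measured by \<open>infdist\<close>, and equicontinuity in the mean is derived
  inside \<open>X\<close>.

  \<open>T\<close> and \<open>S\<close> need not be injective or surjective, so a point has no
  canonical past. This is why closeness to Q is propagated forward by almost returns, and why
  \<open>S\<close> is inverted only on its eventual image. The ambient metric spaces need not be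
  separable, which accounts for sections with countably many values.\<close>

definition Birkhoff_sum :: "('c \<Rightarrow> 'c) \<Rightarrow> ('c \<Rightarrow> real) \<Rightarrow> nat \<Rightarrow> 'c \<Rightarrow> real" where
  "Birkhoff_sum F f n p = (\<Sum>i<n. f ((F ^^ i) p))"

lemma funpow_in_carrier:
  assumes "F ` K \<subseteq> K" "p \<in> K"
  shows "(F ^^ n) p \<in> K"
  using assms by (induction n) auto

lemma continuous_on_funpow:
  fixes F :: "'c::topological_space \<Rightarrow> 'c"
  assumes "continuous_on K F" "F ` K \<subseteq> K"
  shows "continuous_on K (F ^^ n)"
proof (induction n)
  case 0
  then show ?case by (simp add: id_def)
next
  case (Suc n)
  have "continuous_on K (\<lambda>p. F ((F ^^ n) p))"
    by (rule continuous_on_compose2[OF assms(1) Suc]) (use funpow_in_carrier[OF assms(2)] in auto)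
  then show ?case by (simp add: o_def)
qed

lemma continuous_on_Birkhoff_sum:
  fixes F :: "'c::topological_space \<Rightarrow> 'c"
  assumes "continuous_on K F" "F ` K \<subseteq> K" "continuous_on K f"
  shows "continuous_on K (Birkhoff_sum F f n)"
proof -
  have "continuous_on K (\<lambda>p. f ((F ^^ i) p))" for i
    by (rule continuous_on_compose2[OF assms(3) continuous_on_funpow[OF assms(1,2)]])
      (use funpow_in_carrier[OF assms(2)] in auto)
  then show ?thesis
    unfolding Birkhoff_sum_def by (intro continuous_on_sum)
qed

lemma Birkhoff_sum_add:
  "Birkhoff_sum F f (m + n) p = Birkhoff_sum F f m p + Birkhoff_sum F f n ((F ^^ m) p)"
proof -
  have "(\<Sum>i<m + n. f ((F ^^ i) p)) = (\<Sum>i<m. f ((F ^^ i) p)) + (\<Sum>i<n. f ((F ^^ (m + i)) p))"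
    using sum.atLeastLessThan_concat[of 0 m "m + n" "\<lambda>i. f ((F ^^ i) p)"]
      sum.shift_bounds_nat_ivl[of "\<lambda>i. f ((F ^^ i) p)" 0 m n]
    by (simp add: atLeast0LessThan add.commute)
  then show ?thesis
    unfolding Birkhoff_sum_def by (simp add: funpow_add add.commute[of m])
qed

text \<open>The orbit is cut greedily into blocks of length at most \<open>N\<close> with small average; only the
  last, incomplete block is not controlled.\<close>

lemma Birkhoff_sum_le_blocks:
  assumes "\<And>i. \<exists>m. 0 < m \<and> m \<le> N \<and> Birkhoff_sum F f m ((F ^^ i) p) \<le> \<epsilon> * real m"
    and "\<And>i. f ((F ^^ i) p) \<le> B" and "0 \<le> B" "0 \<le> \<epsilon>"
  shows "Birkhoff_sum F f n p \<le> \<epsilon> * real n + real N * B"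
  using assms(1,2)
proof (induction n arbitrary: p rule: less_induct)
  case (less n)
  obtain m where m: "0 < m" "m \<le> N" "Birkhoff_sum F f m p \<le> \<epsilon> * real m"
    using less.prems(1)[of 0] by auto
  show ?case
  proof (cases "n \<le> m")
    case True
    have "Birkhoff_sum F f n p \<le> (\<Sum>i<n. B)"
      unfolding Birkhoff_sum_def by (intro sum_mono less.prems(2))
    also have "\<dots> \<le> real N * B"
      using True m(2) \<open>0 \<le> B\<close> by (simp add: mult_right_mono)
    finally show ?thesis using \<open>0 \<le> \<epsilon>\<close> by (smt (verit) mult_nonneg_nonneg of_nat_0_le_iff)
  next
    case False
    have shift: "(F ^^ i) ((F ^^ m) p) = (F ^^ (i + m)) p" for i
      by (simp add: funpow_add)
    have "Birkhoff_sum F f (n - m) ((F ^^ m) p) \<le> \<epsilon> * real (n - m) + real N * B"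
      by (rule less.IH) (use False m(1) less.prems in \<open>auto simp: shift\<close>)
    moreover have "Birkhoff_sum F f n p = Birkhoff_sum F f m p + Birkhoff_sum F f (n - m) ((F ^^ m) p)"
      using False Birkhoff_sum_add[of F f m "n - m" p] by simp
    ultimately show ?thesis
      using m(3) False by (simp add: of_nat_diff algebra_simps)
  qed
qed

text \<open>A block length that is good for one point of \<open>R\<close> stays good nearby, because
  a strict inequality for a continuous function is an open condition; compactness then bounds the
  lengths. Only points near \<open>R\<close> are controlled, so an orbit has to be kept near
  \<open>R\<close> separately.\<close>

lemma Birkhoff_sum_small_near_compact:
  fixes F :: "'c::metric_space \<Rightarrow> 'c"
  assumes K: "compact K" "continuous_on K F" "F ` K \<subseteq> K" "continuous_on K f"
    and R: "compact R" "R \<subseteq> K" "R \<noteq> {}"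
    and small: "\<And>p. p \<in> R \<Longrightarrow> \<exists>n>0. Birkhoff_sum F f n p < \<epsilon> * real n"
  shows "\<exists>N. \<exists>\<delta>>0. \<forall>p\<in>K. infdist p R < \<delta> \<longrightarrow>
    (\<exists>n>0. n \<le> N \<and> Birkhoff_sum F f n p < \<epsilon> * real n)"
proof (rule ccontr)
  assume *: "\<not> ?thesis"
  then have "\<exists>p\<in>K. infdist p R < 1 / real (Suc k) \<and>
      (\<forall>n>0. n \<le> k \<longrightarrow> \<not> Birkhoff_sum F f n p < \<epsilon> * real n)" for k
  proof -
    have "1 / real (Suc k) > 0" by simp
    with * show ?thesis by blast
  qed
  then obtain p where p: "\<And>k. p k \<in> K" "\<And>k. infdist (p k) R < 1 / real (Suc k)"
    "\<And>k n. 0 < n \<Longrightarrow> n \<le> k \<Longrightarrow> \<not> Birkhoff_sum F f n (p k) < \<epsilon> * real n"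
    by metis
  obtain q r where q: "q \<in> K" "strict_mono r" "(p \<circ> r) \<longlonglongrightarrow> q"
    using K(1) p(1) unfolding compact_def by metis
  have "(\<lambda>k. infdist ((p \<circ> r) k) R) \<longlonglongrightarrow> infdist q R"
    by (intro tendsto_infdist q)
  moreover have "(\<lambda>k. infdist ((p \<circ> r) k) R) \<longlonglongrightarrow> 0"
  proof (rule tendsto_sandwich[where f="\<lambda>_. 0" and h="\<lambda>k. 1 / real (Suc k)"])
    show "\<forall>\<^sub>F k in sequentially. infdist ((p \<circ> r) k) R \<le> 1 / real (Suc k)"
    proof (rule always_eventually, rule allI)
      fix k
      have "infdist (p (r k)) R < 1 / real (Suc (r k))" by (rule p)
      also have "\<dots> \<le> 1 / real (Suc k)"
        using seq_suble[OF q(2), of k] by (intro divide_left_mono) auto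
      finally show "infdist ((p \<circ> r) k) R \<le> 1 / real (Suc k)" by simp
    qed
    show "(\<lambda>k. 1 / real (Suc k)) \<longlonglongrightarrow> 0"
      by (rule LIMSEQ_Suc[OF lim_1_over_n])
  qed (auto simp: infdist_nonneg)
  ultimately have "infdist q R = 0" by (rule LIMSEQ_unique)
  then have "q \<in> R"
    using R by (simp add: in_closed_iff_infdist_zero compact_imp_closed)
  then obtain n where n: "n > 0" "Birkhoff_sum F f n q < \<epsilon> * real n" using small by blast
  have "(\<lambda>k. Birkhoff_sum F f n ((p \<circ> r) k)) \<longlonglongrightarrow> Birkhoff_sum F f n q"
    by (rule continuous_on_tendsto_compose[OF continuous_on_Birkhoff_sum[OF K(2,3,4)] q(3) q(1)])
      (simp add: p)
  then have "\<forall>\<^sub>F k in sequentially. Birkhoff_sum F f n ((p \<circ> r) k) < \<epsilon> * real n"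
    using n(2) by (rule order_tendstoD)
  then obtain k where k: "k \<ge> n" "Birkhoff_sum F f n ((p \<circ> r) k) < \<epsilon> * real n"
    unfolding eventually_sequentially by (meson le_trans nat_le_linear)
  moreover have "n \<le> r k" using k(1) seq_suble[OF q(2), of k] by simp
  ultimately show False using p(3)[OF n(1), of "r k"] by simp
qed

text \<open>Invariance of \<open>R\<close> gives every point of an orbit a good block of length at
  most \<open>N\<close>, so the only error is the last incomplete block. \<open>C\<close> bounds its
  contribution independently of \<open>p\<close> and \<open>n\<close>, which later allows windows
  starting at arbitrary times.\<close>

lemma Birkhoff_sum_uniformly_small:
  fixes F :: "'c::metric_space \<Rightarrow> 'c"
  assumes R: "compact R" "R \<noteq> {}" "continuous_on R F" "F ` R \<subseteq> R" "continuous_on R f"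
    and small: "\<And>p. p \<in> R \<Longrightarrow> \<exists>n>0. Birkhoff_sum F f n p < \<epsilon> * real n" and "\<epsilon> \<ge> 0"
  obtains C where "C \<ge> 0" "\<And>p n. p \<in> R \<Longrightarrow> Birkhoff_sum F f n p \<le> \<epsilon> * real n + C"
proof -
  obtain N \<delta> where N: "\<delta> > 0"
    "\<And>p. p \<in> R \<Longrightarrow> infdist p R < \<delta> \<Longrightarrow> \<exists>n>0. n \<le> N \<and> Birkhoff_sum F f n p < \<epsilon> * real n"
    using Birkhoff_sum_small_near_compact[OF R(1,3,4,5) R(1) order_refl R(2) small] by metis
  have "bounded (f ` R)" using R by (intro compact_imp_bounded compact_continuous_image)
  then obtain B where B: "\<And>p. p \<in> R \<Longrightarrow> f p \<le> B" "B \<ge> 0"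
    unfolding bounded_iff by (metis abs_ge_self abs_ge_zero imageI order_trans real_norm_def all_not_in_conv R(2))
  have "Birkhoff_sum F f n p \<le> \<epsilon> * real n + real N * B" if "p \<in> R" for p n
  proof (rule Birkhoff_sum_le_blocks)
    fix i
    have "(F ^^ i) p \<in> R" using funpow_in_carrier[OF R(4) that] .
    then show "f ((F ^^ i) p) \<le> B"
      "\<exists>m>0. m \<le> N \<and> Birkhoff_sum F f m ((F ^^ i) p) \<le> \<epsilon> * real m"
      using N(1) N(2)[of "(F ^^ i) p"] B(1) by (auto simp: less_imp_le)
  qed (use B \<open>\<epsilon> \<ge> 0\<close> in auto)
  then show thesis using that[of "real N * B"] B(2) by simp
qed

section \<open>Zero Banach density as a uniform bound over long windows\<close>

lemma zero_Banach_density_iff: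
  "zero_Banach_density F \<longleftrightarrow>
     (\<forall>\<eta>>0. \<exists>L. \<forall>M N. N - M \<ge> L \<longrightarrow> real (card (F \<inter> {M..N})) < \<eta> * real (N - M + 1))"
proof -
  define G :: "(nat \<times> nat) filter" where "G = filtercomap (\<lambda>(M, N). N - M) at_top"
  define h :: "nat \<times> nat \<Rightarrow> ereal"
    where "h = (\<lambda>(M, N). ereal (real (card (F \<inter> {M..N})) / real (N - M + 1)))"
  \<comment> \<open>On the trivial filter the Limsup would be \<open>-\<infinity>\<close>. The pairs
    \<open>(0, n)\<close> show that the filter is proper, so the Limsup is at least 0 and only the
    upper bound carries information.\<close>
  have "G \<noteq> bot"
    unfolding G_def
  proof (rule filtercomap_neq_bot)
    fix P :: "nat \<Rightarrow> bool" assume "eventually P at_top"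
    then obtain n where "P n" by (auto simp: eventually_at_top_linorder)
    then show "\<exists>x. P (case x of (M, N) \<Rightarrow> N - M)"
      by (intro exI[of _ "(0, n)"]) simp
  qed
  moreover have "\<forall>\<^sub>F x in G. 0 \<le> h x"
    by (rule always_eventually) (auto simp: h_def)
  ultimately have "0 \<le> Limsup G h"
    using le_Limsup by blast
  then have "zero_Banach_density F \<longleftrightarrow> (\<forall>\<eta>>0. \<forall>\<^sub>F x in G. h x < ereal \<eta>)"
    unfolding zero_Banach_density_def G_def[symmetric] h_def[symmetric]
  proof -
    assume 0: "0 \<le> Limsup G h"
    have "Limsup G h = 0 \<longleftrightarrow> Limsup G h \<le> 0" using 0 by auto
    also have "\<dots> \<longleftrightarrow> (\<forall>y>0. \<forall>\<^sub>F x in G. h x < y)" by (rule Limsup_le_iff)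
    also have "\<dots> \<longleftrightarrow> (\<forall>\<eta>>0. \<forall>\<^sub>F x in G. h x < ereal \<eta>)"
    proof safe
      fix y :: ereal
      assume *: "\<forall>\<eta>>0. \<forall>\<^sub>F x in G. h x < ereal \<eta>" "0 < y"
      obtain z where z: "0 < ereal z" "ereal z < y" using *(2) ereal_dense2 by blast
      then have "\<forall>\<^sub>F x in G. h x < ereal z" using * by simp
      then show "\<forall>\<^sub>F x in G. h x < y"
        by eventually_elim (use z in auto)
    qed auto
    finally show "Limsup G h = 0 \<longleftrightarrow> (\<forall>\<eta>>0. \<forall>\<^sub>F x in G. h x < ereal \<eta>)" .
  qed
  moreover have "(\<forall>\<^sub>F x in G. h x < ereal \<eta>) \<longleftrightarrow>
      (\<exists>L. \<forall>M N. N - M \<ge> L \<longrightarrow> real (card (F \<inter> {M..N})) < \<eta> * real (N - M + 1))" for \<eta>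
    unfolding G_def h_def eventually_filtercomap eventually_at_top_linorder
    by (auto simp: divide_less_eq)
  ultimately show ?thesis by simp
qed

lemma zero_Banach_density_subset:
  assumes "zero_Banach_density F" "E \<subseteq> F"
  shows "zero_Banach_density E"
proof -
  have "card (E \<inter> {M..N}) \<le> card (F \<inter> {M..N})" for M N
    using assms(2) by (intro card_mono) auto
  then have "real (card (E \<inter> {M..N})) \<le> real (card (F \<inter> {M..N}))" for M N
    by (rule of_nat_mono)
  then show ?thesis
    using assms(1) unfolding zero_Banach_density_iff by (meson le_less_trans)
qed

lemma zero_Banach_density_Un:
  assumes "zero_Banach_density E" "zero_Banach_density F"
  shows "zero_Banach_density (E \<union> F)"
  unfolding zero_Banach_density_iff
proof (intro allI impI)
  fix \<eta> :: real assume "\<eta> > 0"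
  then obtain L L' where L: "\<And>M N. N - M \<ge> L \<Longrightarrow> real (card (E \<inter> {M..N})) < \<eta> / 2 * real (N - M + 1)"
    and L': "\<And>M N. N - M \<ge> L' \<Longrightarrow> real (card (F \<inter> {M..N})) < \<eta> / 2 * real (N - M + 1)"
    using assms half_gt_zero[of \<eta>] unfolding zero_Banach_density_iff by meson
  have "real (card ((E \<union> F) \<inter> {M..N})) < \<eta> * real (N - M + 1)" if "N - M \<ge> max L L'" for M N
  proof -
    have "card ((E \<union> F) \<inter> {M..N}) \<le> card (E \<inter> {M..N}) + card (F \<inter> {M..N})"
      unfolding Int_Un_distrib2 by (rule card_Un_le)
    then have "real (card ((E \<union> F) \<inter> {M..N})) \<le> real (card (E \<inter> {M..N})) + real (card (F \<inter> {M..N}))"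
      by linarith
    also have "\<dots> < \<eta> / 2 * real (N - M + 1) + \<eta> / 2 * real (N - M + 1)"
      using that by (intro add_strict_mono L L') auto
    finally show ?thesis by (simp add: field_simps)
  qed
  then show "\<exists>L. \<forall>M N. L \<le> N - M \<longrightarrow> real (card ((E \<union> F) \<inter> {M..N})) < \<eta> * real (N - M + 1)"
    by blast
qed


text \<open>On the compact set where \<open>f \<ge> \<epsilon>\<close> the function \<open>h\<close>
  has no zero, so its minimum there serves as \<open>\<delta>\<close>. In this way exact
  implications between closed conditions become uniform approximate ones.\<close>

lemma compact_small_near_zeros:
  fixes f h :: "'c::metric_space \<Rightarrow> real"
  assumes "compact K" "continuous_on K f" "continuous_on K h"
    and "\<And>p. p \<in> K \<Longrightarrow> h p \<ge> 0" "\<And>p. p \<in> K \<Longrightarrow> h p = 0 \<Longrightarrow> f p \<le> 0" and "\<epsilon> > 0"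
  obtains \<delta> where "\<delta> > 0" "\<And>p. p \<in> K \<Longrightarrow> h p < \<delta> \<Longrightarrow> f p < \<epsilon>"
proof (cases "K \<inter> f -` {\<epsilon>..} = {}")
  case True
  then show thesis using that[of 1] by force
next
  case False
  have "closedin (top_of_set K) (K \<inter> f -` {\<epsilon>..})"
    by (rule continuous_closedin_preimage[OF assms(2)]) simp
  then have "compact (K \<inter> f -` {\<epsilon>..})"
    using assms(1) closedin_compact by blast
  moreover have "continuous_on (K \<inter> f -` {\<epsilon>..}) h"
    using assms(3) by (rule continuous_on_subset) simp
  ultimately obtain q where q: "q \<in> K \<inter> f -` {\<epsilon>..}" "\<And>p. p \<in> K \<inter> f -` {\<epsilon>..} \<Longrightarrow> h q \<le> h p"
    using continuous_attains_inf False by metis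
  have "h q > 0" using q(1) assms(4,5,6) by fastforce
  then show thesis
    by (rule that) (use q(2) in force)
qed

section \<open>Distance sums as Birkhoff sums of the product system\<close>

definition dist_sum :: "('a::metric_space \<Rightarrow> 'a) \<Rightarrow> nat \<Rightarrow> 'a \<Rightarrow> 'a \<Rightarrow> real" where
  "dist_sum T n x y = (\<Sum>i<n. dist ((T ^^ i) x) ((T ^^ i) y))"

abbreviation pair_dist :: "'a::metric_space \<times> 'a \<Rightarrow> real" where
  "pair_dist p \<equiv> dist (fst p) (snd p)"

lemma funpow_map_prod:
  fixes T :: "'c \<Rightarrow> 'c"
  shows "(map_prod T T ^^ n) p = ((T ^^ n) (fst p), (T ^^ n) (snd p))"
  by (induction n) (simp_all add: map_prod_def case_prod_beta)

lemma dist_sum_eq: "dist_sum T n x y = Birkhoff_sum (map_prod T T) pair_dist n (x, y)"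
  by (simp add: dist_sum_def Birkhoff_sum_def funpow_map_prod)

lemma dist_sum_nonneg: "0 \<le> dist_sum T n x y"
  unfolding dist_sum_def by (intro sum_nonneg) simp

locale dynamical_system =
  fixes X :: "'a::metric_space set" and T :: "'a \<Rightarrow> 'a"
  assumes tds: "topological_dynamical_system X T"
begin

lemma X_nonempty: "X \<noteq> {}" and compact_X: "compact X" and cont_T: "continuous_on X T"
  and T_image: "T ` X \<subseteq> X" and T_in [intro, simp]: "x \<in> X \<Longrightarrow> T x \<in> X"
  using tds by (auto simp: topological_dynamical_system_def)

lemma iter_in [intro, simp]: "x \<in> X \<Longrightarrow> (T ^^ n) x \<in> X"
  using funpow_in_carrier[OF T_image] .

lemma cont_iter: "continuous_on X (T ^^ n)"
  by (rule continuous_on_funpow[OF cont_T T_image])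

lemma compact_pairs: "compact (X \<times> X)"
  using compact_X by (intro compact_Times)

lemma cont_pair_map: "continuous_on (X \<times> X) (map_prod T T)"
  unfolding map_prod_def case_prod_beta
  by (intro continuous_on_Pair continuous_on_compose2[OF cont_T] continuous_intros) auto

lemma cont_pair_dist: "continuous_on A (\<lambda>p::'a \<times> 'a. pair_dist p)"
  by (intro continuous_intros)

lemma dist_le_diameter: "x \<in> X \<Longrightarrow> y \<in> X \<Longrightarrow> dist x y \<le> diameter X"
  using compact_X by (intro diameter_bounded_bound compact_imp_bounded)

lemma diameter_nonneg: "diameter X \<ge> 0"
  using X_nonempty dist_le_diameter dist_self by (metis all_not_in_conv)

text \<open>A window \<open>{M..N}\<close> is an initial segment of the orbit of the pair shifted by
  \<open>M\<close>, which is again in \<open>R\<close>. The uniform bound on Birkhoff sums thus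
  applies to every window, and Markov's inequality turns it into a density.\<close>

lemma small_averages_imp_Banach_proximal:
  assumes R: "compact R" "R \<subseteq> X \<times> X" "\<And>x y. (x, y) \<in> R \<Longrightarrow> (T x, T y) \<in> R"
    and small: "\<And>x y \<epsilon>. (x, y) \<in> R \<Longrightarrow> \<epsilon> > 0 \<Longrightarrow> \<exists>n>0. dist_sum T n x y < \<epsilon> * real n"
  shows "R \<subseteq> Banach_proximal_pairs X T"
proof clarify
  fix x y assume xy: "(x, y) \<in> R"
  have inv: "map_prod T T ` R \<subseteq> R" using R(3) by auto
  have "zero_Banach_density {n. \<not> dist ((T ^^ n) x) ((T ^^ n) y) < \<epsilon>}" if "\<epsilon> > 0" for \<epsilon>
    unfolding zero_Banach_density_iff
  proof (intro allI impI)
    fix \<eta> :: real assume "\<eta> > 0"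
    let ?F = "{n. \<not> dist ((T ^^ n) x) ((T ^^ n) y) < \<epsilon>}"
    \<comment> \<open>Half of \<open>\<epsilon> * \<eta>\<close> pays for the average; the other
      half absorbs the constant \<open>C\<close> once the window is longer than
      \<open>L\<close>.\<close>
    define e where "e = \<epsilon> * \<eta> / 2"
    have e: "e > 0" using \<open>\<eta> > 0\<close> that by (simp add: e_def)
    have "continuous_on R (map_prod T T)"
      using cont_pair_map R(2) by (rule continuous_on_subset)
    moreover have "\<exists>n>0. Birkhoff_sum (map_prod T T) pair_dist n p < e * real n" if "p \<in> R" for p
      using small[of "fst p" "snd p" e] that e by (simp add: dist_sum_eq)
    moreover have "R \<noteq> {}" using xy by blast
    ultimately obtain C where C: "C \<ge> 0"
      "\<And>p n. p \<in> R \<Longrightarrow> Birkhoff_sum (map_prod T T) pair_dist n p \<le> e * real n + C"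
      using Birkhoff_sum_uniformly_small[OF R(1) _ _ inv cont_pair_dist _ less_imp_le[OF e]] by blast
    obtain L where L: "C < real L * e" using reals_Archimedean3[OF e] by blast
    then have "L > 0" using C(1) by (cases L) auto
    have "real (card (?F \<inter> {M..N})) < \<eta> * real (N - M + 1)" if "N - M \<ge> L" for M N
    proof -
      have MN: "M \<le> N" using that \<open>L > 0\<close> by simp
      have "\<epsilon> * real (card (?F \<inter> {M..N})) = (\<Sum>i\<in>?F \<inter> {M..N}. \<epsilon>)" by simp
      also have "\<dots> \<le> (\<Sum>i\<in>?F \<inter> {M..N}. dist ((T ^^ i) x) ((T ^^ i) y))"
        by (intro sum_mono) auto
      also have "\<dots> \<le> (\<Sum>i\<in>{M..N}. dist ((T ^^ i) x) ((T ^^ i) y))"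
        by (intro sum_mono2) auto
      also have "\<dots> = (\<Sum>i<N - M + 1. dist ((T ^^ (i + M)) x) ((T ^^ (i + M)) y))"
        by (rule sum.reindex_bij_witness[of _ "\<lambda>i. i + M" "\<lambda>i. i - M"]) (use MN in auto)
      also have "\<dots> = Birkhoff_sum (map_prod T T) pair_dist (N - M + 1) ((map_prod T T ^^ M) (x, y))"
        by (simp add: Birkhoff_sum_def funpow_map_prod funpow_add)
      also have "\<dots> \<le> e * real (N - M + 1) + C"
        by (intro C funpow_in_carrier[OF inv xy])
      also have "\<dots> < 2 * e * real (N - M + 1)"
      proof -
        have "real L * e \<le> real (N - M + 1) * e" using that e by (intro mult_right_mono) auto
        then show ?thesis using L by (simp add: mult.commute)
      qed
      also have "\<dots> = \<epsilon> * (\<eta> * real (N - M + 1))" by (simp add: e_def)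
      finally show ?thesis using \<open>\<epsilon> > 0\<close> by simp
    qed
    then show "\<exists>L. \<forall>M N. L \<le> N - M \<longrightarrow> real (card (?F \<inter> {M..N})) < \<eta> * real (N - M + 1)"
      by blast
  qed
  then show "(x, y) \<in> Banach_proximal_pairs X T"
    using xy R(2) by (auto simp: Banach_proximal_pairs_def)
qed

text \<open>Outside a set of small density each distance is below \<open>\<epsilon> / 2\<close>; on
  that set it is at most the diameter.\<close>

lemma Banach_proximal_imp_small_average:
  assumes "(x, y) \<in> Banach_proximal_pairs X T" "\<epsilon> > 0"
  shows "\<exists>n>0. dist_sum T n x y < \<epsilon> * real n"
proof -
  let ?F = "{n. \<not> dist ((T ^^ n) x) ((T ^^ n) y) < \<epsilon> / 2}"
  \<comment> \<open>Chosen so that \<open>(diameter X + 1) * \<eta> = \<epsilon> / 2\<close>. The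
    summand 1 keeps the quotient meaningful for a one-point space and makes the final estimate
    strict.\<close>
  define \<eta> where "\<eta> = \<epsilon> / (2 * (diameter X + 1))"
  have B: "diameter X \<ge> 0" by (rule diameter_nonneg)
  have \<eta>: "\<eta> > 0" using assms(2) B by (simp add: \<eta>_def)
  have xy: "x \<in> X" "y \<in> X" using assms(1) by (auto simp: Banach_proximal_pairs_def)
  have "zero_Banach_density ?F"
    using assms half_gt_zero[of \<epsilon>] unfolding Banach_proximal_pairs_def by blast
  then obtain L where "\<And>M N. N - M \<ge> L \<Longrightarrow> real (card (?F \<inter> {M..N})) < \<eta> * real (N - M + 1)"
    using \<eta> unfolding zero_Banach_density_iff by blast
  from this[of L 0] have L: "real (card (?F \<inter> {..L})) < \<eta> * real (L + 1)"
    by (simp add: atLeast0AtMost)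
  have "dist_sum T (L + 1) x y \<le> (\<Sum>i<L+1. \<epsilon> / 2 + diameter X * indicator ?F i)"
    unfolding dist_sum_def
    by (intro sum_mono) (use dist_le_diameter xy assms(2) in \<open>auto simp: indicator_def add_increasing\<close>)
  also have "\<dots> = real (L + 1) * (\<epsilon> / 2) + diameter X * (\<Sum>i<L+1. indicator ?F i)"
    by (simp only: sum.distrib sum_distrib_left sum_constant card_lessThan)
  also have "(\<Sum>i<L+1. indicator ?F i) = real (card (?F \<inter> {..L}))"
  proof -
    have "(\<Sum>i<L+1. indicator ?F i) = (\<Sum>i\<in>{..L} \<inter> ?F. (1::real))"
      using sum.inter_restrict[of "{..L}" "\<lambda>_. 1::real" ?F]
      by (simp add: indicator_def lessThan_Suc_atMost del: sum.lessThan_Suc)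
    then show ?thesis by (simp add: Int_commute)
  qed
  also have "real (L + 1) * (\<epsilon> / 2) + diameter X * real (card (?F \<inter> {..L}))
      < real (L + 1) * (\<epsilon> / 2) + (diameter X + 1) * (\<eta> * real (L + 1))"
  proof -
    have "diameter X * real (card (?F \<inter> {..L})) \<le> diameter X * (\<eta> * real (L + 1))"
      using L B by (intro mult_left_mono) auto
    moreover have "0 < \<eta> * real (L + 1)" using \<eta> by simp
    ultimately show ?thesis by (simp only: distrib_right mult_1)
  qed
  also have "\<dots> = \<epsilon> * real (L + 1)"
  proof -
    have "(diameter X + 1) * \<eta> = \<epsilon> / 2" using B by (simp add: \<eta>_def field_simps)
    then have "(diameter X + 1) * (\<eta> * real (L + 1)) = \<epsilon> / 2 * real (L + 1)"
      by (metis mult.assoc)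
    then show ?thesis by argo
  qed
  finally show ?thesis by (intro exI[of _ "L + 1"]) simp
qed

section \<open>Inclusions among the proximal relations, and Banach proximality as an equivalence
  relation\<close>

lemma Banach_proximal_subset_proximal: "Banach_proximal_pairs X T \<subseteq> proximal_pairs X T"
proof (clarsimp simp: Banach_proximal_pairs_def proximal_pairs_def)
  fix x y and \<epsilon> :: real
  let ?F = "{n. \<not> dist ((T ^^ n) x) ((T ^^ n) y) < \<epsilon>}"
  assume "\<forall>\<epsilon>>0. zero_Banach_density {n. \<not> dist ((T ^^ n) x) ((T ^^ n) y) < \<epsilon>}" "\<epsilon> > 0"
  then obtain L where L: "\<And>M N. N - M \<ge> L \<Longrightarrow> real (card (?F \<inter> {M..N})) < 1 * real (N - M + 1)"
    unfolding zero_Banach_density_iff using zero_less_one by blast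
  \<comment> \<open>Proximality asks for a positive time, hence the window starts at 1.\<close>
  have "real (card (?F \<inter> {1..L+1})) < real (L + 1)"
    using L[of "L + 1" 1] by (simp only: add_diff_cancel_right' order_refl mult_1)
  then have "card (?F \<inter> {1..L+1}) < L + 1" by (simp only: of_nat_less_iff)
  then have "?F \<inter> {1..L+1} \<noteq> {1..L+1}" by force
  then obtain n where "n \<in> {1..L+1}" "n \<notin> ?F" by blast
  then show "\<exists>n>0. dist ((T ^^ n) x) ((T ^^ n) y) < \<epsilon>" by (intro exI[of _ n]) auto
qed

lemma proximal_subset_regionally_proximal: "proximal_pairs X T \<subseteq> regionally_proximal_pairs X T"
proof (rule subrelI)
  fix x y assume "(x, y) \<in> proximal_pairs X T"
  then have xy: "x \<in> X" "y \<in> X" and *: "\<And>\<epsilon>. \<epsilon> > 0 \<Longrightarrow> \<exists>n>0. dist ((T ^^ n) x) ((T ^^ n) y) < \<epsilon>"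
    unfolding proximal_pairs_def by auto
  have "\<exists>x'\<in>X. \<exists>y'\<in>X. dist x x' < \<epsilon> \<and> dist y y' < \<epsilon> \<and>
      (\<exists>n>0. dist ((T ^^ n) x') ((T ^^ n) y') < \<epsilon>)" if "\<epsilon> > 0" for \<epsilon>
    using *[OF that] xy that by (intro bexI[of _ x] bexI[of _ y]) auto
  then show "(x, y) \<in> regionally_proximal_pairs X T"
    unfolding regionally_proximal_pairs_def using xy by simp
qed

lemma Banach_proximal_refl: "x \<in> X \<Longrightarrow> (x, x) \<in> Banach_proximal_pairs X T"
  by (auto simp: Banach_proximal_pairs_def zero_Banach_density_iff)

lemma Banach_proximal_sym:
  "(x, y) \<in> Banach_proximal_pairs X T \<Longrightarrow> (y, x) \<in> Banach_proximal_pairs X T"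
  by (auto simp: Banach_proximal_pairs_def dist_commute)

text \<open>The union of two exceptional sets of zero Banach density has zero Banach density.
  Proximality in general is not transitive; the equality of Banach proximal and regionally proximal
  pairs is later exploited through this property.\<close>

lemma Banach_proximal_trans:
  assumes "(x, y) \<in> Banach_proximal_pairs X T" "(y, z) \<in> Banach_proximal_pairs X T"
  shows "(x, z) \<in> Banach_proximal_pairs X T"
proof -
  have "zero_Banach_density {n. \<not> dist ((T ^^ n) x) ((T ^^ n) z) < \<epsilon>}" if "\<epsilon> > 0" for \<epsilon>
  proof (rule zero_Banach_density_subset[OF zero_Banach_density_Un])
    show "zero_Banach_density {n. \<not> dist ((T ^^ n) x) ((T ^^ n) y) < \<epsilon> / 2}"
      "zero_Banach_density {n. \<not> dist ((T ^^ n) y) ((T ^^ n) z) < \<epsilon> / 2}"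
      using assms that unfolding Banach_proximal_pairs_def by (simp_all del: less_divide_eq_numeral1)
    show "{n. \<not> dist ((T ^^ n) x) ((T ^^ n) z) < \<epsilon>} \<subseteq>
        {n. \<not> dist ((T ^^ n) x) ((T ^^ n) y) < \<epsilon> / 2} \<union> {n. \<not> dist ((T ^^ n) y) ((T ^^ n) z) < \<epsilon> / 2}"
    proof
      fix n assume "n \<in> {n. \<not> dist ((T ^^ n) x) ((T ^^ n) z) < \<epsilon>}"
      moreover have "dist ((T ^^ n) x) ((T ^^ n) z) \<le>
          dist ((T ^^ n) x) ((T ^^ n) y) + dist ((T ^^ n) y) ((T ^^ n) z)"
        by (rule dist_triangle)
      ultimately show "n \<in> {n. \<not> dist ((T ^^ n) x) ((T ^^ n) y) < \<epsilon> / 2} \<union>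
          {n. \<not> dist ((T ^^ n) y) ((T ^^ n) z) < \<epsilon> / 2}"
        unfolding Un_iff mem_Collect_eq by argo
    qed
  qed
  moreover have "x \<in> X" using assms(1) by (simp add: Banach_proximal_pairs_def)
  moreover have "z \<in> X" using assms(2) by (simp add: Banach_proximal_pairs_def)
  ultimately show ?thesis by (simp add: Banach_proximal_pairs_def)
qed

text \<open>The bound only has to be useful for large \<open>n\<close>; finitely many small \<open>n\<close> are handled by
  uniform continuity of the iterates.\<close>

lemma equicontinuous_in_the_meanI:
  assumes "\<And>\<epsilon>. \<epsilon> > 0 \<Longrightarrow> \<exists>\<delta>>0. \<exists>C. \<forall>x\<in>X. \<forall>y\<in>X. dist x y < \<delta> \<longrightarrow>
    (\<forall>n. dist_sum T n x y \<le> \<epsilon> * real n + C)"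
  shows "equicontinuous_in_the_mean X T"
  unfolding equicontinuous_in_the_mean_def
proof (intro allI impI)
  fix \<epsilon> :: real assume "\<epsilon> > 0"
  then have "\<epsilon> / 2 > 0" by simp
  from assms[OF this] obtain \<delta> C where \<delta>: "\<delta> > 0" "\<And>x y n. x \<in> X \<Longrightarrow> y \<in> X \<Longrightarrow> dist x y < \<delta> \<Longrightarrow>
      dist_sum T n x y \<le> \<epsilon> / 2 * real n + C"
    by meson
  obtain L where L: "C < real L * (\<epsilon> / 2)" "L > 0"
  proof -
    obtain L where "C < real L * (\<epsilon> / 2)" using reals_Archimedean3[OF \<open>\<epsilon> / 2 > 0\<close>] by blast
    also have "\<dots> \<le> real (Suc L) * (\<epsilon> / 2)" using \<open>\<epsilon> > 0\<close> by (intro mult_right_mono) auto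
    finally show thesis using that by blast
  qed
  have "\<exists>d>0. \<forall>x\<in>X. \<forall>y\<in>X. dist x y < d \<longrightarrow> dist_sum T n x y < \<epsilon> * real n" if "n > 0" for n
  proof -
    have "continuous_on (X \<times> X) (Birkhoff_sum (map_prod T T) pair_dist n)"
      by (rule continuous_on_Birkhoff_sum[OF cont_pair_map _ cont_pair_dist]) auto
    moreover have "Birkhoff_sum (map_prod T T) pair_dist n p \<le> 0" if "pair_dist p = 0" for p :: "'a \<times> 'a"
      using that by (simp add: Birkhoff_sum_def funpow_map_prod)
    moreover have "\<epsilon> * real n > 0" using \<open>\<epsilon> > 0\<close> \<open>n > 0\<close> by simp
    ultimately obtain d where d: "d > 0" "\<And>p. p \<in> X \<times> X \<Longrightarrow> pair_dist p < d \<Longrightarrow>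
        Birkhoff_sum (map_prod T T) pair_dist n p < \<epsilon> * real n"
      using compact_small_near_zeros[OF compact_pairs _ cont_pair_dist zero_le_dist] by blast
    then show ?thesis by (auto simp: dist_sum_eq intro!: exI[of _ d])
  qed
  then obtain d where d: "\<And>n. n > 0 \<Longrightarrow> d n > 0"
    "\<And>n x y. n > 0 \<Longrightarrow> x \<in> X \<Longrightarrow> y \<in> X \<Longrightarrow> dist x y < d n \<Longrightarrow> dist_sum T n x y < \<epsilon> * real n"
    by metis
  define r where "r = Min (insert \<delta> (d ` {1..L}))"
  have r: "r > 0" unfolding r_def using \<delta>(1) d(1) by (subst Min_gr_iff) auto
  have r_le: "r \<le> \<delta>" "\<And>n. n \<in> {1..L} \<Longrightarrow> r \<le> d n" unfolding r_def by (intro Min_le; simp)+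
  have "1 / real n * dist_sum T n x y < \<epsilon>" if "n \<ge> 1" "x \<in> X" "y \<in> X" "dist x y < r" for n x y
  proof -
    have "dist_sum T n x y < \<epsilon> * real n"
    proof (cases "n \<le> L")
      case True
      then show ?thesis using d(2)[of n x y] r_le(2)[of n] that by auto
    next
      case False
      have "dist_sum T n x y \<le> \<epsilon> / 2 * real n + C" using \<delta>(2) r_le(1) that by auto
      also have "\<dots> < \<epsilon> / 2 * real n + real L * (\<epsilon> / 2)" using L by simp
      also have "\<dots> \<le> \<epsilon> / 2 * real n + real n * (\<epsilon> / 2)"
        using False \<open>\<epsilon> > 0\<close> by (intro add_left_mono mult_right_mono) auto
      finally show ?thesis by simp
    qed
    then show ?thesis using that(1) by (simp add: field_simps)
  qed
  then show "\<exists>\<delta>>0. \<forall>n\<ge>1. \<forall>x\<in>X. \<forall>y\<in>X. dist x y < \<delta> \<longrightarrow>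
      1 / real n * (\<Sum>i<n. dist ((T ^^ i) x) ((T ^^ i) y)) < \<epsilon>"
    using r unfolding dist_sum_def by blast
qed

end

section \<open>Equicontinuity modulo regional proximality\<close>

lemma compact_dense_sequence:
  fixes X :: "'a::metric_space set"
  assumes "compact X" "X \<noteq> {}"
  shows "\<exists>d :: nat \<Rightarrow> 'a. (\<forall>n. d n \<in> X) \<and> (\<forall>x\<in>X. \<forall>e>0. \<exists>n. dist (d n) x < e)"
proof -
  have "\<exists>k. finite k \<and> k \<subseteq> X \<and> X \<subseteq> (\<Union>x\<in>k. ball x (1 / real (Suc n)))" for n
    using compactE_image[OF assms(1), of X "\<lambda>x. ball x (1 / real (Suc n))"] by force
  then obtain k where k: "\<And>n. finite (k n)" "\<And>n. k n \<subseteq> X"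
    "\<And>n. X \<subseteq> (\<Union>x\<in>k n. ball x (1 / real (Suc n)))" by metis
  define D where "D = (\<Union>n. k n)"
  have "D \<noteq> {}" using k(3) assms(2) by (fastforce simp: D_def)
  have D: "range (from_nat_into D) = D"
    using k(1) \<open>D \<noteq> {}\<close> by (intro range_from_nat_into) (auto simp: D_def intro: countable_finite)
  show ?thesis
  proof (intro exI[of _ "from_nat_into D"] conjI allI ballI impI)
    show "from_nat_into D n \<in> X" for n
      using from_nat_into[OF \<open>D \<noteq> {}\<close>, of n] k(2) by (auto simp: D_def)
    fix x and e :: real assume x: "x \<in> X" "e > 0"
    then obtain n where n: "1 / real (Suc n) < e" using nat_approx_posE by blast
    obtain c where c: "c \<in> k n" "dist c x < 1 / real (Suc n)" using k(3)[of n] x(1) by auto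
    then have "c \<in> range (from_nat_into D)" unfolding D by (auto simp: D_def)
    then show "\<exists>n. dist (from_nat_into D n) x < e" using c(2) n by (metis (no_types) less_trans rangeE)
  qed
qed

context dynamical_system
begin

lemma regionally_proximal_refl: "x \<in> X \<Longrightarrow> (x, x) \<in> regionally_proximal_pairs X T"
  using Banach_proximal_refl Banach_proximal_subset_proximal proximal_subset_regionally_proximal
  by blast

lemma closed_regionally_proximal: "closed (regionally_proximal_pairs X T)"
  unfolding closure_subset_eq[symmetric]
proof
  fix p :: "'a \<times> 'a"
  assume "p \<in> closure (regionally_proximal_pairs X T)"
  then have *: "\<forall>e>0. \<exists>q\<in>regionally_proximal_pairs X T. dist q p < e"
    by (simp add: closure_approachable)
  obtain x y where p: "p = (x, y)" by fastforce
  have "closed (X \<times> X)" using compact_pairs by (rule compact_imp_closed)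
  moreover have "regionally_proximal_pairs X T \<subseteq> X \<times> X" by (auto simp: regionally_proximal_pairs_def)
  ultimately have "p \<in> X \<times> X" using * closed_approachable[of "X \<times> X" p] by blast
  moreover have "\<exists>x'\<in>X. \<exists>y'\<in>X. dist x x' < \<epsilon> \<and> dist y y' < \<epsilon> \<and>
      (\<exists>n>0. dist ((T ^^ n) x') ((T ^^ n) y') < \<epsilon>)" if "\<epsilon> > 0" for \<epsilon>
  proof -
    obtain a b where ab: "(a, b) \<in> regionally_proximal_pairs X T" "dist (a, b) p < \<epsilon> / 2"
      using * \<open>\<epsilon> > 0\<close> half_gt_zero by (metis surj_pair)
    have "\<exists>x'\<in>X. \<exists>y'\<in>X. dist a x' < \<epsilon> / 2 \<and> dist b y' < \<epsilon> / 2 \<and>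
        (\<exists>n>0. dist ((T ^^ n) x') ((T ^^ n) y') < \<epsilon> / 2)"
      using ab(1) half_gt_zero[OF that] by (simp add: regionally_proximal_pairs_def del: less_divide_eq_numeral1)
    then obtain x' y' n where xy: "x' \<in> X" "y' \<in> X" "dist a x' < \<epsilon> / 2" "dist b y' < \<epsilon> / 2" "n > 0"
        "dist ((T ^^ n) x') ((T ^^ n) y') < \<epsilon> / 2"
      by blast
    have "dist a x < \<epsilon> / 2" "dist b y < \<epsilon> / 2"
      using ab(2) dist_fst_le[of "(a, b)" p] dist_snd_le[of "(a, b)" p] p by auto
    then have "dist x x' < \<epsilon>" "dist y y' < \<epsilon>"
      using xy(3,4) dist_triangle[of x x' a] dist_triangle[of y y' b] by (auto simp: dist_commute)
    then show ?thesis
      using xy that by (intro bexI[of _ x'] bexI[of _ y'] conjI exI[of _ n]) auto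
  qed
  ultimately show "p \<in> regionally_proximal_pairs X T"
    unfolding regionally_proximal_pairs_def p by simp
qed

lemma compact_regionally_proximal: "compact (regionally_proximal_pairs X T)"
proof -
  have "regionally_proximal_pairs X T = (X \<times> X) \<inter> regionally_proximal_pairs X T"
    by (auto simp: regionally_proximal_pairs_def)
  then show ?thesis using compact_Int_closed[OF compact_pairs closed_regionally_proximal] by metis
qed

text \<open>Staying near \<open>R\<close> provides a good block at every time of the orbit, which is
  all that greedy cutting asks for. It serves both the regionally proximal relation and the fibre
  relation of \<open>\<pi>\<close>.\<close>

lemma dist_sum_le_of_orbit_near:
  assumes R: "compact R" "R \<subseteq> X \<times> X" "R \<noteq> {}"
    and small: "\<And>x y. (x, y) \<in> R \<Longrightarrow> \<exists>n>0. dist_sum T n x y < \<epsilon> * real n" and "\<epsilon> > 0"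
  shows "\<exists>\<delta>>0. \<exists>C. \<forall>x\<in>X. \<forall>y\<in>X. (\<forall>i. infdist ((T ^^ i) x, (T ^^ i) y) R < \<delta>) \<longrightarrow>
    (\<forall>n. dist_sum T n x y \<le> \<epsilon> * real n + C)"
proof -
  have image: "map_prod T T ` (X \<times> X) \<subseteq> X \<times> X" by auto
  have small': "\<exists>n>0. Birkhoff_sum (map_prod T T) pair_dist n p < \<epsilon> * real n" if "p \<in> R" for p
    using small[of "fst p" "snd p"] that by (simp add: dist_sum_eq)
  obtain N \<delta> where N: "\<delta> > 0"
    "\<And>p. p \<in> X \<times> X \<Longrightarrow> infdist p R < \<delta> \<Longrightarrow>
      \<exists>n>0. n \<le> N \<and> Birkhoff_sum (map_prod T T) pair_dist n p < \<epsilon> * real n"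
    using Birkhoff_sum_small_near_compact[OF compact_pairs cont_pair_map image cont_pair_dist R small']
    by blast
  have "dist_sum T n x y \<le> \<epsilon> * real n + real N * diameter X"
    if "x \<in> X" "y \<in> X" "\<And>i. infdist ((T ^^ i) x, (T ^^ i) y) R < \<delta>" for x y n
    unfolding dist_sum_eq
  proof (rule Birkhoff_sum_le_blocks)
    fix i
    show "\<exists>m>0. m \<le> N \<and> Birkhoff_sum (map_prod T T) pair_dist m ((map_prod T T ^^ i) (x, y)) \<le> \<epsilon> * real m"
      using N(2)[of "((T ^^ i) x, (T ^^ i) y)"] that by (auto simp: funpow_map_prod intro: less_imp_le)
    show "pair_dist ((map_prod T T ^^ i) (x, y)) \<le> diameter X"
      using that dist_le_diameter by (simp add: funpow_map_prod)
  qed (use \<open>\<epsilon> > 0\<close> diameter_nonneg in auto)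
  then show ?thesis using N(1) by blast
qed

text \<open>A convergent subsequence of the orbit of the pair is Cauchy, so late terms are close.
  Its indices grow by at least one per step, so terms \<open>n\<close> apart give a return time of
  at least \<open>n\<close>, common to both coordinates.\<close>

lemma recurrence_of_pairs:
  assumes "x \<in> X" "y \<in> X" "\<delta> > 0"
  obtains i l where "l \<ge> n" "dist ((T ^^ i) x) ((T ^^ (i + l)) x) < \<delta>" "dist ((T ^^ i) y) ((T ^^ (i + l)) y) < \<delta>"
proof -
  define p where "p = (\<lambda>k. ((T ^^ k) x, (T ^^ k) y))"
  have "\<forall>k. p k \<in> X \<times> X" using assms by (simp add: p_def)
  then obtain q r where r: "strict_mono r" "(p \<circ> r) \<longlonglongrightarrow> q"
    using compact_pairs unfolding compact_def by metis
  then have "Cauchy (p \<circ> r)" by (intro LIMSEQ_imp_Cauchy)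
  then obtain M where M: "\<And>a b. a \<ge> M \<Longrightarrow> b \<ge> M \<Longrightarrow> dist ((p \<circ> r) a) ((p \<circ> r) b) < \<delta>"
    using assms(3) unfolding Cauchy_def by blast
  have "r (M + n) \<ge> r M + n"
  proof (induction n)
    case (Suc n)
    have "r (M + n) < r (M + Suc n)" using r(1) by (simp add: strict_mono_less)
    then show ?case using Suc by simp
  qed simp
  moreover have "dist (p (r M)) (p (r (M + n))) < \<delta>" using M[of M "M + n"] by simp
  ultimately show thesis
    using that[of "r (M + n) - r M" "r M"] dist_fst_le[of "p (r M)" "p (r (M + n))"]
      dist_snd_le[of "p (r M)" "p (r (M + n))"] by (simp add: p_def)
qed

text \<open>If the regionally proximal relation \<open>Q\<close> is the Banach proximal relation, then \<open>T\<close> is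
  equicontinuous modulo \<open>Q\<close>.  By definition of \<open>Q\<close>, pairs that come close to the diagonal, and
  hence pairs that come close to \<open>Q\<close>, must start close to \<open>Q\<close>.  Pulling back almost returns of
  the orbit, every point is recurrent modulo \<open>Q\<close>, so the behaviour in the past controls the
  behaviour in the future.\<close>

lemma orbits_near_regionally_proximal:
  assumes BPQ: "Banach_proximal_pairs X T = regionally_proximal_pairs X T" and "\<epsilon> > 0"
  obtains \<delta> where "\<delta> > 0"
    "\<And>x y n. x \<in> X \<Longrightarrow> y \<in> X \<Longrightarrow> dist x y < \<delta> \<Longrightarrow>
      infdist ((T ^^ n) x, (T ^^ n) y) (regionally_proximal_pairs X T) < \<epsilon>"
proof -
  define R where "R = regionally_proximal_pairs X T"
  have diag: "(x, x) \<in> R" if "x \<in> X" for x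
    using that regionally_proximal_refl by (simp add: R_def)
  have R: "compact R" "R \<subseteq> X \<times> X" "R \<noteq> {}" "closed R"
  proof -
    show "compact R" "closed R"
      by (simp_all add: R_def compact_regionally_proximal closed_regionally_proximal)
    show "R \<subseteq> X \<times> X" by (auto simp: R_def regionally_proximal_pairs_def)
    show "R \<noteq> {}" using diag X_nonempty by blast
  qed
  have in_R: "p \<in> R" if "infdist p R = 0" for p
    using that R by (simp add: in_closed_iff_infdist_zero)
  have infdist_le_dist: "infdist (x, y) R \<le> dist x y" if "x \<in> X" for x y
    using infdist_le[OF diag[OF that], of "(x, y)"] by (simp add: dist_Pair_Pair dist_commute)
  \<comment> \<open>Regional proximality made uniform: a limit of pairs whose orbits come
    arbitrarily close is regionally proximal, so such pairs cannot stay \<open>\<epsilon>\<close>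
    away from \<open>R\<close>.\<close>
  have close_imp_near: "\<exists>\<delta>>0. \<forall>x\<in>X. \<forall>y\<in>X. \<forall>n. dist ((T ^^ n) x) ((T ^^ n) y) < \<delta> \<longrightarrow> infdist (x, y) R < \<epsilon>"
    if pos: "\<epsilon> > 0" for \<epsilon>
  proof (rule ccontr)
    assume *: "\<not> ?thesis"
    \<comment> \<open>The minimum with \<open>\<epsilon>\<close> excludes \<open>n = 0\<close>,
      since at time 0 the pair would itself be within \<open>\<epsilon>\<close> of the diagonal and
      hence of \<open>R\<close>; regional proximality requires a positive time.\<close>
    have "\<exists>x\<in>X. \<exists>y\<in>X. \<exists>n. dist ((T ^^ n) x) ((T ^^ n) y) < min \<epsilon> (1 / real (Suc k)) \<and> \<not> infdist (x, y) R < \<epsilon>" for k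
    proof -
      have "min \<epsilon> (1 / real (Suc k)) > 0" using pos by simp
      with * show ?thesis by blast
    qed
    then obtain x y n where xy: "\<And>k. x k \<in> X" "\<And>k. y k \<in> X"
      "\<And>k. dist ((T ^^ n k) (x k)) ((T ^^ n k) (y k)) < min \<epsilon> (1 / real (Suc k))"
      "\<And>k. \<not> infdist (x k, y k) R < \<epsilon>" by metis
    have n: "n k > 0" for k
    proof (rule ccontr)
      assume "\<not> n k > 0"
      then have "dist (x k) (y k) < \<epsilon>" using xy(3)[of k] by simp
      then show False using infdist_le_dist[OF xy(1), of k "y k"] xy(4)[of k] by simp
    qed
    have "\<forall>k. (x k, y k) \<in> X \<times> X" using xy(1,2) by simp
    with spec[OF compact_pairs[unfolded compact_def], of "\<lambda>k. (x k, y k)"]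
    obtain q r where r: "q \<in> X \<times> X" "strict_mono r" "((\<lambda>k. (x k, y k)) \<circ> r) \<longlonglongrightarrow> q"
      by blast
    obtain a b where q: "q = (a, b)" by fastforce
    have lim: "(\<lambda>k. x (r k)) \<longlonglongrightarrow> a" "(\<lambda>k. y (r k)) \<longlonglongrightarrow> b"
      using tendsto_fst[OF r(3)] tendsto_snd[OF r(3)] by (simp_all add: q o_def)
    have "(\<lambda>k. infdist (x (r k), y (r k)) R) \<longlonglongrightarrow> infdist q R"
      using tendsto_infdist[OF r(3)] by (simp add: o_def)
    moreover have "\<forall>k\<ge>0. \<epsilon> \<le> infdist (x (r k), y (r k)) R"
      using xy(4) by (simp add: not_less)
    ultimately have "infdist q R \<ge> \<epsilon>"
      by (meson LIMSEQ_le_const)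
    moreover have "q \<in> R"
    proof -
      have "\<exists>x'\<in>X. \<exists>y'\<in>X. dist a x' < e \<and> dist b y' < e \<and> (\<exists>n>0. dist ((T ^^ n) x') ((T ^^ n) y') < e)"
        if "e > 0" for e
      proof -
        have "\<forall>\<^sub>F k in sequentially. dist (x (r k)) a < e" "\<forall>\<^sub>F k in sequentially. dist (y (r k)) b < e"
          using lim \<open>e > 0\<close> by (auto dest: tendstoD)
        moreover have "\<forall>\<^sub>F k in sequentially. 1 / real (Suc k) < e"
          using order_tendstoD(2)[OF LIMSEQ_Suc[OF lim_1_over_n] that] by simp
        ultimately have "\<forall>\<^sub>F k in sequentially. dist (x (r k)) a < e \<and> dist (y (r k)) b < e \<and> 1 / real (Suc k) < e"
          by eventually_elim blast
        then obtain k where k: "dist (x (r k)) a < e" "dist (y (r k)) b < e" "1 / real (Suc k) < e"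
          using eventually_happens'[OF sequentially_bot] by blast
        have "dist ((T ^^ n (r k)) (x (r k))) ((T ^^ n (r k)) (y (r k))) < 1 / real (Suc (r k))"
          using xy(3)[of "r k"] by simp
        also have "\<dots> \<le> 1 / real (Suc k)"
          using seq_suble[OF r(2), of k] by (intro divide_left_mono) auto
        also have "\<dots> < e" by (rule k)
        finally have "\<exists>m>0. dist ((T ^^ m) (x (r k))) ((T ^^ m) (y (r k))) < e" using n by blast
        moreover have "dist a (x (r k)) < e" "dist b (y (r k)) < e"
          using k by (simp_all add: dist_commute)
        ultimately show ?thesis using xy(1,2) by blast
      qed
      then show ?thesis using r(1) by (simp add: R_def regionally_proximal_pairs_def q)
    qed
    ultimately show False using pos by simp
  qed
  \<comment> \<open>Pairs in \<open>R\<close> are Banach proximal, so a pair near \<open>R\<close>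
    has a block with small average distance. At some time in that block the distance is small, and
    \<open>close_imp_near\<close> applies to the original pair.\<close>
  have pull_back: "\<exists>\<delta>>0. \<forall>x\<in>X. \<forall>y\<in>X. \<forall>n. infdist ((T ^^ n) x, (T ^^ n) y) R < \<delta> \<longrightarrow> infdist (x, y) R < \<epsilon>"
    if pos: "\<epsilon> > 0" for \<epsilon>
  proof -
    obtain e where e: "e > 0" and
      e_imp: "\<And>x y n. x \<in> X \<Longrightarrow> y \<in> X \<Longrightarrow> dist ((T ^^ n) x) ((T ^^ n) y) < e \<Longrightarrow> infdist (x, y) R < \<epsilon>"
      using close_imp_near[OF pos] by blast
    have image: "map_prod T T ` (X \<times> X) \<subseteq> X \<times> X" by auto
    have small: "\<exists>n>0. Birkhoff_sum (map_prod T T) pair_dist n p < e * real n" if "p \<in> R" for p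
      using Banach_proximal_imp_small_average[of "fst p" "snd p" e] e that BPQ
      by (simp add: dist_sum_eq R_def)
    obtain N \<delta> where N: "\<delta> > 0"
      "\<And>p. p \<in> X \<times> X \<Longrightarrow> infdist p R < \<delta> \<Longrightarrow>
        \<exists>n>0. n \<le> N \<and> Birkhoff_sum (map_prod T T) pair_dist n p < e * real n"
      using Birkhoff_sum_small_near_compact[OF compact_pairs cont_pair_map image cont_pair_dist R(1,2,3) small]
      by blast
    have "infdist (x, y) R < \<epsilon>" if xy: "x \<in> X" "y \<in> X" and near: "infdist ((T ^^ n) x, (T ^^ n) y) R < \<delta>" for x y n
    proof -
      obtain m where m: "m > 0" "dist_sum T m ((T ^^ n) x) ((T ^^ n) y) < e * real m"
        using N(2)[OF _ near] xy by (auto simp: dist_sum_eq)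
      have "\<exists>i. dist ((T ^^ (i + n)) x) ((T ^^ (i + n)) y) < e"
      proof (rule ccontr)
        assume "\<not> ?thesis"
        then have "(\<Sum>i<m. e) \<le> dist_sum T m ((T ^^ n) x) ((T ^^ n) y)"
          unfolding dist_sum_def by (intro sum_mono) (simp add: funpow_add not_less)
        then show False using m by (simp add: mult.commute)
      qed
      then show ?thesis using e_imp xy by blast
    qed
    then show ?thesis using N(1) by blast
  qed
  \<comment> \<open>An approximate transitivity of \<open>R\<close>. A zero of \<open>?h\<close>
    consists of two pairs in \<open>R\<close> with a common first coordinate, to which symmetry and
    transitivity of Banach proximality apply.\<close>
  have compose: "\<exists>\<delta>>0. \<forall>x\<in>X. \<forall>x'\<in>X. \<forall>y\<in>X. \<forall>y'\<in>X. infdist (x, x') R < \<delta> \<longrightarrow> dist x y < \<delta> \<longrightarrow>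
      infdist (y, y') R < \<delta> \<longrightarrow> infdist (x', y') R < \<epsilon>" if pos: "\<epsilon> > 0" for \<epsilon>
  proof -
    let ?K = "(X \<times> X) \<times> (X \<times> X)"
    let ?f = "\<lambda>p. infdist (snd (fst p), snd (snd p)) R"
    let ?h = "\<lambda>p. infdist (fst p) R + dist (fst (fst p)) (fst (snd p)) + infdist (snd p) R"
    have "compact ?K" using compact_X by (intro compact_Times)
    moreover have "continuous_on ?K ?f" "continuous_on ?K ?h"
      by (intro continuous_intros)+
    moreover have "?h p \<ge> 0" for p
      by (simp add: infdist_nonneg)
    moreover have "?f p \<le> 0" if "?h p = 0" for p
    proof -
      have "infdist (fst p) R = 0" "fst (fst p) = fst (snd p)" "infdist (snd p) R = 0"
        using that infdist_nonneg[of "fst p" R] infdist_nonneg[of "snd p" R]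
          zero_le_dist[of "fst (fst p)" "fst (snd p)"] by (auto simp: add_nonneg_eq_0_iff)
      then have "fst p \<in> Banach_proximal_pairs X T" "snd p \<in> Banach_proximal_pairs X T"
        "fst (fst p) = fst (snd p)"
        using in_R by (auto simp: BPQ R_def)
      then have "(snd (fst p), snd (snd p)) \<in> Banach_proximal_pairs X T"
        using Banach_proximal_trans Banach_proximal_sym by (metis prod.collapse)
      then show ?thesis using BPQ by (simp add: R_def)
    qed
    ultimately obtain \<delta> where \<delta>: "\<delta> > 0" "\<And>p. p \<in> ?K \<Longrightarrow> ?h p < \<delta> \<Longrightarrow> ?f p < \<epsilon>"
      using compact_small_near_zeros[OF _ _ _ _ _ pos, of ?K ?f ?h] by blast
    have "infdist (x', y') R < \<epsilon>"
      if "x \<in> X" "x' \<in> X" "y \<in> X" "y' \<in> X" "infdist (x, x') R < \<delta> / 3" "dist x y < \<delta> / 3" "infdist (y, y') R < \<delta> / 3"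
      for x x' y y'
      using \<delta>(2)[of "((x, x'), (y, y'))"] that by simp
    then show ?thesis using \<delta>(1) by (intro exI[of _ "\<delta> / 3"]) auto
  qed
  \<comment> \<open>The radii are chosen backwards: \<open>a\<close> for the last pull-back from
    time \<open>l\<close> to time \<open>n\<close>, \<open>b\<close> for joining the two returns,
    \<open>c\<close> for pulling each return back to time 0.\<close>
  obtain a where a: "a > 0" "\<And>x y n. x \<in> X \<Longrightarrow> y \<in> X \<Longrightarrow> infdist ((T ^^ n) x, (T ^^ n) y) R < a \<Longrightarrow> infdist (x, y) R < \<epsilon>"
    using pull_back[OF \<open>\<epsilon> > 0\<close>] by blast
  obtain b where b: "b > 0" "\<And>x x' y y'. x \<in> X \<Longrightarrow> x' \<in> X \<Longrightarrow> y \<in> X \<Longrightarrow> y' \<in> X \<Longrightarrow>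
      infdist (x, x') R < b \<Longrightarrow> dist x y < b \<Longrightarrow> infdist (y, y') R < b \<Longrightarrow> infdist (x', y') R < a"
    using compose[OF a(1)] by blast
  obtain c where c: "c > 0" "\<And>x y n. x \<in> X \<Longrightarrow> y \<in> X \<Longrightarrow> infdist ((T ^^ n) x, (T ^^ n) y) R < c \<Longrightarrow> infdist (x, y) R < b"
    using pull_back[OF b(1)] by blast
  have "infdist ((T ^^ n) x, (T ^^ n) y) R < \<epsilon>" if xy: "x \<in> X" "y \<in> X" "dist x y < b" for x y n
  proof -
    obtain i l where l: "l \<ge> n" "dist ((T ^^ i) x) ((T ^^ (i + l)) x) < c" "dist ((T ^^ i) y) ((T ^^ (i + l)) y) < c"
      using recurrence_of_pairs[OF xy(1,2) c(1)] by blast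
    \<comment> \<open>The orbit of \<open>u\<close> nearly repeats itself between the times
      \<open>i\<close> and \<open>i + l\<close>. This need not be visible at time 0 in the metric,
      but pulling back by \<open>i\<close> shows that \<open>u\<close> and \<open>(T ^^ l) u\<close>
      are nearly related by \<open>R\<close>.\<close>
    have return: "infdist (u, (T ^^ l) u) R < b" if "u \<in> X" "dist ((T ^^ i) u) ((T ^^ (i + l)) u) < c" for u
    proof (rule c(2))
      have "infdist ((T ^^ i) u, (T ^^ i) ((T ^^ l) u)) R \<le> dist ((T ^^ i) u) ((T ^^ (i + l)) u)"
        using infdist_le_dist[of "(T ^^ i) u"] that(1) by (simp add: funpow_add)
      then show "infdist ((T ^^ i) u, (T ^^ i) ((T ^^ l) u)) R < c" using that(2) by simp
    qed (use that in auto)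
    have "infdist ((T ^^ l) x, (T ^^ l) y) R < a"
      by (rule b(2)[of x _ y]) (use xy return l in auto)
    \<comment> \<open>Because \<open>l \<ge> n\<close>, the pair at time \<open>l\<close> lies in
      the future of the pair at time \<open>n\<close>, so a pull-back reaches the latter.\<close>
    moreover have "(T ^^ l) u = (T ^^ (l - n)) ((T ^^ n) u)" for u
      using l(1) by (metis comp_apply funpow_add le_add_diff_inverse2)
    ultimately show ?thesis using a(2)[of "(T ^^ n) x" "(T ^^ n) y" "l - n"] xy by simp
  qed
  then show thesis using that[OF b(1)] by (simp add: R_def)
qed

lemma BP_eq_Q_imp_equicontinuous_in_the_mean:
  assumes BPQ: "Banach_proximal_pairs X T = regionally_proximal_pairs X T"
  shows "equicontinuous_in_the_mean X T"
proof (rule equicontinuous_in_the_meanI)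
  fix \<epsilon> :: real assume "\<epsilon> > 0"
  let ?R = "regionally_proximal_pairs X T"
  have R: "?R \<subseteq> X \<times> X" "?R \<noteq> {}"
  proof -
    show "?R \<subseteq> X \<times> X" by (auto simp: regionally_proximal_pairs_def)
    show "?R \<noteq> {}" using regionally_proximal_refl X_nonempty by blast
  qed
  have small: "\<exists>n>0. dist_sum T n x y < \<epsilon> * real n" if "(x, y) \<in> ?R" for x y
    using Banach_proximal_imp_small_average[of x y \<epsilon>] that \<open>\<epsilon> > 0\<close> by (simp add: BPQ)
  obtain \<delta> C where \<delta>: "\<delta> > 0" "\<And>x y n. x \<in> X \<Longrightarrow> y \<in> X \<Longrightarrow>
      (\<forall>i. infdist ((T ^^ i) x, (T ^^ i) y) ?R < \<delta>) \<Longrightarrow> dist_sum T n x y \<le> \<epsilon> * real n + C"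
    using dist_sum_le_of_orbit_near[OF compact_regionally_proximal R small \<open>\<epsilon> > 0\<close>] by meson
  obtain \<eta> where \<eta>: "\<eta> > 0" "\<And>x y n. x \<in> X \<Longrightarrow> y \<in> X \<Longrightarrow> dist x y < \<eta> \<Longrightarrow>
      infdist ((T ^^ n) x, (T ^^ n) y) ?R < \<delta>"
    using orbits_near_regionally_proximal[OF BPQ \<delta>(1)] by blast
  have "\<forall>x\<in>X. \<forall>y\<in>X. dist x y < \<eta> \<longrightarrow> (\<forall>n. dist_sum T n x y \<le> \<epsilon> * real n + C)"
  proof (intro ballI impI allI)
    fix x y n assume "x \<in> X" "y \<in> X" "dist x y < \<eta>"
    then show "dist_sum T n x y \<le> \<epsilon> * real n + C" by (intro \<delta>(2) \<eta>(2) allI)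
  qed
  then show "\<exists>\<delta>>0. \<exists>C. \<forall>x\<in>X. \<forall>y\<in>X. dist x y < \<delta> \<longrightarrow> (\<forall>n. dist_sum T n x y \<le> \<epsilon> * real n + C)"
    using \<eta>(1) by blast
qed

end

section \<open>The upper mean distance\<close>

text \<open>The Besicovitch pseudometric. On \<open>X\<close> the limit superior is bounded by the
  diameter, so the conversion to a real loses nothing there.\<close>

definition upper_mean_dist :: "('a::metric_space \<Rightarrow> 'a) \<Rightarrow> 'a \<Rightarrow> 'a \<Rightarrow> real" where
  "upper_mean_dist T x y = real_of_ereal (limsup (\<lambda>n. ereal (1 / real n * dist_sum T n x y)))"

context dynamical_system
begin

lemma mean_dist_le_diameter:
  assumes "x \<in> X" "y \<in> X"
  shows "1 / real n * dist_sum T n x y \<le> diameter X"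
proof (cases "n = 0")
  case False
  have "dist_sum T n x y \<le> (\<Sum>i<n. diameter X)"
    unfolding dist_sum_def by (intro sum_mono dist_le_diameter iter_in assms)
  then show ?thesis using False by (simp add: field_simps)
qed (simp add: diameter_nonneg)

lemma ereal_upper_mean_dist:
  assumes "x \<in> X" "y \<in> X"
  shows "ereal (upper_mean_dist T x y) = limsup (\<lambda>n. ereal (1 / real n * dist_sum T n x y))"
proof -
  let ?u = "\<lambda>n. ereal (1 / real n * dist_sum T n x y)"
  have "limsup ?u \<le> ereal (diameter X)"
    by (rule Limsup_bounded) (use mean_dist_le_diameter[OF assms] in auto)
  moreover have "0 \<le> limsup ?u"
    by (rule le_Limsup) (auto simp: dist_sum_nonneg)
  ultimately have "\<bar>limsup ?u\<bar> \<noteq> \<infinity>" by auto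
  then show ?thesis unfolding upper_mean_dist_def by (rule ereal_real')
qed

lemma upper_mean_dist_nonneg:
  assumes "x \<in> X" "y \<in> X"
  shows "0 \<le> upper_mean_dist T x y"
proof -
  have "0 \<le> limsup (\<lambda>n. ereal (1 / real n * dist_sum T n x y))"
    by (rule le_Limsup) (auto simp: dist_sum_nonneg)
  then show ?thesis using ereal_upper_mean_dist[OF assms] by (metis ereal_less_eq(5))
qed

lemma upper_mean_dist_sym: "upper_mean_dist T x y = upper_mean_dist T y x"
  by (simp add: upper_mean_dist_def dist_sum_def dist_commute)

lemma upper_mean_dist_triangle:
  assumes "x \<in> X" "y \<in> X" "z \<in> X"
  shows "upper_mean_dist T x z \<le> upper_mean_dist T x y + upper_mean_dist T y z"
proof -
  let ?u = "\<lambda>x y n. 1 / real n * dist_sum T n x y"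
  have "?u x z n \<le> ?u x y n + ?u y z n" for n
  proof -
    have "dist_sum T n x z \<le> dist_sum T n x y + dist_sum T n y z"
      unfolding dist_sum_def sum.distrib[symmetric] by (intro sum_mono dist_triangle)
    then show ?thesis by (simp add: divide_right_mono add_divide_distrib[symmetric])
  qed
  then have "limsup (\<lambda>n. ereal (?u x z n)) \<le> limsup (\<lambda>n. ereal (?u x y n) + ereal (?u y z n))"
    by (intro Limsup_mono) simp
  also have "\<dots> \<le> limsup (\<lambda>n. ereal (?u x y n)) + limsup (\<lambda>n. ereal (?u y z n))"
    by (rule ereal_limsup_add_mono)
  finally have "ereal (upper_mean_dist T x z) \<le> ereal (upper_mean_dist T x y) + ereal (upper_mean_dist T y z)"
    using assms by (simp only: ereal_upper_mean_dist)
  then show ?thesis by simp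
qed

text \<open>Shifting changes the sum of the first \<open>n\<close> distances by two boundary terms
  only; their difference divided by \<open>n\<close> is the null sequence \<open>w\<close>.\<close>

lemma upper_mean_dist_shift:
  assumes "x \<in> X" "y \<in> X"
  shows "upper_mean_dist T (T x) (T y) = upper_mean_dist T x y"
proof -
  let ?u = "\<lambda>x y n. 1 / real n * dist_sum T n x y"
  define w where "w = (\<lambda>n. 1 / real n * (dist ((T ^^ n) x) ((T ^^ n) y) - dist x y))"
  have "\<bar>dist ((T ^^ n) x) ((T ^^ n) y) - dist x y\<bar> \<le> diameter X" for n
    using dist_le_diameter[of "(T ^^ n) x" "(T ^^ n) y"] dist_le_diameter[of x y] assms
    by (simp add: abs_le_iff) (smt (verit) zero_le_dist)
  then have w: "norm (w n) \<le> diameter X * (1 / real n)" for n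
    unfolding w_def by (auto simp: abs_mult divide_right_mono)
  have "(\<lambda>n. diameter X * (1 / real n)) \<longlonglongrightarrow> 0"
    using tendsto_mult_right_zero[OF lim_1_over_n] .
  then have "w \<longlonglongrightarrow> 0"
    by (rule Lim_null_comparison[rotated]) (use w in auto)
  then have "(\<lambda>n. ereal (w n)) \<longlonglongrightarrow> ereal 0" by (intro tendsto_ereal)
  then have "limsup (\<lambda>n. ereal (w n) + ereal (?u x y n)) = ereal 0 + limsup (\<lambda>n. ereal (?u x y n))"
    by (rule ereal_limsup_lim_add) simp
  moreover have "ereal (w n) + ereal (?u x y n) = ereal (?u (T x) (T y) n)" for n
  proof -
    have "dist_sum T (Suc n) x y = dist x y + dist_sum T n (T x) (T y)"
      unfolding dist_sum_def by (subst sum.lessThan_Suc_shift) (simp add: funpow_swap1)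
    moreover have "dist_sum T (Suc n) x y = dist_sum T n x y + dist ((T ^^ n) x) ((T ^^ n) y)"
      by (simp add: dist_sum_def)
    ultimately have "dist_sum T n (T x) (T y) = dist ((T ^^ n) x) ((T ^^ n) y) - dist x y + dist_sum T n x y"
      by simp
    then show ?thesis by (simp add: w_def add_divide_distrib)
  qed
  ultimately show ?thesis unfolding upper_mean_dist_def by (simp add: zero_ereal_def[symmetric])
qed

lemma upper_mean_dist_shift_iter:
  assumes "x \<in> X" "y \<in> X"
  shows "upper_mean_dist T ((T ^^ n) x) ((T ^^ n) y) = upper_mean_dist T x y"
  using assms by (induction n) (simp_all add: upper_mean_dist_shift)

lemma upper_mean_dist_zero_imp_small_average:
  assumes "x \<in> X" "y \<in> X" "upper_mean_dist T x y = 0" "\<epsilon> > 0"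
  shows "\<exists>n>0. dist_sum T n x y < \<epsilon> * real n"
proof -
  have "limsup (\<lambda>n. ereal (1 / real n * dist_sum T n x y)) < ereal \<epsilon>"
    unfolding ereal_upper_mean_dist[OF assms(1,2), symmetric] using assms(3,4) by simp
  then have "\<forall>\<^sub>F n in sequentially. ereal (1 / real n * dist_sum T n x y) < ereal \<epsilon>"
    by (rule Limsup_lessD)
  then have "\<forall>\<^sub>F n in sequentially. 0 < n \<and> 1 / real n * dist_sum T n x y < \<epsilon>"
    using eventually_gt_at_top[of "0::nat"] by eventually_elim simp
  then obtain n where "0 < n" "1 / real n * dist_sum T n x y < \<epsilon>"
    using eventually_happens'[OF sequentially_bot] by blast
  then show ?thesis by (intro exI[of _ n]) (simp add: field_simps)
qed

end

locale mean_equicontinuous_system = dynamical_system +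
  assumes mean_equi: "mean_equicontinuous X T"
begin

lemma upper_mean_dist_small:
  assumes "\<epsilon> > 0"
  shows "\<exists>\<delta>>0. \<forall>x\<in>X. \<forall>y\<in>X. dist x y < \<delta> \<longrightarrow> upper_mean_dist T x y < \<epsilon>"
proof -
  obtain \<delta> where \<delta>: "\<delta> > 0" "\<forall>x\<in>X. \<forall>y\<in>X. dist x y < \<delta> \<longrightarrow>
      limsup (\<lambda>n. ereal (1 / real n * (\<Sum>i<n. dist ((T ^^ i) x) ((T ^^ i) y)))) < ereal \<epsilon>"
    using mean_equi assms unfolding mean_equicontinuous_def by meson
  have "upper_mean_dist T x y < \<epsilon>" if "x \<in> X" "y \<in> X" "dist x y < \<delta>" for x y
  proof -
    have "ereal (upper_mean_dist T x y) < ereal \<epsilon>"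
      using \<delta>(2) that unfolding ereal_upper_mean_dist[OF that(1,2)] dist_sum_def by blast
    then show ?thesis by simp
  qed
  then show ?thesis using \<delta>(1) by blast
qed

definition mean_zero :: "('a \<times> 'a) set" where
  "mean_zero = {(x, y) \<in> X \<times> X. upper_mean_dist T x y = 0}"

text \<open>Go from \<open>x\<close> to \<open>x'\<close>, from \<open>x'\<close> to
  \<open>y'\<close> and from \<open>y'\<close> to \<open>y\<close>. The outer legs are short in the
  metric; invariance allows measuring the middle leg at the time \<open>n\<close> when the two
  orbits are close.\<close>

lemma regionally_proximal_subset_mean_zero: "regionally_proximal_pairs X T \<subseteq> mean_zero"
proof (rule subrelI)
  fix x y assume xy: "(x, y) \<in> regionally_proximal_pairs X T"
  then have in_X: "x \<in> X" "y \<in> X" by (simp_all add: regionally_proximal_pairs_def)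
  have "upper_mean_dist T x y \<le> 0"
  proof (rule field_le_epsilon)
    fix e :: real assume "e > 0"
    then have "e / 3 > 0" by simp
    then obtain d where d: "d > 0" "\<And>x y. x \<in> X \<Longrightarrow> y \<in> X \<Longrightarrow> dist x y < d \<Longrightarrow> upper_mean_dist T x y < e / 3"
      using upper_mean_dist_small by meson
    have "\<exists>x'\<in>X. \<exists>y'\<in>X. dist x x' < d \<and> dist y y' < d \<and> (\<exists>n>0. dist ((T ^^ n) x') ((T ^^ n) y') < d)"
      using xy d(1) by (simp add: regionally_proximal_pairs_def)
    then obtain x' y' n where *: "x' \<in> X" "y' \<in> X" "dist x x' < d" "dist y y' < d"
      "dist ((T ^^ n) x') ((T ^^ n) y') < d" by blast
    have "upper_mean_dist T x y \<le> upper_mean_dist T x x' + upper_mean_dist T x' y"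
      using in_X * by (intro upper_mean_dist_triangle)
    also have "upper_mean_dist T x' y \<le> upper_mean_dist T x' y' + upper_mean_dist T y' y"
      using in_X * by (intro upper_mean_dist_triangle)
    finally have "upper_mean_dist T x y \<le>
        upper_mean_dist T x x' + (upper_mean_dist T x' y' + upper_mean_dist T y' y)" by simp
    moreover have "upper_mean_dist T x x' < e / 3" using d(2) in_X * by blast
    moreover have "upper_mean_dist T y' y < e / 3"
      using d(2)[OF in_X(2) *(2,4)] upper_mean_dist_sym[of y y'] by simp
    moreover have "upper_mean_dist T x' y' < e / 3"
      using d(2)[OF _ _ *(5)] * upper_mean_dist_shift_iter[OF *(1,2)] by simp
    ultimately show "upper_mean_dist T x y \<le> 0 + e" by simp
  qed
  then show "(x, y) \<in> mean_zero"
    using in_X upper_mean_dist_nonneg[OF in_X] by (simp add: mean_zero_def)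
qed

lemma compact_mean_zero: "compact mean_zero"
proof -
  have "closure mean_zero \<subseteq> mean_zero"
  proof
    fix p assume p: "p \<in> closure mean_zero"
    obtain x y where xy: "p = (x, y)" by fastforce
    have "closed (X \<times> X)" using compact_pairs by (rule compact_imp_closed)
    then have "closure mean_zero \<subseteq> X \<times> X"
      by (intro closure_minimal) (auto simp: mean_zero_def)
    then have in_X: "x \<in> X" "y \<in> X" using p xy by auto
    have "upper_mean_dist T x y \<le> 0"
    proof (rule field_le_epsilon)
      fix e :: real assume "e > 0"
      then have "e / 2 > 0" by simp
      then obtain d where d: "d > 0" "\<And>x y. x \<in> X \<Longrightarrow> y \<in> X \<Longrightarrow> dist x y < d \<Longrightarrow> upper_mean_dist T x y < e / 2"
        using upper_mean_dist_small by meson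
      have "\<exists>q\<in>mean_zero. dist q p < d"
        using p d(1) by (simp add: closure_approachable)
      then obtain a b where ab: "(a, b) \<in> mean_zero" "dist (a, b) p < d"
        by (metis surj_pair)
      then have *: "a \<in> X" "b \<in> X" "upper_mean_dist T a b = 0" "dist a x < d" "dist b y < d"
        using dist_fst_le[of "(a, b)" p] dist_snd_le[of "(a, b)" p] by (auto simp: mean_zero_def xy)
      have "upper_mean_dist T x y \<le> upper_mean_dist T x a + upper_mean_dist T a y"
        using in_X * by (intro upper_mean_dist_triangle)
      also have "upper_mean_dist T a y \<le> upper_mean_dist T a b + upper_mean_dist T b y"
        using in_X * by (intro upper_mean_dist_triangle)
      finally have "upper_mean_dist T x y \<le>
          upper_mean_dist T x a + (upper_mean_dist T a b + upper_mean_dist T b y)" by simp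
      moreover have "upper_mean_dist T x a < e / 2"
        using d(2)[OF *(1) in_X(1) *(4)] upper_mean_dist_sym[of x a] by simp
      moreover have "upper_mean_dist T b y < e / 2" using d(2)[OF *(2) in_X(2) *(5)] .
      ultimately show "upper_mean_dist T x y \<le> 0 + e" using *(3) by simp
    qed
    then show "p \<in> mean_zero"
      using in_X upper_mean_dist_nonneg[OF in_X] by (simp add: mean_zero_def xy)
  qed
  then have "closed mean_zero" by (simp add: closure_subset_eq)
  moreover have "mean_zero = (X \<times> X) \<inter> mean_zero" by (auto simp: mean_zero_def)
  ultimately show ?thesis using compact_Int_closed[OF compact_pairs] by metis
qed

text \<open>Upper mean distance 0 concerns windows starting at time 0. Compactness and invariance of
  the relation upgrade it to all windows, as Banach density demands.\<close>

lemma mean_zero_subset_Banach_proximal: "mean_zero \<subseteq> Banach_proximal_pairs X T"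
proof (rule small_averages_imp_Banach_proximal[OF compact_mean_zero])
  show "mean_zero \<subseteq> X \<times> X" by (auto simp: mean_zero_def)
  show "(T x, T y) \<in> mean_zero" if "(x, y) \<in> mean_zero" for x y
    using that by (auto simp: mean_zero_def upper_mean_dist_shift)
  show "\<exists>n>0. dist_sum T n x y < \<epsilon> * real n" if "(x, y) \<in> mean_zero" "\<epsilon> > 0" for x y \<epsilon>
    using that upper_mean_dist_zero_imp_small_average by (auto simp: mean_zero_def)
qed

lemma proximal_relations_coincide:
  "Banach_proximal_pairs X T = proximal_pairs X T \<and> proximal_pairs X T = regionally_proximal_pairs X T"
  using mean_zero_subset_Banach_proximal regionally_proximal_subset_mean_zero
    Banach_proximal_subset_proximal proximal_subset_regionally_proximal by blast

text \<open>The quotient by \<open>mean_zero\<close> is realised by a Kuratowski embedding whose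
  coordinates are the upper mean distances to a dense sequence. Bounded sequences are the target
  because \<open>maximal_equicontinuous_factor\<close> states its universal property there.\<close>

lemma mean_isometric_factor:
  "\<exists>(W :: (nat \<Rightarrow>\<^sub>C real) set) U \<phi>. factor_map X T W U \<phi> \<and> equicontinuous W U \<and>
    (\<forall>x\<in>X. \<forall>y\<in>X. dist (\<phi> x) (\<phi> y) = upper_mean_dist T x y)"
proof -
  let ?D = "upper_mean_dist T"
  obtain d :: "nat \<Rightarrow> 'a" where "\<forall>n. d n \<in> X" "\<forall>x\<in>X. \<forall>e>0. \<exists>n. dist (d n) x < e"
    using compact_dense_sequence[OF compact_X X_nonempty] by blast
  note d = this[rule_format]
  have D_le: "\<bar>?D x (d n) - ?D y (d n)\<bar> \<le> ?D x y" if "x \<in> X" "y \<in> X" for x y n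
    using upper_mean_dist_triangle[OF that(1,2) d(1), of n] upper_mean_dist_triangle[OF that(2,1) d(1), of n]
      upper_mean_dist_sym[of x y] by linarith
  define \<phi> where "\<phi> = (\<lambda>x. Bcontfun (\<lambda>n. ?D x (d n)))"
  have apply_\<phi>: "apply_bcontfun (\<phi> x) = (\<lambda>n. ?D x (d n))" if "x \<in> X" for x
  proof -
    have "norm (?D x (d n)) \<le> diameter X" for n
    proof -
      have "ereal (?D x (d n)) \<le> ereal (diameter X)"
        unfolding ereal_upper_mean_dist[OF that d(1)]
        by (rule Limsup_bounded) (use mean_dist_le_diameter[OF that d(1)] in auto)
      then show ?thesis using upper_mean_dist_nonneg[OF that d(1), of n] by simp
    qed
    then have "bounded (range (\<lambda>n. ?D x (d n)))" unfolding bounded_iff by blast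
    then have "(\<lambda>n. ?D x (d n)) \<in> bcontfun" by (simp add: bcontfun_def)
    then show ?thesis by (simp add: \<phi>_def Bcontfun_inverse)
  qed
  have dist_\<phi>: "dist (\<phi> x) (\<phi> y) = ?D x y" if xy: "x \<in> X" "y \<in> X" for x y
  proof (rule antisym)
    show "dist (\<phi> x) (\<phi> y) \<le> ?D x y"
      by (rule dist_bound) (use D_le that in \<open>simp add: apply_\<phi> dist_real_def\<close>)
    show "?D x y \<le> dist (\<phi> x) (\<phi> y)"
    proof (rule field_le_epsilon)
      fix e :: real assume "e > 0"
      then have "e / 2 > 0" by simp
      then obtain \<delta> where \<delta>: "\<delta> > 0" "\<And>x y. x \<in> X \<Longrightarrow> y \<in> X \<Longrightarrow> dist x y < \<delta> \<Longrightarrow> ?D x y < e / 2"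
        using upper_mean_dist_small by meson
      obtain n where n: "dist (d n) x < \<delta>" using d(2)[OF xy(1) \<delta>(1)] by blast
      have "?D (d n) x < e / 2" using \<delta>(2)[OF d(1) that(1) n] .
      moreover have "\<bar>?D x (d n) - ?D y (d n)\<bar> \<le> dist (\<phi> x) (\<phi> y)"
        using dist_bounded[of "\<phi> x" n "\<phi> y"] that by (simp add: apply_\<phi> dist_real_def)
      moreover have "?D x y \<le> ?D x (d n) + ?D (d n) y"
        using upper_mean_dist_triangle[OF that(1) d(1) that(2)] .
      ultimately show "?D x y \<le> dist (\<phi> x) (\<phi> y) + e"
        using upper_mean_dist_sym[of x "d n"] upper_mean_dist_sym[of y "d n"] by linarith
    qed
  qed
  \<comment> \<open>Any preimage will do: points with the same image have upper mean distance 0,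
    which \<open>T\<close> preserves.\<close>
  define U where "U = (\<lambda>w. \<phi> (T (inv_into X \<phi> w)))"
  have U: "U (\<phi> x) = \<phi> (T x)" if "x \<in> X" for x
  proof -
    let ?x = "inv_into X \<phi> (\<phi> x)"
    have x: "?x \<in> X" "\<phi> ?x = \<phi> x" using that by (auto intro: inv_into_into f_inv_into_f)
    then have "?D ?x x = 0" using dist_\<phi>[OF x(1) that] by simp
    then have "dist (\<phi> (T ?x)) (\<phi> (T x)) = 0"
      using x(1) that by (simp add: dist_\<phi> upper_mean_dist_shift)
    then show ?thesis by (simp add: U_def)
  qed
  have U_iso: "dist (U v) (U w) = dist v w" if "v \<in> \<phi> ` X" "w \<in> \<phi> ` X" for v w
    using that by (auto simp: U dist_\<phi> upper_mean_dist_shift)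
  have U_in: "U ` (\<phi> ` X) \<subseteq> \<phi> ` X" by (auto simp: U)
  have cont_\<phi>: "continuous_on X \<phi>"
    unfolding continuous_on_iff
  proof (intro ballI allI impI)
    fix x and e :: real assume "x \<in> X" "0 < e"
    then obtain \<delta> where "\<delta> > 0" "\<forall>x\<in>X. \<forall>y\<in>X. dist x y < \<delta> \<longrightarrow> ?D x y < e"
      using upper_mean_dist_small by blast
    then show "\<exists>d>0. \<forall>x'\<in>X. dist x' x < d \<longrightarrow> dist (\<phi> x') (\<phi> x) < e"
      using \<open>x \<in> X\<close> dist_\<phi> by (intro exI[of _ \<delta>]) simp
  qed
  have "continuous_on (\<phi> ` X) U"
    unfolding continuous_on_iff using U_iso by metis
  then have "topological_dynamical_system (\<phi> ` X) U"
    unfolding topological_dynamical_system_def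
    using X_nonempty U_in compact_continuous_image[OF cont_\<phi> compact_X] by simp
  then have "factor_map X T (\<phi> ` X) U \<phi>"
    unfolding factor_map_def using tds cont_\<phi> U by simp
  moreover have "equicontinuous (\<phi> ` X) U"
    unfolding equicontinuous_def
  proof (intro allI impI)
    fix e :: real assume "e > 0"
    have "dist ((U ^^ n) v) ((U ^^ n) w) = dist v w" if "v \<in> \<phi> ` X" "w \<in> \<phi> ` X" for v w n
    proof (induction n)
      case (Suc n)
      then show ?case using U_iso funpow_in_carrier[OF U_in] that by simp
    qed simp
    then show "\<exists>\<delta>>0. \<forall>x\<in>\<phi> ` X. \<forall>y\<in>\<phi> ` X. dist x y < \<delta> \<longrightarrow> (\<forall>n. dist ((U ^^ n) x) ((U ^^ n) y) < e)"
      using \<open>e > 0\<close> by (intro exI[of _ e]) simp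
  qed
  ultimately show ?thesis using dist_\<phi> by blast
qed

text \<open>Here maximality enters: the isometric factor \<open>\<phi>\<close> factors through
  \<open>\<pi>\<close>, so it identifies the points of each fibre.\<close>

lemma Banach_proximal_map_mef:
  assumes "maximal_equicontinuous_factor X T Z S \<pi>"
  shows "Banach_proximal_map X T \<pi>"
  unfolding Banach_proximal_map_def
proof (intro ballI impI)
  fix x y assume xy: "x \<in> X" "y \<in> X" "\<pi> x = \<pi> y"
  obtain W :: "(nat \<Rightarrow>\<^sub>C real) set" and U \<phi> where \<phi>: "factor_map X T W U \<phi>" "equicontinuous W U"
    "\<forall>x\<in>X. \<forall>y\<in>X. dist (\<phi> x) (\<phi> y) = upper_mean_dist T x y"
    using mean_isometric_factor by blast
  obtain \<psi> where "\<And>x. x \<in> X \<Longrightarrow> \<phi> x = \<psi> (\<pi> x)"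
    using assms \<phi>(1,2) unfolding maximal_equicontinuous_factor_def by metis
  then have "\<phi> x = \<phi> y" using xy by simp
  moreover have "upper_mean_dist T x y = dist (\<phi> x) (\<phi> y)" using \<phi>(3) xy by simp
  ultimately have "(x, y) \<in> mean_zero" using xy by (simp add: mean_zero_def)
  then show "(x, y) \<in> Banach_proximal_pairs X T" using mean_zero_subset_Banach_proximal by blast
qed

end

section \<open>Equicontinuous factors\<close>

lemma (in dynamical_system) equicontinuous_in_the_mean_imp_mean_equicontinuous:
  assumes "equicontinuous_in_the_mean X T"
  shows "mean_equicontinuous X T"
  unfolding mean_equicontinuous_def
proof (intro allI impI)
  fix \<epsilon> :: real assume "\<epsilon> > 0"
  \<comment> \<open>Passing to the limit superior preserves only the weak inequality, hence the
    half.\<close>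
  then have "\<epsilon> / 2 > 0" by simp
  then obtain \<delta> where \<delta>: "\<delta> > 0" "\<forall>n\<ge>1. \<forall>x\<in>X. \<forall>y\<in>X. dist x y < \<delta> \<longrightarrow>
      1 / real n * (\<Sum>i<n. dist ((T ^^ i) x) ((T ^^ i) y)) < \<epsilon> / 2"
    using assms unfolding equicontinuous_in_the_mean_def by meson
  have "limsup (\<lambda>n. ereal (1 / real n * (\<Sum>i<n. dist ((T ^^ i) x) ((T ^^ i) y)))) < ereal \<epsilon>"
    if "x \<in> X" "y \<in> X" "dist x y < \<delta>" for x y
  proof -
    have "limsup (\<lambda>n. ereal (1 / real n * (\<Sum>i<n. dist ((T ^^ i) x) ((T ^^ i) y)))) \<le> ereal (\<epsilon> / 2)"
    proof (rule Limsup_bounded)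
      show "\<forall>\<^sub>F n in sequentially. ereal (1 / real n * (\<Sum>i<n. dist ((T ^^ i) x) ((T ^^ i) y))) \<le> ereal (\<epsilon> / 2)"
        using eventually_ge_at_top[of "1::nat"]
      proof eventually_elim
        case (elim n)
        then have "1 / real n * (\<Sum>i<n. dist ((T ^^ i) x) ((T ^^ i) y)) < \<epsilon> / 2"
          using \<delta>(2) that by blast
        then show ?case by (simp only: ereal_less_eq less_imp_le)
      qed
    qed
    also have "\<dots> < ereal \<epsilon>" using \<open>\<epsilon> > 0\<close> by simp
    finally show ?thesis .
  qed
  then show "\<exists>\<delta>>0. \<forall>x\<in>X. \<forall>y\<in>X. dist x y < \<delta> \<longrightarrow>
      limsup (\<lambda>n. ereal (1 / real n * (\<Sum>i<n. dist ((T ^^ i) x) ((T ^^ i) y)))) < ereal \<epsilon>"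
    using \<delta>(1) by blast
qed

locale equicontinuous_factor = dynamical_system X T
  for X :: "'a::metric_space set" and T :: "'a \<Rightarrow> 'a" +
  fixes Z :: "'b::metric_space set" and S :: "'b \<Rightarrow> 'b" and \<pi> :: "'a \<Rightarrow> 'b"
  assumes factor: "factor_map X T Z S \<pi>" and equi: "equicontinuous Z S"
begin

sublocale Z: dynamical_system Z S
  using factor by unfold_locales (simp add: factor_map_def)

lemma cont_\<pi>: "continuous_on X \<pi>" and \<pi>_image: "\<pi> ` X = Z" and \<pi>_T: "x \<in> X \<Longrightarrow> \<pi> (T x) = S (\<pi> x)"
  using factor by (simp_all add: factor_map_def)

lemma \<pi>_in [intro, simp]: "x \<in> X \<Longrightarrow> \<pi> x \<in> Z"
  using \<pi>_image by blast

lemma \<pi>_iter: "x \<in> X \<Longrightarrow> \<pi> ((T ^^ n) x) = (S ^^ n) (\<pi> x)"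
  by (induction n) (simp_all add: \<pi>_T)

definition fiber_pairs :: "('a \<times> 'a) set" where
  "fiber_pairs = {(x, y) \<in> X \<times> X. \<pi> x = \<pi> y}"

lemma fiber_pairs_subset: "fiber_pairs \<subseteq> X \<times> X"
  by (auto simp: fiber_pairs_def)

lemma fiber_pairs_nonempty: "fiber_pairs \<noteq> {}"
  using X_nonempty by (auto simp: fiber_pairs_def)

lemma fiber_pairs_shift: "(x, y) \<in> fiber_pairs \<Longrightarrow> (T x, T y) \<in> fiber_pairs"
  by (auto simp: fiber_pairs_def \<pi>_T)

lemma cont_fst_snd: "continuous_on (X \<times> X) (\<lambda>p. \<pi> (fst p))" "continuous_on (X \<times> X) (\<lambda>p. \<pi> (snd p))"
  by (rule continuous_on_compose2[OF cont_\<pi>]; auto intro: continuous_intros)+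

lemma compact_fiber_pairs: "compact fiber_pairs"
proof -
  have "continuous_on (X \<times> X) (\<lambda>p. dist (\<pi> (fst p)) (\<pi> (snd p)))"
    by (intro continuous_on_dist cont_fst_snd)
  then have "closedin (top_of_set (X \<times> X)) ((X \<times> X) \<inter> (\<lambda>p. dist (\<pi> (fst p)) (\<pi> (snd p))) -` {0})"
    by (rule continuous_closedin_preimage) simp
  moreover have "(X \<times> X) \<inter> (\<lambda>p. dist (\<pi> (fst p)) (\<pi> (snd p))) -` {0} = fiber_pairs"
    by (auto simp: fiber_pairs_def)
  ultimately show ?thesis using closedin_compact[OF compact_pairs] by metis
qed

text \<open>The fibre relation is compact and invariant, so small averages from time 0 suffice. The
  negation yields a pair whose averages are bounded below at every length, the input of the
  Krylov-Bogoliubov argument.\<close>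

lemma Banach_proximal_map_iff:
  "Banach_proximal_map X T \<pi> \<longleftrightarrow> (\<forall>x y \<epsilon>. (x, y) \<in> fiber_pairs \<longrightarrow> \<epsilon> > 0 \<longrightarrow> (\<exists>n>0. dist_sum T n x y < \<epsilon> * real n))"
    (is "_ \<longleftrightarrow> ?small")
proof
  assume "Banach_proximal_map X T \<pi>"
  then have "(x, y) \<in> Banach_proximal_pairs X T" if "(x, y) \<in> fiber_pairs" for x y
    using that unfolding Banach_proximal_map_def fiber_pairs_def by blast
  then show ?small using Banach_proximal_imp_small_average by blast
next
  assume ?small
  then have "fiber_pairs \<subseteq> Banach_proximal_pairs X T"
    by (intro small_averages_imp_Banach_proximal[OF compact_fiber_pairs fiber_pairs_subset fiber_pairs_shift]) auto
  then show "Banach_proximal_map X T \<pi>"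
    unfolding Banach_proximal_map_def fiber_pairs_def by blast
qed

text \<open>Equicontinuity of \<open>S\<close> keeps the images close at all times, and compactness
  turns close images into closeness to the fibre relation.\<close>

lemma near_fibers:
  assumes "\<delta> > 0"
  shows "\<exists>\<eta>>0. \<forall>x\<in>X. \<forall>y\<in>X. dist (\<pi> x) (\<pi> y) < \<eta> \<longrightarrow> (\<forall>n. infdist ((T ^^ n) x, (T ^^ n) y) fiber_pairs < \<delta>)"
proof -
  have c1: "continuous_on (X \<times> X) (\<lambda>p. infdist p fiber_pairs)"
    by (intro continuous_intros)
  have c2: "continuous_on (X \<times> X) (\<lambda>p. dist (\<pi> (fst p)) (\<pi> (snd p)))"
    by (intro continuous_on_dist cont_fst_snd)
  have z: "infdist p fiber_pairs \<le> 0" if "p \<in> X \<times> X" "dist (\<pi> (fst p)) (\<pi> (snd p)) = 0" for p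
  proof -
    have "p \<in> fiber_pairs" using that by (auto simp: fiber_pairs_def)
    then show ?thesis by simp
  qed
  obtain e where e: "e > 0"
    "\<And>p. p \<in> X \<times> X \<Longrightarrow> dist (\<pi> (fst p)) (\<pi> (snd p)) < e \<Longrightarrow> infdist p fiber_pairs < \<delta>"
    using compact_small_near_zeros[OF compact_pairs c1 c2 zero_le_dist z assms] by blast
  obtain \<eta> where \<eta>: "\<eta> > 0" "\<forall>x\<in>Z. \<forall>y\<in>Z. dist x y < \<eta> \<longrightarrow> (\<forall>n. dist ((S ^^ n) x) ((S ^^ n) y) < e)"
    using equi e(1) unfolding equicontinuous_def by meson
  have "infdist ((T ^^ n) x, (T ^^ n) y) fiber_pairs < \<delta>" if "x \<in> X" "y \<in> X" "dist (\<pi> x) (\<pi> y) < \<eta>" for x y n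
  proof (rule e(2))
    show "dist (\<pi> (fst ((T ^^ n) x, (T ^^ n) y))) (\<pi> (snd ((T ^^ n) x, (T ^^ n) y))) < e"
      using \<eta>(2) that by (simp add: \<pi>_iter)
  qed (use that in auto)
  then show ?thesis using \<eta>(1) by blast
qed

text \<open>Closeness is measured in \<open>Z\<close> rather than in \<open>X\<close>; this form
  permits one representative per small piece of \<open>Z\<close> when sections are built.\<close>

lemma dist_sum_le_of_near_fiber:
  assumes "Banach_proximal_map X T \<pi>" "\<epsilon> > 0"
  shows "\<exists>\<delta>>0. \<exists>C. \<forall>x\<in>X. \<forall>y\<in>X. dist (\<pi> x) (\<pi> y) < \<delta> \<longrightarrow> (\<forall>n. dist_sum T n x y \<le> \<epsilon> * real n + C)"
proof -
  have "\<exists>n>0. dist_sum T n x y < \<epsilon> * real n" if "(x, y) \<in> fiber_pairs" for x y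
    using assms that unfolding Banach_proximal_map_iff by blast
  from dist_sum_le_of_orbit_near[OF compact_fiber_pairs fiber_pairs_subset fiber_pairs_nonempty this assms(2)]
  obtain \<delta> C where \<delta>: "\<delta> > 0" "\<forall>x\<in>X. \<forall>y\<in>X. (\<forall>i. infdist ((T ^^ i) x, (T ^^ i) y) fiber_pairs < \<delta>) \<longrightarrow>
      (\<forall>n. dist_sum T n x y \<le> \<epsilon> * real n + C)" by blast
  obtain \<eta> where "\<eta> > 0" "\<forall>x\<in>X. \<forall>y\<in>X. dist (\<pi> x) (\<pi> y) < \<eta> \<longrightarrow> (\<forall>n. infdist ((T ^^ n) x, (T ^^ n) y) fiber_pairs < \<delta>)"
    using near_fibers[OF \<delta>(1)] by blast
  then show ?thesis using \<delta>(2) by blast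
qed

lemma Banach_proximal_map_imp_equicontinuous_in_the_mean:
  assumes "Banach_proximal_map X T \<pi>"
  shows "equicontinuous_in_the_mean X T"
proof (rule equicontinuous_in_the_meanI)
  fix \<epsilon> :: real assume "\<epsilon> > 0"
  then obtain \<delta> C where \<delta>: "\<delta> > 0"
    "\<forall>x\<in>X. \<forall>y\<in>X. dist (\<pi> x) (\<pi> y) < \<delta> \<longrightarrow> (\<forall>n. dist_sum T n x y \<le> \<epsilon> * real n + C)"
    using dist_sum_le_of_near_fiber[OF assms] by blast
  have "uniformly_continuous_on X \<pi>"
    using compact_uniformly_continuous[OF cont_\<pi> compact_X] .
  then obtain \<eta> where "\<eta> > 0" "\<forall>x\<in>X. \<forall>y\<in>X. dist y x < \<eta> \<longrightarrow> dist (\<pi> y) (\<pi> x) < \<delta>"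
    using \<delta>(1) unfolding uniformly_continuous_on_def by blast
  then show "\<exists>\<delta>>0. \<exists>C. \<forall>x\<in>X. \<forall>y\<in>X. dist x y < \<delta> \<longrightarrow> (\<forall>n. dist_sum T n x y \<le> \<epsilon> * real n + C)"
    using \<delta>(2) by blast
qed

end

section \<open>Invariant measures\<close>

text \<open>Closed sets form an intersection-stable generator, and the indicator of a nonempty
  closed set is the limit of the continuous cut-offs
  \<open>max 0 (1 - real j * infdist x A)\<close>.\<close>

lemma measure_eqI_continuous_integrals:
  fixes K :: "'c::metric_space set"
  assumes K: "compact K"
    and M: "prob_space M" "sets M = sets (restrict_space borel K)"
    and N: "prob_space N" "sets N = sets (restrict_space borel K)"
    and int: "\<And>g :: 'c \<Rightarrow> real. continuous_on K g \<Longrightarrow> integral\<^sup>L M g = integral\<^sup>L N g"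
  shows "M = N"
proof -
  interpret M: prob_space M by fact
  interpret N: prob_space N by fact
  let ?E = "(\<inter>) K ` {A. closed A}"
  have "K \<in> sigma_sets UNIV {A. closed A}" using compact_imp_closed[OF K] by blast
  then have "(\<inter>) K ` sigma_sets UNIV {A. closed A} = sigma_sets K ?E"
    by (intro sigma_sets_Int) auto
  then have sets: "sets (restrict_space borel K) = sigma_sets K ?E"
    by (simp add: sets_restrict_space borel_eq_closed)
  have spM: "space M = K" using sets_eq_imp_space_eq[OF M(2)] by (simp add: space_restrict_space)
  have spN: "space N = K" using sets_eq_imp_space_eq[OF N(2)] by (simp add: space_restrict_space)
  have lim: "(\<lambda>j. integral\<^sup>L L (\<lambda>x. max 0 (1 - real j * infdist x A))) \<longlonglongrightarrow> measure L (K \<inter> A)"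
    if L: "prob_space L" "sets L = sets (restrict_space borel K)" and A: "closed A" "A \<noteq> {}" for A and L :: "'c measure"
  proof -
    interpret L: prob_space L by fact
    have spL: "space L = K" using sets_eq_imp_space_eq[OF L(2)] by (simp add: space_restrict_space)
    have meas: "g \<in> borel_measurable L" if "continuous_on K g" for g :: "'c \<Rightarrow> real"
      using borel_measurable_continuous_on_restrict[OF that] measurable_cong_sets[OF L(2) refl] by blast
    have KA: "K \<inter> A \<in> sets L" using A(1) by (auto simp: L(2) sets_restrict_space)
    have "(\<lambda>j. integral\<^sup>L L (\<lambda>x. max 0 (1 - real j * infdist x A))) \<longlonglongrightarrow> integral\<^sup>L L (indicator (K \<inter> A))"
    proof (rule integral_dominated_convergence[where w="\<lambda>_. 1"])
      show "(\<lambda>x. max 0 (1 - real j * infdist x A)) \<in> borel_measurable L" for j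
        by (intro meas continuous_intros)
      show "AE x in L. (\<lambda>j. max 0 (1 - real j * infdist x A)) \<longlonglongrightarrow> indicator (K \<inter> A) x"
      proof (rule AE_I2)
        fix x assume "x \<in> space L"
        then have "x \<in> K" by (simp add: spL)
        show "(\<lambda>j. max 0 (1 - real j * infdist x A)) \<longlonglongrightarrow> indicator (K \<inter> A) x"
        proof (cases "x \<in> A")
          case True
          then show ?thesis using \<open>x \<in> K\<close> by (simp add: indicator_def)
        next
          case False
          then have pos: "infdist x A > 0" using A infdist_pos_not_in_closed by blast
          obtain j0 where "1 < real j0 * infdist x A" using reals_Archimedean3[OF pos] by blast
          then have "1 - real j * infdist x A \<le> 0" if "j \<ge> j0" for j
          proof -
            have "real j0 * infdist x A \<le> real j * infdist x A"
              using that pos by (intro mult_right_mono) auto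
            with \<open>1 < real j0 * infdist x A\<close> show ?thesis by linarith
          qed
          then have "\<forall>\<^sub>F j in sequentially. max 0 (1 - real j * infdist x A) = 0"
            unfolding eventually_sequentially by (intro exI[of _ j0]) (simp add: max_absorb1)
          then show ?thesis using False by (simp add: tendsto_eventually)
        qed
      qed
      show "AE x in L. norm (max 0 (1 - real j * infdist x A)) \<le> 1" for j
        by (simp add: infdist_nonneg)
    qed (use KA in auto)
    also have "integral\<^sup>L L (indicator (K \<inter> A)) = measure L (K \<inter> A)"
      by (simp add: KA spL Int_absorb2)
    finally show ?thesis .
  qed
  show ?thesis
  proof (rule measure_eqI_generator_eq[where E="?E" and \<Omega>=K and A="\<lambda>_. K"])
    show "Int_stable ?E"
    proof (rule Int_stableI)
      fix a b assume "a \<in> ?E" "b \<in> ?E"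
      then obtain A B where "closed A" "closed B" "a = K \<inter> A" "b = K \<inter> B" by blast
      then have "a \<inter> b = K \<inter> (A \<inter> B)" "closed (A \<inter> B)" by auto
      then show "a \<inter> b \<in> ?E" by (intro image_eqI[where x="A \<inter> B"]) auto
    qed
    show "emeasure M Y = emeasure N Y" if Y: "Y \<in> ?E" for Y
    proof -
      obtain A where A: "closed A" "Y = K \<inter> A" using Y by blast
      have "measure M Y = measure N Y"
      \<comment> \<open>By convention \<open>infdist x {} = 0\<close>, so for the empty set the
        cut-offs would be constantly 1.\<close>
      proof (cases "A = {}")
        case False
        have "integral\<^sup>L M (\<lambda>x. max 0 (1 - real j * infdist x A)) = integral\<^sup>L N (\<lambda>x. max 0 (1 - real j * infdist x A))" for j
          by (intro int continuous_intros)
        then show ?thesis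
          using LIMSEQ_unique[OF lim[OF M A(1) False]] lim[OF N A(1) False] A(2) by simp
      qed (simp add: A(2))
      then show ?thesis by (simp add: M.emeasure_eq_measure N.emeasure_eq_measure)
    qed
    show "range (\<lambda>_. K) \<subseteq> ?E" using compact_imp_closed[OF K] by auto
  qed (auto simp: M(2) N(2) sets M.emeasure_eq_measure)
qed

section \<open>Weak limits on a compact space by coding it into the real line\<close>

text \<open>The first nonzero digit contributes \<open>(1 / 4) ^ m\<close> and all later ones
  together at most a third of that. In base 2 the tail could cancel the leading term.\<close>

lemma abs_suminf_quarter_ge:
  fixes a :: "nat \<Rightarrow> real"
  assumes bound: "\<And>j. \<bar>a j\<bar> \<le> 1" and zero: "\<And>j. j < m \<Longrightarrow> a j = 0" and one: "\<bar>a m\<bar> = 1"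
  shows "2 / 3 * (1 / 4) ^ m \<le> \<bar>\<Sum>j. a j * (1 / 4) ^ j\<bar>"
proof -
  have geo: "summable (\<lambda>j. (1 / 4 :: real) ^ j)" by (intro summable_geometric) simp
  have summ: "summable (\<lambda>j. a j * (1 / 4) ^ j)"
    by (rule summable_comparison_test'[OF geo]) (use bound in \<open>simp add: abs_mult mult_left_le_one_le\<close>)
  let ?t = "\<lambda>j. a (j + Suc m) * (1 / 4) ^ (j + Suc m)"
  have summ_t: "summable ?t" using summ by (rule summable_ignore_initial_segment)
  have "(\<Sum>j. a j * (1 / 4) ^ j) = suminf ?t + (\<Sum>j<Suc m. a j * (1 / 4) ^ j)"
    by (rule suminf_split_initial_segment[OF summ])
  also have "(\<Sum>j<Suc m. a j * (1 / 4) ^ j) = a m * (1 / 4) ^ m"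
    using zero by simp
  finally have eq: "(\<Sum>j. a j * (1 / 4) ^ j) = suminf ?t + a m * (1 / 4) ^ m" .
  have t_le: "norm (?t j) \<le> (1 / 4) ^ Suc m * (1 / 4) ^ j" for j
    using bound[of "j + Suc m"] by (simp add: abs_mult power_add mult_left_le_one_le)
  have "norm (suminf ?t) \<le> (\<Sum>j. (1 / 4) ^ Suc m * (1 / 4) ^ j)"
    by (rule norm_suminf_le[OF t_le summable_mult[OF geo]])
  also have "\<dots> = (1 / 4) ^ Suc m * (4 / 3)"
    by (subst suminf_mult[OF geo]) (simp add: suminf_geometric)
  finally have "\<bar>suminf ?t\<bar> \<le> 1 / 3 * (1 / 4) ^ m" by simp
  moreover have "\<bar>a m * (1 / 4) ^ m\<bar> = (1 / 4) ^ m" using one by (simp add: abs_mult)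
  ultimately show ?thesis unfolding eq by linarith
qed

text \<open>A base 4 expansion records which balls of a countable base contain \<open>x\<close>.  The code itself is
  not continuous, but its inverse is uniformly continuous, and this is what allows weak limits of
  measures on the real line to be transported to \<open>K\<close>.\<close>

lemma real_coding_of_compact:
  fixes K :: "'c::metric_space set"
  assumes K: "compact K" "K \<noteq> {}"
  shows "\<exists>c :: 'c \<Rightarrow> real. (\<forall>x. \<bar>c x\<bar> \<le> 2) \<and>
    (\<forall>\<epsilon>>0. \<exists>\<delta>>0. \<forall>x\<in>K. \<forall>y\<in>K. \<bar>c x - c y\<bar> < \<delta> \<longrightarrow> dist x y < \<epsilon>)"
proof -
  obtain d :: "nat \<Rightarrow> 'c" where d: "\<forall>n. d n \<in> K" "\<forall>x\<in>K. \<forall>e>0. \<exists>n. dist (d n) x < e"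
    using compact_dense_sequence[OF K] by blast
  \<comment> \<open>Decoding pairs of indices enumerates the balls around all \<open>d i\<close>
    with all radii \<open>1 / real (Suc k)\<close>.\<close>
  define B where "B = (\<lambda>j. ball (d (fst (prod_decode j))) (1 / real (Suc (snd (prod_decode j)))))"
  define c where "c = (\<lambda>x. \<Sum>j. indicator (B j) x * (1 / 4 :: real) ^ j)"
  have geo: "summable (\<lambda>j. (1 / 4 :: real) ^ j)" by (intro summable_geometric) simp
  have summ: "summable (\<lambda>j. indicator (B j) x * (1 / 4 :: real) ^ j)" for x
    by (rule summable_comparison_test'[OF geo]) (simp add: indicator_def)
  have "\<bar>c x\<bar> \<le> 2" for x
  proof -
    have "norm (c x) \<le> (\<Sum>j. (1 / 4 :: real) ^ j)"
      unfolding c_def by (rule norm_suminf_le[OF _ geo]) (simp add: indicator_def)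
    then show ?thesis by (simp add: suminf_geometric)
  qed
  moreover have "\<exists>\<delta>>0. \<forall>x\<in>K. \<forall>y\<in>K. \<bar>c x - c y\<bar> < \<delta> \<longrightarrow> dist x y < \<epsilon>" if pos: "\<epsilon> > 0" for \<epsilon>
  proof -
    have "\<epsilon> / 2 > 0" using pos by simp
    then obtain k where k: "1 / real (Suc k) < \<epsilon> / 2" using nat_approx_posE by blast
    let ?b = "\<lambda>i. ball (d i) (1 / real (Suc k))"
    have cover: "K \<subseteq> (\<Union>i\<in>UNIV. ?b i)"
    proof
      fix x assume "x \<in> K"
      moreover have "1 / real (Suc k) > 0" by simp
      ultimately obtain i where "dist (d i) x < 1 / real (Suc k)" using d(2) by blast
      then show "x \<in> (\<Union>i\<in>UNIV. ?b i)" by auto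
    qed
    obtain I where I: "finite I" "K \<subseteq> (\<Union>i\<in>I. ?b i)"
      using compactE_image[OF K(1) _ cover] by (metis open_ball)
    \<comment> \<open>The largest index of a ball in a finite cover of fixed radius: points whose
      digits agree up to \<open>J\<close> share a ball of that cover.\<close>
    define J where "J = Max (insert 0 ((\<lambda>i. prod_encode (i, k)) ` I))"
    have J: "prod_encode (i, k) \<le> J" if "i \<in> I" for i
      unfolding J_def using I(1) that by (intro Max_ge) auto
    have "dist x y < \<epsilon>" if xy: "x \<in> K" "y \<in> K" "\<bar>c x - c y\<bar> < 2 / 3 * (1 / 4) ^ J" for x y
    proof -
      define a :: "nat \<Rightarrow> real" where "a = (\<lambda>j. indicator (B j) x - indicator (B j) y)"
      have ca: "c x - c y = (\<Sum>j. a j * (1 / 4) ^ j)"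
        unfolding c_def a_def using suminf_diff[OF summ[of x] summ[of y]] by (simp add: left_diff_distrib)
      have a0: "a j = 0" if "j \<le> J" for j
      proof (rule ccontr)
        assume "a j \<noteq> 0"
        define m where "m = (LEAST j. a j \<noteq> 0)"
        have m: "a m \<noteq> 0" "m \<le> j"
          unfolding m_def using \<open>a j \<noteq> 0\<close>
          by (rule LeastI[where P="\<lambda>j. a j \<noteq> 0"], rule Least_le)
        have less: "a i = 0" if "i < m" for i
          using not_less_Least[OF that[unfolded m_def]] by simp
        have "2 / 3 * (1 / 4) ^ J \<le> 2 / 3 * (1 / 4 :: real) ^ m"
          using m(2) \<open>j \<le> J\<close> by (intro mult_left_mono power_decreasing) auto
        also have "\<dots> \<le> \<bar>c x - c y\<bar>"
          unfolding ca by (rule abs_suminf_quarter_ge) (use m(1) less in \<open>auto simp: a_def indicator_def\<close>)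
        finally show False using xy(3) by simp
      qed
      obtain i where i: "i \<in> I" "x \<in> ?b i" using I(2) xy(1) by blast
      have Bi: "B (prod_encode (i, k)) = ?b i" by (simp add: B_def)
      have "a (prod_encode (i, k)) = 0" using a0 J[OF i(1)] by blast
      then have "y \<in> ?b i" using i(2) by (auto simp: a_def Bi indicator_def split: if_splits)
      then have "dist (d i) x < \<epsilon> / 2" "dist (d i) y < \<epsilon> / 2" using i(2) k by auto
      then show ?thesis using dist_triangle[of x y "d i"] by (simp add: dist_commute)
    qed
    then show ?thesis by (intro exI[of _ "2 / 3 * (1 / 4) ^ J"]) simp
  qed
  ultimately show ?thesis by blast
qed

text \<open>The modulus makes the inverse of \<open>c\<close> uniformly continuous on the image of
  \<open>K\<close>, so it extends to the closure; compactness of \<open>K\<close> keeps the new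
  values in \<open>K\<close>.\<close>

lemma real_coding_inverse:
  fixes K :: "'c::metric_space set" and c :: "'c \<Rightarrow> real"
  assumes K: "compact K"
    and modulus: "\<And>\<epsilon>. \<epsilon> > 0 \<Longrightarrow> \<exists>\<delta>>0. \<forall>x\<in>K. \<forall>y\<in>K. \<bar>c x - c y\<bar> < \<delta> \<longrightarrow> dist x y < \<epsilon>"
  shows "\<exists>\<kappa>. continuous_on (closure (c ` K)) \<kappa> \<and> \<kappa> ` closure (c ` K) \<subseteq> K \<and> (\<forall>x\<in>K. \<kappa> (c x) = x)"
proof -
  have "\<exists>x\<in>K. \<forall>e>0. \<exists>y\<in>K. \<bar>c y - t\<bar> < e \<and> dist y x < e" if t: "t \<in> closure (c ` K)" for t
  proof -
    obtain s where s: "\<forall>n. s n \<in> c ` K" "s \<longlonglongrightarrow> t" using t closure_sequential by metis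
    then have "\<forall>n. \<exists>y. y \<in> K \<and> s n = c y" by blast
    then obtain y :: "nat \<Rightarrow> 'c" where y: "\<forall>n. y n \<in> K \<and> s n = c (y n)" by metis
    obtain x r where x: "x \<in> K" "strict_mono (r :: nat \<Rightarrow> nat)" "(y \<circ> r) \<longlonglongrightarrow> x"
      using spec[OF K[unfolded compact_def], of y] y by blast
    have "\<exists>y\<in>K. \<bar>c y - t\<bar> < e \<and> dist y x < e" if "e > 0" for e
    proof -
      have "\<forall>\<^sub>F n in sequentially. dist ((y \<circ> r) n) x < e" using x(3) \<open>e > 0\<close> by (rule tendstoD)
      moreover have "\<forall>\<^sub>F n in sequentially. dist ((s \<circ> r) n) t < e"
        using LIMSEQ_subseq_LIMSEQ[OF s(2) x(2)] \<open>e > 0\<close> by (rule tendstoD)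
      ultimately have "\<forall>\<^sub>F n in sequentially. dist ((y \<circ> r) n) x < e \<and> dist ((s \<circ> r) n) t < e"
        by eventually_elim blast
      then obtain n where "dist ((y \<circ> r) n) x < e \<and> dist ((s \<circ> r) n) t < e"
        using eventually_happens'[OF sequentially_bot] by blast
      then show ?thesis using y by (intro bexI[of _ "y (r n)"]) (auto simp: dist_real_def)
    qed
    then show ?thesis using x(1) by blast
  qed
  then have "\<forall>t\<in>closure (c ` K). \<exists>x. x \<in> K \<and> (\<forall>e>0. \<exists>y\<in>K. \<bar>c y - t\<bar> < e \<and> dist y x < e)" by blast
  from bchoice[OF this] obtain \<kappa> where \<kappa>: "\<forall>t\<in>closure (c ` K). \<kappa> t \<in> K \<and> (\<forall>e>0. \<exists>y\<in>K. \<bar>c y - t\<bar> < e \<and> dist y (\<kappa> t) < e)"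
    by blast
  have close: "\<exists>\<delta>>0. \<forall>t\<in>closure (c ` K). \<forall>x\<in>K. \<bar>c x - t\<bar> < \<delta> \<longrightarrow> dist x (\<kappa> t) < \<epsilon>" if pos: "\<epsilon> > 0" for \<epsilon>
  proof -
    have "\<epsilon> / 2 > 0" using pos by simp
    then obtain \<delta> where \<delta>: "\<delta> > 0" "\<forall>x\<in>K. \<forall>y\<in>K. \<bar>c x - c y\<bar> < \<delta> \<longrightarrow> dist x y < \<epsilon> / 2"
      using modulus by meson
    have "dist x (\<kappa> t) < \<epsilon>" if t: "t \<in> closure (c ` K)" "x \<in> K" "\<bar>c x - t\<bar> < \<delta> / 2" for t x
    proof -
      have "min (\<delta> / 2) (\<epsilon> / 2) > 0" using \<delta>(1) pos by simp
      then obtain y where y: "y \<in> K" "\<bar>c y - t\<bar> < min (\<delta> / 2) (\<epsilon> / 2)" "dist y (\<kappa> t) < min (\<delta> / 2) (\<epsilon> / 2)"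
        using \<kappa> t(1) by meson
      have "\<bar>c y - t\<bar> < \<delta> / 2" using y(2) by simp
      then have "\<bar>c x - c y\<bar> < \<delta>" using t(3) by linarith
      then have "dist x y < \<epsilon> / 2" using \<delta>(2) t(2) y(1) by blast
      then show ?thesis using y(3) dist_triangle[of x "\<kappa> t" y] by simp
    qed
    then show ?thesis using \<delta>(1) by (intro exI[of _ "\<delta> / 2"]) simp
  qed
  have "\<kappa> (c x) = x" if "x \<in> K" for x
  proof (rule ccontr)
    assume "\<kappa> (c x) \<noteq> x"
    then have "dist x (\<kappa> (c x)) > 0" by simp
    from close[OF this] obtain \<delta> where \<delta>: "\<delta> > 0"
      "\<forall>t\<in>closure (c ` K). \<forall>y\<in>K. \<bar>c y - t\<bar> < \<delta> \<longrightarrow> dist y (\<kappa> t) < dist x (\<kappa> (c x))"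
      by blast
    have "c x \<in> closure (c ` K)" using that by (intro subsetD[OF closure_subset] imageI)
    then have "\<bar>c x - c x\<bar> < \<delta> \<longrightarrow> dist x (\<kappa> (c x)) < dist x (\<kappa> (c x))"
      using \<delta>(2) that by blast
    then show False using \<delta>(1) by simp
  qed
  moreover have "continuous_on (closure (c ` K)) \<kappa>"
    unfolding continuous_on_iff
  proof (intro ballI allI impI)
    fix t and \<epsilon> :: real assume t: "t \<in> closure (c ` K)" "0 < \<epsilon>"
    then have "\<epsilon> / 2 > 0" by simp
    then obtain \<delta> where \<delta>: "\<delta> > 0" "\<forall>t\<in>closure (c ` K). \<forall>x\<in>K. \<bar>c x - t\<bar> < \<delta> \<longrightarrow> dist x (\<kappa> t) < \<epsilon> / 2"
      using close by meson
    have "dist (\<kappa> t') (\<kappa> t) < \<epsilon>" if t': "t' \<in> closure (c ` K)" "dist t' t < \<delta> / 2" for t'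
    proof -
      have "\<delta> / 2 > 0" using \<delta>(1) by simp
      then obtain y where y: "y \<in> K" "\<bar>c y - t'\<bar> < \<delta> / 2" using \<kappa> t'(1) by meson
      have "\<bar>c y - t'\<bar> < \<delta>" "\<bar>c y - t\<bar> < \<delta>" using y(2) t'(2) by (simp_all only: dist_real_def)
      then have "dist y (\<kappa> t') < \<epsilon> / 2" "dist y (\<kappa> t) < \<epsilon> / 2" using \<delta>(2) t(1) t'(1) y(1) by auto
      then show ?thesis using dist_triangle3[of "\<kappa> t'" "\<kappa> t" y] by simp
    qed
    then show "\<exists>d>0. \<forall>x'\<in>closure (c ` K). dist x' t < d \<longrightarrow> dist (\<kappa> x') (\<kappa> t) < \<epsilon>"
      using \<delta>(1) by (intro exI[of _ "\<delta> / 2"]) simp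
  qed
  moreover have "\<kappa> ` closure (c ` K) \<subseteq> K" using \<kappa> by blast
  ultimately show ?thesis by blast
qed

text \<open>On the line the coded empirical measures are supported in a fixed bounded interval, so
  Helly selection applies. The weak limit lives on the closed set \<open>C\<close> and is carried
  back by \<open>\<kappa>\<close>.\<close>

lemma weak_limit_on_compact:
  fixes K :: "'c::metric_space set" and p :: "nat \<Rightarrow> 'c"
  assumes K: "compact K" and p: "\<And>i. p i \<in> K"
  shows "\<exists>L r. prob_space L \<and> sets L = sets (restrict_space borel K) \<and> strict_mono (r :: nat \<Rightarrow> nat) \<and>
    (\<forall>g :: 'c \<Rightarrow> real. continuous_on K g \<longrightarrow>
      (\<lambda>k. (\<Sum>i\<le>r k. g (p i)) / real (Suc (r k))) \<longlonglongrightarrow> integral\<^sup>L L g)"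
proof -
  have "K \<noteq> {}" using p by blast
  obtain c :: "'c \<Rightarrow> real" where c: "\<forall>x. \<bar>c x\<bar> \<le> 2"
    "\<forall>\<epsilon>>0. \<exists>\<delta>>0. \<forall>x\<in>K. \<forall>y\<in>K. \<bar>c x - c y\<bar> < \<delta> \<longrightarrow> dist x y < \<epsilon>"
    using real_coding_of_compact[OF K \<open>K \<noteq> {}\<close>] by blast
  define C where "C = closure (c ` K)"
  obtain \<kappa> where \<kappa>: "continuous_on C \<kappa>" "\<kappa> ` C \<subseteq> K" "\<forall>x\<in>K. \<kappa> (c x) = x"
    using real_coding_inverse[OF K, of c] c(2) unfolding C_def by blast
  have C: "closed C" "C \<noteq> {}" "\<And>i. c (p i) \<in> C"
    using \<open>K \<noteq> {}\<close> p closure_subset[of "c ` K"] by (auto simp: C_def)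
  \<comment> \<open>Uniform distribution on the \<open>n + 1\<close> times up to \<open>n\<close>,
    hence the denominators \<open>real (Suc n)\<close>.\<close>
  define \<mu> where "\<mu> = (\<lambda>n. distr (measure_pmf (pmf_of_set {..n})) borel (\<lambda>i. c (p i)))"
  have \<mu>: "real_distribution (\<mu> n)" for n
  proof -
    have "prob_space (\<mu> n)" unfolding \<mu>_def
      by (rule prob_space.prob_space_distr) (simp_all add: prob_space_measure_pmf)
    then show ?thesis
      by (simp add: real_distribution_def real_distribution_axioms_def \<mu>_def)
  qed
  have int_\<mu>: "integral\<^sup>L (\<mu> n) g = (\<Sum>i\<le>n. g (c (p i))) / real (Suc n)"
    if "g \<in> borel_measurable borel" for g :: "real \<Rightarrow> real" and n
    unfolding \<mu>_def using that by (simp add: integral_distr integral_pmf_of_set)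
  have "tight \<mu>"
    unfolding tight_def
  proof (intro conjI allI impI)
    fix \<epsilon> :: real assume "\<epsilon> > 0"
    have "measure (\<mu> n) {-3<..3} = 1" for n
    proof -
      have "-3 < c (p i) \<and> c (p i) \<le> 3" for i using c(1)[rule_format, of "p i"] by linarith
      then have "(\<lambda>i. c (p i)) -` {-3<..3} = UNIV" by auto
      then show ?thesis unfolding \<mu>_def by (simp add: measure_distr)
    qed
    then show "\<exists>a b. a < b \<and> (\<forall>n. 1 - \<epsilon> < measure (\<mu> n) {a<..b})"
      using \<open>\<epsilon> > 0\<close> by (intro exI[of _ "-3"] exI[of _ 3]) simp
  qed (rule \<mu>)
  from tight_imp_convergent_subsubsequence[OF this strict_mono_id]
  obtain r :: "nat \<Rightarrow> nat" and M where r: "strict_mono r" and M: "real_distribution M"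
    and conv: "weak_conv_m (\<mu> \<circ> id \<circ> r) M" by blast
  interpret M: real_distribution M by fact
  have int_conv: "(\<lambda>k. (\<Sum>i\<le>r k. g (c (p i))) / real (Suc (r k))) \<longlonglongrightarrow> integral\<^sup>L M g"
    if g: "continuous_on UNIV g" "\<And>x. norm (g x) \<le> B" for g :: "real \<Rightarrow> real" and B
  proof -
    have "g \<in> borel_measurable borel" using g(1) by (rule borel_measurable_continuous_onI)
    moreover have "(\<lambda>k. integral\<^sup>L ((\<mu> \<circ> id \<circ> r) k) g) \<longlonglongrightarrow> integral\<^sup>L M g"
    proof (rule weak_conv_imp_integral_bdd_continuous_conv[OF _ M conv])
      show "isCont g x" for x using g(1) by (simp add: continuous_on_eq_continuous_at)
    qed (use \<mu> g(2) in auto)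
    ultimately show ?thesis by (simp add: int_\<mu>)
  qed
  have "AE t in M. t \<in> C"
  proof -
    \<comment> \<open>Every empirical measure integrates this bounded continuous function to 0, so
      the limit does too; its zero set is \<open>C\<close>.\<close>
    let ?g = "\<lambda>t. min 1 (infdist t C)"
    have cont: "continuous_on UNIV ?g" by (intro continuous_intros)
    have nonneg: "0 \<le> ?g t" for t by (simp add: infdist_nonneg)
    have bound: "norm (?g t) \<le> 1" for t using nonneg[of t] by simp
    have "?g (c (p i)) = 0" for i using C(3)[of i] by simp
    then have "(\<lambda>k. 0::real) \<longlonglongrightarrow> integral\<^sup>L M ?g"
      using int_conv[OF cont bound] by simp
    then have "integral\<^sup>L M ?g = 0" by (simp add: LIMSEQ_const_iff)
    moreover have "integrable M ?g"
      by (rule M.integrable_const_bound[where B=1]) (use bound borel_measurable_continuous_onI[OF cont] in auto)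
    ultimately have "AE t in M. ?g t = 0"
      using integral_nonneg_eq_0_iff_AE[of M ?g] nonneg by simp
    then show ?thesis
    proof eventually_elim
      case (elim t)
      then have "infdist t C = 0" by (auto simp: min_def split: if_splits)
      then show ?case using C(1,2) by (simp add: in_closed_iff_infdist_zero)
    qed
  qed
  \<comment> \<open>The value \<open>p 0\<close> off \<open>C\<close>, a null set for
    \<open>M\<close>, merely keeps the map inside \<open>K\<close>.\<close>
  define \<kappa>' where "\<kappa>' = (\<lambda>t. if t \<in> C then \<kappa> t else p 0)"
  have \<kappa>'_in: "\<kappa>' t \<in> K" for t using \<kappa>(2) p by (auto simp: \<kappa>'_def)
  have "\<kappa>' \<in> borel_measurable borel"
    unfolding \<kappa>'_def by (rule borel_measurable_continuous_on_if) (use C \<kappa>(1) in auto)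
  then have meas_\<kappa>': "\<kappa>' \<in> measurable M (restrict_space borel K)"
    using \<kappa>'_in by (intro measurable_restrict_space2) auto
  define L where "L = distr M (restrict_space borel K) \<kappa>'"
  have "(\<lambda>k. (\<Sum>i\<le>r k. g (p i)) / real (Suc (r k))) \<longlonglongrightarrow> integral\<^sup>L L g"
    if g: "continuous_on K g" for g :: "'c \<Rightarrow> real"
  proof -
    have "bounded (g ` K)" using g K by (intro compact_imp_bounded compact_continuous_image)
    then obtain B where B: "\<forall>x\<in>K. norm (g x) \<le> B" unfolding bounded_iff by blast
    have "0 \<le> B" using B p norm_ge_zero order_trans by blast
    have "continuous_on C (\<lambda>t. g (\<kappa> t))"
      by (rule continuous_on_compose2[OF g \<kappa>(1,2)])
    \<comment> \<open>Weak convergence tests functions on the whole line, so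
      \<open>g (\<kappa> t)\<close> is extended from \<open>C\<close> with the same bound.\<close>
    then obtain h where h: "continuous_on UNIV h" "\<And>t. t \<in> C \<Longrightarrow> h t = g (\<kappa> t)" "\<And>t. norm (h t) \<le> B"
      using Tietze[of C "\<lambda>t. g (\<kappa> t)" UNIV B] C(1) B \<kappa>(2) \<open>0 \<le> B\<close> by (auto simp: image_subset_iff)
    have "integral\<^sup>L M h = integral\<^sup>L M (\<lambda>t. g (\<kappa>' t))"
    proof (rule integral_cong_AE)
      show "h \<in> borel_measurable M" using borel_measurable_continuous_onI[OF h(1)] by simp
      show "(\<lambda>t. g (\<kappa>' t)) \<in> borel_measurable M"
        using measurable_compose[OF meas_\<kappa>' borel_measurable_continuous_on_restrict[OF g]] by simp
      show "AE t in M. h t = g (\<kappa>' t)"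
        using \<open>AE t in M. t \<in> C\<close> by eventually_elim (simp add: h(2) \<kappa>'_def)
    qed
    also have "\<dots> = integral\<^sup>L L g"
      unfolding L_def by (rule integral_distr[symmetric, OF meas_\<kappa>' borel_measurable_continuous_on_restrict[OF g]])
    finally have "integral\<^sup>L M h = integral\<^sup>L L g" .
    moreover have "h (c (p i)) = g (p i)" for i using h(2) C(3) \<kappa>(3) p by simp
    ultimately show ?thesis using int_conv[OF h(1,3)] by simp
  qed
  moreover have "prob_space L" unfolding L_def by (rule M.prob_space_distr[OF meas_\<kappa>'])
  moreover have "sets L = sets (restrict_space borel K)" by (simp add: L_def)
  ultimately show ?thesis using r by blast
qed

text \<open>Along one orbit, shifting changes the sums by boundary terms only, so the limit is
  invariant. The lower bound is required at all lengths because compactness, not choice, selects the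
  subsequence.\<close>

lemma Krylov_Bogoliubov:
  fixes K :: "'c::metric_space set"
  assumes K: "compact K" "continuous_on K F" "F ` K \<subseteq> K" and f: "continuous_on K f" and p: "p \<in> K"
    and large: "\<And>n. n > 0 \<Longrightarrow> \<epsilon> * real n \<le> Birkhoff_sum F f n p"
  shows "\<exists>L\<in>invariant_measures K F. \<epsilon> \<le> integral\<^sup>L L f"
proof -
  have in_K: "(F ^^ i) p \<in> K" for i using funpow_in_carrier[OF K(3) p] .
  obtain L r where L: "prob_space L" "sets L = sets (restrict_space borel K)" and r: "strict_mono (r :: nat \<Rightarrow> nat)"
    and lim: "\<forall>g :: 'c \<Rightarrow> real. continuous_on K g \<longrightarrow>
      (\<lambda>k. (\<Sum>i\<le>r k. g ((F ^^ i) p)) / real (Suc (r k))) \<longlonglongrightarrow> integral\<^sup>L L g"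
    using weak_limit_on_compact[OF K(1), of "\<lambda>i. (F ^^ i) p"] in_K by blast
  interpret L: prob_space L by fact
  have spL: "space L = K" using sets_eq_imp_space_eq[OF L(2)] by (simp add: space_restrict_space)
  have "F \<in> measurable (restrict_space borel K) (restrict_space borel K)"
    using borel_measurable_continuous_on_restrict[OF K(2)] K(3)
    by (intro measurable_restrict_space2) (auto simp: space_restrict_space)
  then have meas_F: "F \<in> measurable L L" using measurable_cong_sets[OF L(2) L(2)] by blast
  have "distr L L F = L"
  proof (rule measure_eqI_continuous_integrals[OF K(1)])
    show "prob_space (distr L L F)" by (rule L.prob_space_distr[OF meas_F])
    show "integral\<^sup>L (distr L L F) g = integral\<^sup>L L g" if g: "continuous_on K g" for g :: "'c \<Rightarrow> real"
    proof -
      have gF: "continuous_on K (\<lambda>x. g (F x))" by (rule continuous_on_compose2[OF g K(2,3)])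
      have "bounded (g ` K)" using g K by (intro compact_imp_bounded compact_continuous_image)
      then obtain B where B: "\<forall>x\<in>K. norm (g x) \<le> B" unfolding bounded_iff by blast
      let ?w = "\<lambda>n. (g ((F ^^ Suc n) p) - g p) / real (Suc n)"
      have diff: "(\<Sum>i\<le>n. g (F ((F ^^ i) p))) - (\<Sum>i\<le>n. g ((F ^^ i) p)) = g ((F ^^ Suc n) p) - g p" for n
        by (induction n) simp_all
      have "?w \<longlonglongrightarrow> 0"
      proof (rule Lim_null_comparison)
        show "\<forall>\<^sub>F n in sequentially. norm (?w n) \<le> 2 * B * (1 / real (Suc n))"
        proof (intro always_eventually allI)
          fix n
          have "norm (g ((F ^^ Suc n) p) - g p) \<le> norm (g ((F ^^ Suc n) p)) + norm (g p)"
            by (rule norm_triangle_ineq4)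
          also have "\<dots> \<le> B + B" using B in_K[of "Suc n"] p by (intro add_mono) blast+
          finally have "norm (g ((F ^^ Suc n) p) - g p) \<le> 2 * B" by simp
          then show "norm (?w n) \<le> 2 * B * (1 / real (Suc n))"
            unfolding norm_divide by (simp add: divide_right_mono)
        qed
        show "(\<lambda>n. 2 * B * (1 / real (Suc n))) \<longlonglongrightarrow> 0"
          by (rule tendsto_mult_right_zero[OF LIMSEQ_Suc[OF lim_1_over_n]])
      qed
      then have "(?w \<circ> r) \<longlonglongrightarrow> 0" using r by (rule LIMSEQ_subseq_LIMSEQ)
      moreover have "(\<lambda>k. (\<Sum>i\<le>r k. g (F ((F ^^ i) p))) / real (Suc (r k)) - (\<Sum>i\<le>r k. g ((F ^^ i) p)) / real (Suc (r k)))
          \<longlonglongrightarrow> integral\<^sup>L L (\<lambda>x. g (F x)) - integral\<^sup>L L g"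
        using lim g gF by (intro tendsto_diff) blast+
      ultimately have "integral\<^sup>L L (\<lambda>x. g (F x)) - integral\<^sup>L L g = 0"
        unfolding diff_divide_distrib[symmetric] diff o_def by (rule LIMSEQ_unique[rotated])
      moreover have "g \<in> borel_measurable L"
        using borel_measurable_continuous_on_restrict[OF g] measurable_cong_sets[OF L(2) refl] by blast
      then have "integral\<^sup>L (distr L L F) g = integral\<^sup>L L (\<lambda>x. g (F x))"
        by (rule integral_distr[OF meas_F])
      ultimately show ?thesis by simp
    qed
  qed (use L in auto)
  moreover have "\<epsilon> \<le> integral\<^sup>L L f"
  proof (rule LIMSEQ_le_const)
    show "(\<lambda>k. (\<Sum>i\<le>r k. f ((F ^^ i) p)) / real (Suc (r k))) \<longlonglongrightarrow> integral\<^sup>L L f"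
      using lim f by blast
    have "\<epsilon> \<le> (\<Sum>i\<le>r k. f ((F ^^ i) p)) / real (Suc (r k))" for k
      using large[of "Suc (r k)"] unfolding Birkhoff_sum_def lessThan_Suc_atMost
      by (simp add: pos_le_divide_eq del: of_nat_Suc)
    then show "\<exists>N. \<forall>n\<ge>N. \<epsilon> \<le> (\<Sum>i\<le>r n. f ((F ^^ i) p)) / real (Suc (r n))" by blast
  qed
  ultimately show ?thesis using L unfolding invariant_measures_def by blast
qed

section \<open>Invariant measures of a system and of its factor\<close>

context dynamical_system
begin

lemma space_invariant: "\<mu> \<in> invariant_measures X T \<Longrightarrow> space \<mu> = X"
  unfolding invariant_measures_def using sets_eq_imp_space_eq[of \<mu> "restrict_space borel X"]
  by (auto simp: space_restrict_space)

lemma sets_invariant: "\<mu> \<in> invariant_measures X T \<Longrightarrow> sets \<mu> = sets (restrict_space borel X)"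
  unfolding invariant_measures_def by auto

lemma prob_space_invariant: "\<mu> \<in> invariant_measures X T \<Longrightarrow> prob_space \<mu>"
  unfolding invariant_measures_def by auto

lemma measurable_continuous_invariant:
  assumes "\<mu> \<in> invariant_measures X T" "continuous_on X f" "f ` X \<subseteq> Y" "sets N = sets (restrict_space borel Y)"
  shows "f \<in> measurable \<mu> N"
proof -
  have "f \<in> measurable (restrict_space borel X) (restrict_space borel Y)"
    using borel_measurable_continuous_on_restrict[OF assms(2)] assms(3)
    by (intro measurable_restrict_space2) (auto simp: space_restrict_space)
  then show ?thesis
    using measurable_cong_sets[OF sets_invariant[OF assms(1)] assms(4)] by blast
qed

lemma borel_measurable_continuous_invariant:
  assumes "\<mu> \<in> invariant_measures X T" "continuous_on X f"
  shows "f \<in> borel_measurable \<mu>"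
  using borel_measurable_continuous_on_restrict[OF assms(2)]
    measurable_cong_sets[OF sets_invariant[OF assms(1)] refl] by blast

lemma measurable_iter_invariant: "\<mu> \<in> invariant_measures X T \<Longrightarrow> T ^^ n \<in> measurable \<mu> \<mu>"
  by (rule measurable_continuous_invariant[OF _ cont_iter])
    (auto simp: sets_invariant)

lemma measurable_T_invariant: "\<mu> \<in> invariant_measures X T \<Longrightarrow> T \<in> measurable \<mu> \<mu>"
  using measurable_iter_invariant[of \<mu> 1] by simp

lemma distr_iter_invariant:
  assumes "\<mu> \<in> invariant_measures X T"
  shows "distr \<mu> \<mu> (T ^^ n) = \<mu>"
proof (induction n)
  case 0
  then show ?case by (simp add: id_def distr_id)
next
  case (Suc n)
  have "distr \<mu> \<mu> (T ^^ Suc n) = distr (distr \<mu> \<mu> (T ^^ n)) \<mu> T"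
    using distr_distr[OF measurable_T_invariant[OF assms] measurable_iter_invariant[OF assms, of n]]
    by simp
  also have "\<dots> = \<mu>" unfolding Suc.IH using assms by (simp add: invariant_measures_def)
  finally show ?case .
qed

text \<open>The mixture is realised as a fair coin toss followed by one of the two measures, so it
  is a measure by construction.\<close>

lemma average_of_invariant_measures:
  assumes "\<mu> \<in> invariant_measures X T" "\<nu> \<in> invariant_measures X T"
  shows "\<exists>\<rho>\<in>invariant_measures X T. \<forall>A\<in>sets (restrict_space borel X).
    emeasure \<rho> A = (emeasure \<mu> A + emeasure \<nu> A) / 2"
proof -
  let ?B = "restrict_space borel X"
  let ?f = "\<lambda>b. if b then \<mu> else \<nu>"
  let ?p = "measure_pmf (bernoulli_pmf (1 / 2))"
  define \<rho> where "\<rho> = ?p \<bind> ?f"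
  have inv: "?f b \<in> invariant_measures X T" for b using assms by simp
  have f_meas: "?f \<in> measurable ?p (subprob_algebra ?B)"
    using inv prob_space_invariant sets_invariant
    by (auto simp: space_subprob_algebra intro!: prob_space_imp_subprob_space)
  have sets: "sets \<rho> = sets ?B"
    unfolding \<rho>_def by (rule sets_bind) (use inv sets_invariant in auto)
  have em: "emeasure \<rho> A = (emeasure \<mu> A + emeasure \<nu> A) / 2" if "A \<in> sets ?B" for A
  proof -
    have "emeasure \<rho> A = (\<integral>\<^sup>+b. emeasure (?f b) A \<partial>?p)"
      unfolding \<rho>_def by (rule emeasure_bind[OF _ f_meas that]) simp
    also have "\<dots> = emeasure \<mu> A * ennreal (1 / 2) + emeasure \<nu> A * ennreal (1 - 1 / 2)"
      by (subst nn_integral_bernoulli_pmf) simp_all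
    also have "\<dots> = (emeasure \<mu> A + emeasure \<nu> A) * ennreal (1 / 2)"
      by (simp add: distrib_right)
    also have "ennreal (1 / 2) = 1 / 2"
      by (metis divide_ennreal ennreal_1 ennreal_numeral zero_le_numeral zero_le_one zero_less_numeral)
    also have "(emeasure \<mu> A + emeasure \<nu> A) * (1 / 2) = (emeasure \<mu> A + emeasure \<nu> A) / 2"
      by (simp add: ennreal_times_divide)
    finally show ?thesis .
  qed
  have sp: "space \<rho> = X" using sets_eq_imp_space_eq[OF sets] by (simp add: space_restrict_space)
  have X_in: "X \<in> sets ?B" using sets.top[of ?B] by (simp add: space_restrict_space)
  have one: "emeasure \<mu> X = 1" "emeasure \<nu> X = 1"
    using prob_space.emeasure_space_1[OF prob_space_invariant] space_invariant assms by metis+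
  have "prob_space \<rho>"
    by (rule prob_spaceI) (simp add: sp em[OF X_in] one)
  moreover have "distr \<rho> \<rho> T = \<rho>"
  proof (rule measure_eqI)
    fix A assume "A \<in> sets (distr \<rho> \<rho> T)"
    then have A: "A \<in> sets ?B" by (simp add: sets)
    have T_meas: "T \<in> measurable \<rho> \<rho>"
      using measurable_T_invariant[OF assms(1)] measurable_cong_sets[of \<rho> \<mu> \<rho> \<mu>] sets
        sets_invariant[OF assms(1)] by simp
    have pre: "emeasure m (T -` A \<inter> X) = emeasure m A" if m: "m \<in> invariant_measures X T" for m
    proof -
      have "emeasure m A = emeasure (distr m m T) A" using m by (simp add: invariant_measures_def)
      also have "\<dots> = emeasure m (T -` A \<inter> X)"
        using emeasure_distr[OF measurable_T_invariant[OF m], of A] A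
        by (simp add: sets_invariant[OF m] space_invariant[OF m])
      finally show ?thesis by simp
    qed
    have "T -` A \<inter> X \<in> sets ?B"
      using measurable_sets[OF T_meas, of A] A by (simp add: sets sp)
    then show "emeasure (distr \<rho> \<rho> T) A = emeasure \<rho> A"
      using emeasure_distr[OF T_meas, of A] A by (simp add: sets sp em pre assms)
  qed simp
  ultimately have "\<rho> \<in> invariant_measures X T" using sets by (simp add: invariant_measures_def)
  then show ?thesis using em by blast
qed

end

context equicontinuous_factor
begin

lemma measurable_\<pi>_invariant:
  assumes "\<mu> \<in> invariant_measures X T" "sets N = sets (restrict_space borel Z)"
  shows "\<pi> \<in> measurable \<mu> N"
  by (rule measurable_continuous_invariant[OF assms(1) cont_\<pi> _ assms(2)]) auto

lemma distr_\<pi>_invariant: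
  assumes \<mu>: "\<mu> \<in> invariant_measures X T"
  shows "distr \<mu> (restrict_space borel Z) \<pi> \<in> invariant_measures Z S"
proof -
  let ?B = "restrict_space borel Z"
  let ?\<nu> = "distr \<mu> ?B \<pi>"
  have \<pi>_meas: "\<pi> \<in> measurable \<mu> ?B" by (rule measurable_\<pi>_invariant[OF \<mu>]) simp
  have "S \<in> measurable ?B ?B"
    using borel_measurable_continuous_on_restrict[OF Z.cont_T]
    by (intro measurable_restrict_space2) (auto simp: space_restrict_space)
  then have "distr ?\<nu> ?B S = distr \<mu> ?B (S \<circ> \<pi>)" by (rule distr_distr[OF _ \<pi>_meas])
  also have "\<dots> = distr \<mu> ?B (\<pi> \<circ> T)"
    by (rule distr_cong) (simp_all add: space_invariant[OF \<mu>] \<pi>_T)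
  also have "\<dots> = distr (distr \<mu> \<mu> T) ?B \<pi>"
    by (rule distr_distr[symmetric, OF \<pi>_meas measurable_T_invariant[OF \<mu>]])
  also have "\<dots> = ?\<nu>" using \<mu> by (simp add: invariant_measures_def)
  finally have "distr ?\<nu> ?\<nu> S = ?\<nu>" by (simp cong: distr_cong)
  then show ?thesis
    using prob_space.prob_space_distr[OF prob_space_invariant[OF \<mu>] \<pi>_meas]
    by (simp add: invariant_measures_def)
qed

lemma isomorphism_imp_Banach_proximal_map:
  assumes iso: "\<And>\<mu> \<nu>. \<mu> \<in> invariant_measures X T \<Longrightarrow> \<nu> \<in> invariant_measures Z S \<Longrightarrow>
    distr \<mu> \<nu> \<pi> = \<nu> \<Longrightarrow> measure_theoretic_isomorphism \<mu> T \<nu> S \<pi>"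
  shows "Banach_proximal_map X T \<pi>"
proof (rule ccontr)
  assume "\<not> Banach_proximal_map X T \<pi>"
  then obtain x y and \<epsilon> :: real where xy: "(x, y) \<in> fiber_pairs" and \<epsilon>: "\<epsilon> > 0"
    and large: "\<And>n. n > 0 \<Longrightarrow> \<not> dist_sum T n x y < \<epsilon> * real n"
    unfolding Banach_proximal_map_iff by blast
  have F_cont: "continuous_on fiber_pairs (map_prod T T)"
    using cont_pair_map fiber_pairs_subset by (rule continuous_on_subset)
  have F_in: "map_prod T T ` fiber_pairs \<subseteq> fiber_pairs" using fiber_pairs_shift by auto
  have "\<epsilon> * real n \<le> Birkhoff_sum (map_prod T T) pair_dist n (x, y)" if "n > 0" for n
    using large[OF that] by (simp add: dist_sum_eq)
  from Krylov_Bogoliubov[OF compact_fiber_pairs F_cont F_in cont_pair_dist xy this]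
  obtain L where L: "L \<in> invariant_measures fiber_pairs (map_prod T T)" "\<epsilon> \<le> integral\<^sup>L L pair_dist"
    by blast
  interpret F: dynamical_system fiber_pairs "map_prod T T"
    by unfold_locales
      (simp add: topological_dynamical_system_def fiber_pairs_nonempty compact_fiber_pairs F_cont F_in)
  interpret L: prob_space L using F.prob_space_invariant[OF L(1)] .
  have spL: "space L = fiber_pairs" by (rule F.space_invariant[OF L(1)])
  have marginal: "distr L (restrict_space borel X) q \<in> invariant_measures X T"
    and q_meas: "q \<in> measurable L (restrict_space borel X)"
    if q: "continuous_on fiber_pairs q" "q ` fiber_pairs \<subseteq> X" "\<And>p. q (map_prod T T p) = T (q p)"
    for q :: "'a \<times> 'a \<Rightarrow> 'a"
  proof -
    let ?B = "restrict_space borel X"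
    show meas: "q \<in> measurable L ?B"
      by (rule F.measurable_continuous_invariant[OF L(1) q(1,2)]) simp
    have "T \<in> measurable ?B ?B"
      using borel_measurable_continuous_on_restrict[OF cont_T]
      by (intro measurable_restrict_space2) (auto simp: space_restrict_space)
    then have "distr (distr L ?B q) ?B T = distr L ?B (T \<circ> q)" by (rule distr_distr[OF _ meas])
    also have "T \<circ> q = q \<circ> map_prod T T" using q(3) by auto
    also have "distr L ?B (q \<circ> map_prod T T) = distr (distr L L (map_prod T T)) ?B q"
      by (rule distr_distr[symmetric, OF meas F.measurable_T_invariant[OF L(1)]])
    also have "\<dots> = distr L ?B q" using L(1) by (simp add: invariant_measures_def)
    finally have "distr (distr L ?B q) (distr L ?B q) T = distr L ?B q" by (simp cong: distr_cong)
    then show "distr L ?B q \<in> invariant_measures X T"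
      using L.prob_space_distr[OF meas] by (simp add: invariant_measures_def)
  qed
  have fst_q: "continuous_on fiber_pairs fst" "fst ` fiber_pairs \<subseteq> X" "\<And>p. fst (map_prod T T p) = T (fst p)"
    and snd_q: "continuous_on fiber_pairs snd" "snd ` fiber_pairs \<subseteq> X" "\<And>p. snd (map_prod T T p) = T (snd p)"
    using fiber_pairs_subset by (auto intro!: continuous_intros)
  define \<mu>\<^sub>1 where "\<mu>\<^sub>1 = distr L (restrict_space borel X) fst"
  define \<mu>\<^sub>2 where "\<mu>\<^sub>2 = distr L (restrict_space borel X) snd"
  have \<mu>12: "\<mu>\<^sub>1 \<in> invariant_measures X T" "\<mu>\<^sub>2 \<in> invariant_measures X T"
    unfolding \<mu>\<^sub>1_def \<mu>\<^sub>2_def using marginal[OF fst_q] marginal[OF snd_q] by auto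
  interpret \<mu>1: prob_space \<mu>\<^sub>1 using prob_space_invariant[OF \<mu>12(1)] .
  interpret \<mu>2: prob_space \<mu>\<^sub>2 using prob_space_invariant[OF \<mu>12(2)] .
  \<comment> \<open>The set on which \<open>\<pi>\<close> is injective depends on the measure.
    Treating the marginals separately would give two sets, and \<open>\<pi>\<close> need not be
    injective on their union; a set of full measure for the average is full for both.\<close>
  obtain \<mu> where \<mu>: "\<mu> \<in> invariant_measures X T"
    "\<forall>A\<in>sets (restrict_space borel X). emeasure \<mu> A = (emeasure \<mu>\<^sub>1 A + emeasure \<mu>\<^sub>2 A) / 2"
    using average_of_invariant_measures[OF \<mu>12] by blast
  define \<nu> where "\<nu> = distr \<mu> (restrict_space borel Z) \<pi>"
  have "distr \<mu> \<nu> \<pi> = \<nu>" unfolding \<nu>_def by (rule distr_cong) simp_all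
  moreover have "\<nu> \<in> invariant_measures Z S" unfolding \<nu>_def by (rule distr_\<pi>_invariant[OF \<mu>(1)])
  ultimately have "measure_theoretic_isomorphism \<mu> T \<nu> S \<pi>" using iso \<mu>(1) by blast
  then obtain X\<^sub>0 Z\<^sub>0 where X0: "X\<^sub>0 \<in> sets \<mu>" "emeasure \<mu> X\<^sub>0 = 1" "bij_betw \<pi> X\<^sub>0 Z\<^sub>0"
    unfolding measure_theoretic_isomorphism_def by blast
  have X0_sets: "X\<^sub>0 \<in> sets (restrict_space borel X)" using X0(1) sets_invariant[OF \<mu>(1)] by simp
  have "(emeasure \<mu>\<^sub>1 X\<^sub>0 + emeasure \<mu>\<^sub>2 X\<^sub>0) / 2 = 1" using \<mu>(2) X0_sets X0(2) by simp
  then have "ennreal ((\<mu>1.prob X\<^sub>0 + \<mu>2.prob X\<^sub>0) / 2) = ennreal 1"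
    by (simp add: \<mu>1.emeasure_eq_measure \<mu>2.emeasure_eq_measure ennreal_plus[symmetric] divide_ennreal[symmetric]
        del: ennreal_plus)
  then have "(\<mu>1.prob X\<^sub>0 + \<mu>2.prob X\<^sub>0) / 2 = 1"
    by (subst (asm) ennreal_inj) (auto intro: add_nonneg_nonneg)
  then have "\<mu>1.prob X\<^sub>0 = 1" "\<mu>2.prob X\<^sub>0 = 1"
    using \<mu>1.prob_le_1[of X\<^sub>0] \<mu>2.prob_le_1[of X\<^sub>0] by argo+
  then have ae: "AE x in \<mu>\<^sub>1. x \<in> X\<^sub>0" "AE x in \<mu>\<^sub>2. x \<in> X\<^sub>0"
    using \<mu>1.AE_prob_1 \<mu>2.AE_prob_1 by auto
  have "AE p in L. fst p \<in> X\<^sub>0" "AE p in L. snd p \<in> X\<^sub>0"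
    using ae unfolding \<mu>\<^sub>1_def \<mu>\<^sub>2_def
    by (auto dest!: AE_distrD[OF q_meas[OF fst_q]] AE_distrD[OF q_meas[OF snd_q]])
  then have "AE p in L. pair_dist p = 0"
    using AE_space
  proof eventually_elim
    case (elim p)
    then have "\<pi> (fst p) = \<pi> (snd p)" by (auto simp: spL fiber_pairs_def)
    then have "fst p = snd p" using X0(3) elim by (auto simp: bij_betw_def dest: inj_onD)
    then show ?case by simp
  qed
  then have "integral\<^sup>L L pair_dist = 0" by (rule integral_eq_zero_AE)
  then show False using L(2) \<epsilon> by simp
qed

end

section \<open>Measurable sections\<close>

context dynamical_system
begin

text \<open>The points with arbitrarily long pasts. This set carries every invariant measure, and an
  equicontinuous map is injective on it.\<close>

definition eventual_image :: "'a set" where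
  "eventual_image = (\<Inter>n. (T ^^ n) ` X)"

lemma compact_iter_image: "compact ((T ^^ n) ` X)"
  by (rule compact_continuous_image[OF cont_iter compact_X])

lemma eventual_image_subset: "eventual_image \<subseteq> X"
  unfolding eventual_image_def by (rule INF_lower2[of 0]) auto

lemma compact_eventual_image: "compact eventual_image"
proof -
  have "closed eventual_image"
    unfolding eventual_image_def using compact_iter_image compact_imp_closed by blast
  moreover have "eventual_image = X \<inter> eventual_image" using eventual_image_subset by blast
  ultimately show ?thesis using compact_Int_closed[OF compact_X] by metis
qed

text \<open>Two points with the same image under \<open>T ^^ i\<close> have full backward orbits; if these return to
  themselves after \<open>l \<ge> i\<close> steps, equicontinuity shows that both points are close to a common
  point \<open>(T ^^ l) u = (T ^^ l) v\<close>.\<close>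

lemma inj_on_eventual_image:
  assumes equi: "equicontinuous X T"
  shows "inj_on (T ^^ i) eventual_image"
proof (rule inj_onI)
  fix u v assume uv: "u \<in> eventual_image" "v \<in> eventual_image" "(T ^^ i) u = (T ^^ i) v"
  have "\<forall>n. \<exists>y\<in>X. (T ^^ n) y = u" "\<forall>n. \<exists>y\<in>X. (T ^^ n) y = v"
    using uv(1,2) unfolding eventual_image_def by (metis INT_E UNIV_I imageE)+
  then obtain f g :: "nat \<Rightarrow> 'a" where f: "\<forall>n. f n \<in> X \<and> (T ^^ n) (f n) = u"
    and g: "\<forall>n. g n \<in> X \<and> (T ^^ n) (g n) = v" by metis
  have "dist u v \<le> 0"
  proof (rule field_le_epsilon)
    fix e :: real assume "e > 0"
    then have "e / 2 > 0" by simp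
    then obtain \<delta> where \<delta>: "\<delta> > 0" "\<forall>x\<in>X. \<forall>y\<in>X. dist x y < \<delta> \<longrightarrow> (\<forall>n. dist ((T ^^ n) x) ((T ^^ n) y) < e / 2)"
      using equi unfolding equicontinuous_def by meson
    have "\<forall>n. (f n, g n) \<in> X \<times> X" using f g by simp
    with spec[OF compact_pairs[unfolded compact_def], of "\<lambda>n. (f n, g n)"]
    obtain q and r :: "nat \<Rightarrow> nat" where r: "strict_mono r" "((\<lambda>n. (f n, g n)) \<circ> r) \<longlonglongrightarrow> q" by blast
    have "Cauchy ((\<lambda>n. (f n, g n)) \<circ> r)" using r(2) by (rule LIMSEQ_imp_Cauchy)
    then obtain M where M: "\<forall>a\<ge>M. \<forall>b\<ge>M. dist (((\<lambda>n. (f n, g n)) \<circ> r) a) (((\<lambda>n. (f n, g n)) \<circ> r) b) < \<delta>"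
      using \<delta>(1) unfolding Cauchy_def by blast
    \<comment> \<open>Two times at which the chosen preimages of both points are close. Applying
      \<open>T ^^ l\<close> sends \<open>f l\<close> to \<open>u\<close>, and \<open>f m\<close> to
      a point on the forward orbit of \<open>(T ^^ i) u\<close>, where the orbits of
      \<open>u\<close> and \<open>v\<close> have merged.\<close>
    define m l where "m = r M" and "l = r (M + i)"
    have "r (M + i) \<ge> r M + i"
    proof (induction i)
      case (Suc i)
      have "r (M + i) < r (M + Suc i)" using r(1) by (simp add: strict_mono_less)
      then show ?case using Suc by simp
    qed simp
    then have l: "m + i \<le> l" by (simp add: m_def l_def)
    have "dist (f m, g m) (f l, g l) < \<delta>" using M by (simp add: m_def l_def)
    then have "dist (f m) (f l) < \<delta>" "dist (g m) (g l) < \<delta>"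
      using dist_fst_le[of "(f m, g m)" "(f l, g l)"] dist_snd_le[of "(f m, g m)" "(f l, g l)"] by auto
    then have "dist ((T ^^ l) (f m)) ((T ^^ l) (f l)) < e / 2" "dist ((T ^^ l) (g m)) ((T ^^ l) (g l)) < e / 2"
      using \<delta>(2) f g by blast+
    moreover have "(T ^^ l) (f m) = (T ^^ (l - m - i)) ((T ^^ i) u)"
    proof -
      have "l = (l - m - i) + (i + m)" using l by simp
      then have "(T ^^ l) (f m) = (T ^^ (l - m - i)) ((T ^^ i) ((T ^^ m) (f m)))"
        by (metis comp_apply funpow_add)
      then show ?thesis using f by simp
    qed
    moreover have "(T ^^ l) (g m) = (T ^^ (l - m - i)) ((T ^^ i) u)"
    proof -
      have "l = (l - m - i) + (i + m)" using l by simp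
      then have "(T ^^ l) (g m) = (T ^^ (l - m - i)) ((T ^^ i) ((T ^^ m) (g m)))"
        by (metis comp_apply funpow_add)
      then show ?thesis using g uv(3) by simp
    qed
    ultimately have "dist ((T ^^ (l - m - i)) ((T ^^ i) u)) u < e / 2" "dist ((T ^^ (l - m - i)) ((T ^^ i) u)) v < e / 2"
      using f g by simp_all
    then show "dist u v \<le> 0 + e"
      using dist_triangle3[of u v "(T ^^ (l - m - i)) ((T ^^ i) u)"] by simp
  qed
  then show "u = v" by simp
qed

text \<open>Every \<open>(T ^^ n) x\<close> lies in the image of \<open>T ^^ n\<close>; invariance
  moves this trivial statement from \<open>(T ^^ n) x\<close> to \<open>x\<close>.\<close>

lemma AE_eventual_image:
  assumes \<mu>: "\<mu> \<in> invariant_measures X T"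
  shows "AE x in \<mu>. x \<in> eventual_image"
proof -
  have "AE x in \<mu>. x \<in> (T ^^ n) ` X" for n
  proof -
    have sets: "{x \<in> space \<mu>. x \<in> (T ^^ n) ` X} \<in> sets \<mu>"
    proof -
      have "{x \<in> space \<mu>. x \<in> (T ^^ n) ` X} = X \<inter> (T ^^ n) ` X"
        by (auto simp: space_invariant[OF \<mu>])
      also have "\<dots> \<in> sets \<mu>"
        using compact_imp_closed[OF compact_iter_image] by (auto simp: sets_invariant[OF \<mu>] sets_restrict_space)
      finally show ?thesis .
    qed
    have "(AE x in distr \<mu> \<mu> (T ^^ n). x \<in> (T ^^ n) ` X) \<longleftrightarrow> (AE x in \<mu>. (T ^^ n) x \<in> (T ^^ n) ` X)"
      by (rule AE_distr_iff[OF measurable_iter_invariant[OF \<mu>] sets])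
    moreover have "AE x in \<mu>. (T ^^ n) x \<in> (T ^^ n) ` X"
      by (rule AE_I2) (simp add: space_invariant[OF \<mu>])
    ultimately show ?thesis unfolding distr_iter_invariant[OF \<mu>] by blast
  qed
  then have "AE x in \<mu>. \<forall>n. x \<in> (T ^^ n) ` X" by (simp add: AE_all_countable)
  then show ?thesis by (simp add: eventual_image_def)
qed

end

context equicontinuous_factor
begin

text \<open>Points of \<open>X\<close> whose images in \<open>Z\<close> are close have orbits that are close on average.  So, up to a
  small average error, the orbit of \<open>x\<close> is determined by the piece of a fine partition of \<open>Z\<close> that
  contains \<open>\<pi> x\<close>; hence for some \<open>i\<close> the point \<open>(T ^^ i) x\<close> is nearly a function of \<open>\<pi> x\<close>.  As \<open>S ^^ i\<close> is
  injective almost everywhere, it is nearly a function of \<open>\<pi> ((T ^^ i) x)\<close>, and invariance removes \<open>T ^^ i\<close>.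
  Approximate sections are encoded by an index \<open>j\<close> into a sequence \<open>b\<close> of points.\<close>

lemma approximate_section:
  assumes BP: "Banach_proximal_map X T \<pi>" and \<mu>: "\<mu> \<in> invariant_measures X T"
    and \<nu>: "\<nu> \<in> invariant_measures Z S" "distr \<mu> \<nu> \<pi> = \<nu>" and "\<epsilon> > 0"
  shows "\<exists>(b :: nat \<Rightarrow> 'a) j. (\<forall>i. b i \<in> X) \<and> j \<in> measurable borel (count_space UNIV) \<and>
    integral\<^sup>L \<mu> (\<lambda>x. dist x (b (j (\<pi> x)))) \<le> \<epsilon>"
proof -
  interpret \<mu>: prob_space \<mu> by (rule prob_space_invariant[OF \<mu>])
  have sp: "space \<mu> = X" by (rule space_invariant[OF \<mu>])
  have "\<epsilon> / 2 > 0" using \<open>\<epsilon> > 0\<close> by simp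
  from dist_sum_le_of_near_fiber[OF BP this] obtain \<delta> C where \<delta>: "\<delta> > 0"
    and dist_sum_le: "\<forall>x\<in>X. \<forall>y\<in>X. dist (\<pi> x) (\<pi> y) < \<delta> \<longrightarrow> (\<forall>n. dist_sum T n x y \<le> \<epsilon> / 2 * real n + C)"
    by blast
  \<comment> \<open>At this length the constant \<open>C\<close> costs at most another
    \<open>\<epsilon> / 2\<close> on average.\<close>
  obtain n where n: "n > 0" "C \<le> \<epsilon> / 2 * real n"
  proof -
    obtain n where "C < real n * (\<epsilon> / 2)" using reals_Archimedean3[OF \<open>\<epsilon> / 2 > 0\<close>] by blast
    also have "\<dots> \<le> real (Suc n) * (\<epsilon> / 2)" using \<open>\<epsilon> > 0\<close> by (intro mult_right_mono) auto
    finally show thesis using that[of "Suc n"] by (simp add: mult.commute)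
  qed
  obtain d :: "nat \<Rightarrow> 'b" where d: "\<forall>n. d n \<in> Z" "\<forall>x\<in>Z. \<forall>e>0. \<exists>n. dist (d n) x < e"
    using compact_dense_sequence[OF Z.compact_X Z.X_nonempty] by blast
  have "\<forall>k. \<exists>x. x \<in> X \<and> \<pi> x = d k" using d(1) \<pi>_image by (metis imageE)
  then obtain a :: "nat \<Rightarrow> 'a" where a: "\<forall>k. a k \<in> X \<and> \<pi> (a k) = d k" by metis
  \<comment> \<open>\<open>J\<close> partitions \<open>Z\<close> measurably into small pieces, and
    \<open>a k\<close>, in the fibre over \<open>d k\<close>, represents the piece with index
    \<open>k\<close>.\<close>
  define J where "J = (\<lambda>z. LEAST k. dist (d k) z < \<delta>)"
  have J_meas: "J \<in> measurable borel (count_space UNIV)"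
  proof -
    have "Measurable.pred borel (\<lambda>z. dist (d k) z < \<delta>)" for k
    proof -
      have "{z. dist (d k) z < \<delta>} = ball (d k) \<delta>" by auto
      then show ?thesis by (simp add: pred_def)
    qed
    then show ?thesis unfolding J_def by (rule measurable_Least)
  qed
  have J: "dist (\<pi> x) (\<pi> (a (J (\<pi> x)))) < \<delta>" if "x \<in> X" for x
  proof -
    have "\<exists>k. dist (d k) (\<pi> x) < \<delta>" using d(2) \<delta> that by blast
    then have "dist (d (J (\<pi> x))) (\<pi> x) < \<delta>" unfolding J_def by (rule LeastI_ex)
    then show ?thesis using a by (simp add: dist_commute)
  qed
  have \<pi>_borel: "\<pi> \<in> measurable \<mu> borel" by (rule borel_measurable_continuous_invariant[OF \<mu> cont_\<pi>])
  \<comment> \<open>Without separability, the distance of two measurable maps need not be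
    measurable. If one of them takes countably many values, it is glued from countably many
    measurable functions.\<close>
  have meas: "(\<lambda>x. dist ((T ^^ i) x) (c (k (\<pi> x)))) \<in> borel_measurable \<mu>"
    if k: "k \<in> measurable borel (count_space UNIV)" for i and c :: "nat \<Rightarrow> 'a" and k
  proof (rule measurable_compose_countable[where g="\<lambda>x. k (\<pi> x)" and f="\<lambda>l x. dist ((T ^^ i) x) (c l)"])
    show "(\<lambda>x. dist ((T ^^ i) x) (c l)) \<in> borel_measurable \<mu>" for l
      by (intro borel_measurable_continuous_invariant[OF \<mu>] continuous_on_dist cont_iter continuous_on_const)
    show "(\<lambda>x. k (\<pi> x)) \<in> measurable \<mu> (count_space UNIV)"
      by (rule measurable_compose[OF \<pi>_borel k])
  qed
  define h where "h = (\<lambda>i x. dist ((T ^^ i) x) ((T ^^ i) (a (J (\<pi> x)))))"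
  have h_int: "integrable \<mu> (h i)" for i
  proof (rule \<mu>.integrable_const_bound[where B="diameter X"])
    show "AE x in \<mu>. norm (h i x) \<le> diameter X"
      by (rule AE_I2) (use a in \<open>simp add: h_def sp dist_le_diameter\<close>)
    show "h i \<in> borel_measurable \<mu>"
      unfolding h_def by (rule meas[OF J_meas, of i "\<lambda>l. (T ^^ i) (a l)"])
  qed
  have "(\<Sum>i<n. integral\<^sup>L \<mu> (h i)) = integral\<^sup>L \<mu> (\<lambda>x. \<Sum>i<n. h i x)"
    using h_int by simp
  also have "\<dots> \<le> integral\<^sup>L \<mu> (\<lambda>x. \<epsilon> * real n)"
  proof (rule integral_mono)
    fix x assume "x \<in> space \<mu>"
    then have "x \<in> X" by (simp add: sp)
    have "(\<Sum>i<n. h i x) = dist_sum T n x (a (J (\<pi> x)))" by (simp add: h_def dist_sum_def)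
    also have "\<dots> \<le> \<epsilon> / 2 * real n + C" using dist_sum_le \<open>x \<in> X\<close> a J by blast
    finally show "(\<Sum>i<n. h i x) \<le> \<epsilon> * real n" using n(2) by linarith
  qed (use h_int in auto)
  finally have sum_le: "(\<Sum>i<n. integral\<^sup>L \<mu> (h i)) \<le> \<epsilon> * real n" by (simp add: \<mu>.prob_space)
  \<comment> \<open>Only the sum over \<open>i\<close> is controlled, so a good \<open>i\<close>
    exists but cannot be prescribed to be 0; this is why \<open>S ^^ i\<close> has to be
    inverted.\<close>
  have "\<exists>i<n. integral\<^sup>L \<mu> (h i) \<le> \<epsilon>"
  proof (rule ccontr)
    assume "\<not> ?thesis"
    then have "(\<Sum>i<n. \<epsilon>) < (\<Sum>i<n. integral\<^sup>L \<mu> (h i))"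
      using n(1) by (intro sum_strict_mono) (auto simp: not_le)
    then show False using sum_le by (simp add: mult.commute)
  qed
  then obtain i where i: "integral\<^sup>L \<mu> (h i) \<le> \<epsilon>" by blast
  let ?E = "Z.eventual_image"
  define W where "W = (S ^^ i) ` ?E"
  \<comment> \<open>A Borel inverse of \<open>S ^^ i\<close> on the image of the compact set
    \<open>?E\<close>; \<open>d 0\<close> is a default value off \<open>W\<close>.\<close>
  define q where "q = (\<lambda>z. if z \<in> W then inv_into ?E (S ^^ i) z else d 0)"
  have cont_E: "continuous_on ?E (S ^^ i)"
    using Z.cont_iter Z.eventual_image_subset by (rule continuous_on_subset)
  have inj: "inj_on (S ^^ i) ?E" by (rule Z.inj_on_eventual_image[OF equi])
  have "compact W" unfolding W_def by (rule compact_continuous_image[OF cont_E Z.compact_eventual_image])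
  have "continuous_on W (inv_into ?E (S ^^ i))"
    unfolding W_def by (rule continuous_on_inv[OF cont_E Z.compact_eventual_image]) (simp add: inj)
  then have q_meas: "q \<in> measurable borel borel"
    unfolding q_def using \<open>compact W\<close>
    by (intro borel_measurable_continuous_on_if) (auto intro: borel_closed compact_imp_closed)
  define b where "b = (\<lambda>l. (T ^^ i) (a l))"
  define j where "j = (\<lambda>z. J (q z))"
  have j_meas: "j \<in> measurable borel (count_space UNIV)"
    unfolding j_def by (rule measurable_compose[OF q_meas J_meas])
  have E_ae: "AE x in \<mu>. \<pi> x \<in> ?E"
  proof -
    have \<pi>\<nu>: "\<pi> \<in> measurable \<mu> \<nu>" by (rule measurable_\<pi>_invariant[OF \<mu> Z.sets_invariant[OF \<nu>(1)]])
    have "AE z in distr \<mu> \<nu> \<pi>. z \<in> ?E" unfolding \<nu>(2) by (rule Z.AE_eventual_image[OF \<nu>(1)])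
    then show ?thesis by (rule AE_distrD[OF \<pi>\<nu>])
  qed
  have meas_b: "(\<lambda>x. dist x (b (j (\<pi> x)))) \<in> borel_measurable \<mu>"
    using meas[OF j_meas, of 0 b] by simp
  \<comment> \<open>Invariance replaces \<open>x\<close> by \<open>(T ^^ i) x\<close>; then
    \<open>q\<close> recovers \<open>\<pi> x\<close> almost everywhere, and the integrand becomes
    \<open>h i\<close>.\<close>
  have "integral\<^sup>L \<mu> (\<lambda>x. dist x (b (j (\<pi> x)))) = integral\<^sup>L (distr \<mu> \<mu> (T ^^ i)) (\<lambda>x. dist x (b (j (\<pi> x))))"
    by (simp add: distr_iter_invariant[OF \<mu>])
  also have "\<dots> = integral\<^sup>L \<mu> (\<lambda>x. dist ((T ^^ i) x) (b (j (\<pi> ((T ^^ i) x)))))"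
    by (rule integral_distr[OF measurable_iter_invariant[OF \<mu>] meas_b])
  also have "\<dots> = integral\<^sup>L \<mu> (h i)"
  proof (rule integral_cong_AE)
    show "(\<lambda>x. dist ((T ^^ i) x) (b (j (\<pi> ((T ^^ i) x))))) \<in> borel_measurable \<mu>"
      by (rule measurable_compose[OF measurable_iter_invariant[OF \<mu>] meas_b])
    show "h i \<in> borel_measurable \<mu>" using h_int by blast
    show "AE x in \<mu>. dist ((T ^^ i) x) (b (j (\<pi> ((T ^^ i) x)))) = h i x"
      using E_ae AE_space
    proof eventually_elim
      case (elim x)
      then have "q (\<pi> ((T ^^ i) x)) = \<pi> x"
        using inj by (simp add: \<pi>_iter sp q_def W_def)
      then show ?case by (simp add: h_def b_def j_def)
    qed
  qed
  finally have "integral\<^sup>L \<mu> (\<lambda>x. dist x (b (j (\<pi> x)))) \<le> \<epsilon>" using i by simp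
  moreover have "\<forall>l. b l \<in> X" using a by (simp add: b_def)
  ultimately show ?thesis using j_meas by blast
qed

end

section \<open>From approximate sections to a measurable inverse\<close>

text \<open>With countably many tolerances and thresholds, sets of convergence are visibly
  measurable.\<close>

lemma nonneg_null_sequence_iff:
  fixes f :: "nat \<Rightarrow> real"
  assumes "\<And>k. 0 \<le> f k"
  shows "f \<longlonglongrightarrow> 0 \<longleftrightarrow> (\<forall>m. \<exists>N. \<forall>k\<ge>N. f k < 1 / real (Suc m))"
proof
  assume *: "f \<longlonglongrightarrow> 0"
  show "\<forall>m. \<exists>N. \<forall>k\<ge>N. f k < 1 / real (Suc m)"
  proof
    fix m
    have "0 < 1 / real (Suc m)" by simp
    with * have "\<forall>\<^sub>F k in sequentially. f k < 1 / real (Suc m)" by (rule order_tendstoD(2))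
    then show "\<exists>N. \<forall>k\<ge>N. f k < 1 / real (Suc m)" by (simp only: eventually_sequentially)
  qed
next
  assume *: "\<forall>m. \<exists>N. \<forall>k\<ge>N. f k < 1 / real (Suc m)"
  show "f \<longlonglongrightarrow> 0"
  proof (rule LIMSEQ_I)
    fix r :: real assume "0 < r"
    then obtain m where m: "1 / real (Suc m) < r" using nat_approx_posE by blast
    obtain N where "\<forall>k\<ge>N. f k < 1 / real (Suc m)" using * by blast
    then have "\<forall>k\<ge>N. norm (f k - 0) < r" using m assms by fastforce
    then show "\<exists>no. \<forall>n\<ge>no. norm (f n - 0) < r" by blast
  qed
qed

context equicontinuous_factor
begin

text \<open>The errors \<open>(1 / 2) ^ k\<close> are summable, so the sum of all distances has
  finite integral and is finite almost everywhere; its terms then tend to 0.\<close>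

lemma convergent_sections:
  assumes BP: "Banach_proximal_map X T \<pi>" and \<mu>: "\<mu> \<in> invariant_measures X T"
    and \<nu>: "\<nu> \<in> invariant_measures Z S" "distr \<mu> \<nu> \<pi> = \<nu>"
  shows "\<exists>(b :: nat \<Rightarrow> nat \<Rightarrow> 'a) j. (\<forall>k i. b k i \<in> X) \<and> (\<forall>k. j k \<in> measurable borel (count_space UNIV)) \<and>
    (AE x in \<mu>. (\<lambda>k. dist x (b k (j k (\<pi> x)))) \<longlonglongrightarrow> 0)"
proof -
  interpret \<mu>: prob_space \<mu> by (rule prob_space_invariant[OF \<mu>])
  have sp: "space \<mu> = X" by (rule space_invariant[OF \<mu>])
  have "\<forall>k. \<exists>(b :: nat \<Rightarrow> 'a) j. (\<forall>i. b i \<in> X) \<and> j \<in> measurable borel (count_space UNIV) \<and>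
    integral\<^sup>L \<mu> (\<lambda>x. dist x (b (j (\<pi> x)))) \<le> (1 / 2) ^ k"
    by (rule allI, rule approximate_section[OF BP \<mu> \<nu>]) simp
  from choice[OF this] obtain b :: "nat \<Rightarrow> nat \<Rightarrow> 'a"
    where "\<forall>k. \<exists>j. (\<forall>i. b k i \<in> X) \<and> j \<in> measurable borel (count_space UNIV) \<and>
      integral\<^sup>L \<mu> (\<lambda>x. dist x (b k (j (\<pi> x)))) \<le> (1 / 2) ^ k" by blast
  from choice[OF this] obtain j :: "nat \<Rightarrow> 'b \<Rightarrow> nat"
    where bj: "\<forall>k. (\<forall>i. b k i \<in> X) \<and> j k \<in> measurable borel (count_space UNIV) \<and>
      integral\<^sup>L \<mu> (\<lambda>x. dist x (b k (j k (\<pi> x)))) \<le> (1 / 2) ^ k" by blast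
  define u where "u = (\<lambda>k x. dist x (b k (j k (\<pi> x))))"
  have \<pi>_borel: "\<pi> \<in> measurable \<mu> borel" by (rule borel_measurable_continuous_invariant[OF \<mu> cont_\<pi>])
  have u_meas: "u k \<in> borel_measurable \<mu>" for k
    unfolding u_def
  proof (rule measurable_compose_countable[where g="\<lambda>x. j k (\<pi> x)" and f="\<lambda>l x. dist x (b k l)"])
    show "(\<lambda>x. dist x (b k l)) \<in> borel_measurable \<mu>" for l
      by (intro borel_measurable_continuous_invariant[OF \<mu>] continuous_intros)
    show "(\<lambda>x. j k (\<pi> x)) \<in> measurable \<mu> (count_space UNIV)"
      using measurable_compose[OF \<pi>_borel] bj by blast
  qed
  have u_int: "integrable \<mu> (u k)" for k
  proof (rule \<mu>.integrable_const_bound[where B="diameter X"])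
    show "AE x in \<mu>. norm (u k x) \<le> diameter X"
      by (rule AE_I2) (use bj in \<open>simp add: u_def sp dist_le_diameter\<close>)
  qed (rule u_meas)
  have "(\<integral>\<^sup>+x. (\<Sum>k. ennreal (u k x)) \<partial>\<mu>) = (\<Sum>k. \<integral>\<^sup>+x. ennreal (u k x) \<partial>\<mu>)"
    using u_meas by (intro nn_integral_suminf) auto
  also have "\<dots> \<le> (\<Sum>k. ennreal ((1 / 2) ^ k))"
  proof (rule suminf_le)
    fix k
    have "(\<integral>\<^sup>+x. ennreal (u k x) \<partial>\<mu>) = ennreal (integral\<^sup>L \<mu> (u k))"
      by (rule nn_integral_eq_integral[OF u_int]) (simp add: u_def)
    also have "\<dots> \<le> ennreal ((1 / 2) ^ k)"
      using bj by (intro ennreal_leI) (simp add: u_def)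
    finally show "(\<integral>\<^sup>+x. ennreal (u k x) \<partial>\<mu>) \<le> ennreal ((1 / 2) ^ k)" .
  qed auto
  also have "\<dots> = ennreal (\<Sum>k. (1 / 2) ^ k)"
    by (rule suminf_ennreal2) (auto intro: summable_geometric)
  finally have "(\<integral>\<^sup>+x. (\<Sum>k. ennreal (u k x)) \<partial>\<mu>) \<noteq> \<infinity>"
    by (auto simp: top_unique)
  then have "AE x in \<mu>. (\<Sum>k. ennreal (u k x)) \<noteq> \<infinity>"
    using u_meas by (intro nn_integral_PInf_AE) auto
  then have "AE x in \<mu>. (\<lambda>k. u k x) \<longlonglongrightarrow> 0"
  proof eventually_elim
    case (elim x)
    then have "summable (\<lambda>k. u k x)"
      by (intro summable_suminf_not_top) (auto simp: u_def)
    then show ?case by (rule summable_LIMSEQ_zero)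
  qed
  then show ?thesis using bj unfolding u_def by blast
qed

lemma Banach_proximal_map_imp_isomorphism:
  assumes BP: "Banach_proximal_map X T \<pi>" and \<mu>: "\<mu> \<in> invariant_measures X T"
    and \<nu>: "\<nu> \<in> invariant_measures Z S" "distr \<mu> \<nu> \<pi> = \<nu>"
  shows "measure_theoretic_isomorphism \<mu> T \<nu> S \<pi>"
proof -
  interpret \<mu>: prob_space \<mu> by (rule prob_space_invariant[OF \<mu>])
  interpret \<nu>: prob_space \<nu> by (rule Z.prob_space_invariant[OF \<nu>(1)])
  have sp: "space \<mu> = X" by (rule space_invariant[OF \<mu>])
  have sp\<nu>: "space \<nu> = Z" by (rule Z.space_invariant[OF \<nu>(1)])
  have \<pi>_borel: "\<pi> \<in> measurable \<mu> borel" by (rule borel_measurable_continuous_invariant[OF \<mu> cont_\<pi>])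
  have \<pi>\<nu>: "\<pi> \<in> measurable \<mu> \<nu>" by (rule measurable_\<pi>_invariant[OF \<mu> Z.sets_invariant[OF \<nu>(1)]])
  obtain b :: "nat \<Rightarrow> nat \<Rightarrow> 'a" and j where b: "\<forall>k i. b k i \<in> X"
    and j: "\<forall>k. j k \<in> measurable borel (count_space UNIV)"
    and ae: "AE x in \<mu>. (\<lambda>k. dist x (b k (j k (\<pi> x)))) \<longlonglongrightarrow> 0"
    using convergent_sections[OF BP \<mu> \<nu>] by blast
  define s where "s = (\<lambda>k z. b k (j k z))"
  have s_in: "s k z \<in> X" for k z using b by (simp add: s_def)
  have j\<nu>: "j k \<in> measurable \<nu> (count_space UNIV)" for k
    using measurable_restrict_space1[of "j k" borel "count_space UNIV" Z] j
      measurable_cong_sets[OF Z.sets_invariant[OF \<nu>(1)] refl] by blast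
  have s_borel: "s k \<in> borel_measurable \<nu>" for k
    unfolding s_def by (rule measurable_compose[OF j\<nu>]) simp
  define X\<^sub>2 where "X\<^sub>2 = {x \<in> X. (\<lambda>k. dist x (s k (\<pi> x))) \<longlonglongrightarrow> 0}"
  \<comment> \<open>Convergence alone does not place the limit in the fibre over \<open>z\<close>;
    the second condition does.\<close>
  define Z\<^sub>2 where "Z\<^sub>2 = {z \<in> Z. Cauchy (\<lambda>k. s k z) \<and> (\<lambda>k. dist z (\<pi> (s k z))) \<longlonglongrightarrow> 0}"
  define \<sigma> where "\<sigma> = (\<lambda>z. lim (\<lambda>k. s k z))"
  have X2_sets: "X\<^sub>2 \<in> sets \<mu>"
  proof -
    have [measurable]: "(\<lambda>x. dist x (s k (\<pi> x))) \<in> borel_measurable \<mu>" for k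
      unfolding s_def
    proof (rule measurable_compose_countable[where g="\<lambda>x. j k (\<pi> x)" and f="\<lambda>l x. dist x (b k l)"])
      show "(\<lambda>x. dist x (b k l)) \<in> borel_measurable \<mu>" for l
        by (intro borel_measurable_continuous_invariant[OF \<mu>] continuous_intros)
      show "(\<lambda>x. j k (\<pi> x)) \<in> measurable \<mu> (count_space UNIV)"
        using measurable_compose[OF \<pi>_borel] j by blast
    qed
    have "{x \<in> space \<mu>. \<forall>m. \<exists>N. \<forall>k\<ge>N. dist x (s k (\<pi> x)) < 1 / real (Suc m)} \<in> sets \<mu>"
      by measurable
    then show ?thesis by (simp only: X\<^sub>2_def sp nonneg_null_sequence_iff[OF zero_le_dist])
  qed
  have Z2_sets: "Z\<^sub>2 \<in> sets \<nu>"
  proof -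
    have [measurable]: "(\<lambda>z. dist z (\<pi> (s k z))) \<in> borel_measurable \<nu>" for k
      unfolding s_def
    proof (rule measurable_compose_countable[where g="j k" and f="\<lambda>l z. dist z (\<pi> (b k l))"])
      show "(\<lambda>z. dist z (\<pi> (b k l))) \<in> borel_measurable \<nu>" for l
        by (intro Z.borel_measurable_continuous_invariant[OF \<nu>(1)] continuous_intros)
    qed (rule j\<nu>)
    have [measurable]: "(\<lambda>z. dist (s k z) (s l z)) \<in> borel_measurable \<nu>" for k l
      unfolding s_def
    proof (rule measurable_compose_countable[where g="j k" and f="\<lambda>m z. dist (b k m) (b l (j l z))"])
      show "(\<lambda>z. dist (b k m) (b l (j l z))) \<in> borel_measurable \<nu>" for m
        by (rule measurable_compose[OF j\<nu>]) simp
    qed (rule j\<nu>)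
    have "{z \<in> space \<nu>. (\<forall>m. \<exists>N. \<forall>k\<ge>N. \<forall>l\<ge>N. dist (s k z) (s l z) < inverse (real (Suc m))) \<and>
        (\<forall>m. \<exists>N. \<forall>k\<ge>N. dist z (\<pi> (s k z)) < 1 / real (Suc m))} \<in> sets \<nu>"
      by measurable
    then show ?thesis
      by (simp only: Z\<^sub>2_def sp\<nu> nonneg_null_sequence_iff[OF zero_le_dist] metric_Cauchy_iff2)
  qed
  have lim_s: "(\<lambda>k. s k z) \<longlonglongrightarrow> \<sigma> z" "\<sigma> z \<in> X" if "z \<in> Z\<^sub>2" for z
  proof -
    have "Cauchy (\<lambda>k. s k z)" using that by (simp add: Z\<^sub>2_def)
    then have "\<exists>x\<in>X. (\<lambda>k. s k z) \<longlonglongrightarrow> x"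
      using spec[OF compact_imp_complete[OF compact_X, unfolded complete_def], of "\<lambda>k. s k z"] s_in
      by simp
    then obtain x where x: "x \<in> X" "(\<lambda>k. s k z) \<longlonglongrightarrow> x" by blast
    then show "(\<lambda>k. s k z) \<longlonglongrightarrow> \<sigma> z" "\<sigma> z \<in> X" unfolding \<sigma>_def by (simp_all add: limI)
  qed
  have X2D: "\<pi> x \<in> Z\<^sub>2" "\<sigma> (\<pi> x) = x" if x: "x \<in> X\<^sub>2" for x
  proof -
    have "x \<in> X" and null: "(\<lambda>k. dist x (s k (\<pi> x))) \<longlonglongrightarrow> 0" using x by (auto simp: X\<^sub>2_def)
    from null have lim: "(\<lambda>k. s k (\<pi> x)) \<longlonglongrightarrow> x"
      by (subst tendsto_dist_iff) (simp add: dist_commute)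
    then show "\<sigma> (\<pi> x) = x" unfolding \<sigma>_def by (rule limI)
    have "(\<lambda>k. \<pi> (s k (\<pi> x))) \<longlonglongrightarrow> \<pi> x"
      by (rule continuous_on_tendsto_compose[OF cont_\<pi> lim \<open>x \<in> X\<close>]) (simp add: s_in)
    then have "(\<lambda>k. dist (\<pi> x) (\<pi> (s k (\<pi> x)))) \<longlonglongrightarrow> 0"
      by (subst (asm) tendsto_dist_iff) (simp add: dist_commute)
    then show "\<pi> x \<in> Z\<^sub>2" using LIMSEQ_imp_Cauchy[OF lim] \<open>x \<in> X\<close> by (simp add: Z\<^sub>2_def)
  qed
  have Z2D: "\<sigma> z \<in> X\<^sub>2" "\<pi> (\<sigma> z) = z" if z: "z \<in> Z\<^sub>2" for z
  proof -
    have "(\<lambda>k. \<pi> (s k z)) \<longlonglongrightarrow> \<pi> (\<sigma> z)"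
      by (rule continuous_on_tendsto_compose[OF cont_\<pi> lim_s[OF z]]) (simp add: s_in)
    moreover have "(\<lambda>k. \<pi> (s k z)) \<longlonglongrightarrow> z"
      using z by (subst tendsto_dist_iff) (simp add: dist_commute Z\<^sub>2_def)
    ultimately show eq: "\<pi> (\<sigma> z) = z" by (rule LIMSEQ_unique)
    have "(\<lambda>k. dist (\<sigma> z) (s k z)) \<longlonglongrightarrow> 0"
      using lim_s(1)[OF z] by (subst (asm) tendsto_dist_iff) (simp add: dist_commute)
    then show "\<sigma> z \<in> X\<^sub>2" using lim_s(2)[OF z] by (simp add: X\<^sub>2_def eq)
  qed
  \<comment> \<open>Intersecting over all iterates gives forward invariance, at no cost in measure
    since \<open>\<mu>\<close> is invariant.\<close>
  define X\<^sub>0 where "X\<^sub>0 = {x \<in> X. \<forall>n. (T ^^ n) x \<in> X\<^sub>2}"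
  \<comment> \<open>This is the image of \<open>X\<^sub>0\<close> under \<open>\<pi>\<close>,
    written as a preimage under \<open>\<sigma>\<close>, so its measurability follows from that of
    \<open>\<sigma>\<close> without a theorem on injective Borel images.\<close>
  define Z\<^sub>0 where "Z\<^sub>0 = {z \<in> Z\<^sub>2. \<sigma> z \<in> X\<^sub>0}"
  have X0_sub: "X\<^sub>0 \<subseteq> X\<^sub>2"
  proof
    fix x assume "x \<in> X\<^sub>0"
    then have "(T ^^ 0) x \<in> X\<^sub>2" unfolding X\<^sub>0_def by blast
    then show "x \<in> X\<^sub>2" by simp
  qed
  have X0_sets: "X\<^sub>0 \<in> sets \<mu>"
  proof -
    have "{x \<in> space \<mu>. (T ^^ n) x \<in> X\<^sub>2} \<in> sets \<mu>" for n
      using measurable_sets[OF measurable_iter_invariant[OF \<mu>, of n] X2_sets]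
      by (simp add: vimage_def Int_def conj_commute)
    then have "{x \<in> space \<mu>. \<forall>n. (T ^^ n) x \<in> X\<^sub>2} \<in> sets \<mu>" by (rule sets.sets_Collect_countable_All)
    then show ?thesis by (simp add: X\<^sub>0_def sp)
  qed
  have T_X0: "T ` X\<^sub>0 \<subseteq> X\<^sub>0"
  proof clarify
    fix x assume x: "x \<in> X\<^sub>0"
    have "(T ^^ n) (T x) \<in> X\<^sub>2" for n
    proof -
      have "(T ^^ Suc n) x \<in> X\<^sub>2" using x unfolding X\<^sub>0_def by blast
      then show ?thesis by (simp add: funpow_swap1)
    qed
    then show "T x \<in> X\<^sub>0" using x by (simp add: X\<^sub>0_def)
  qed
  have "AE x in \<mu>. x \<in> X\<^sub>2"
    using ae AE_space by eventually_elim (simp add: X\<^sub>2_def s_def sp)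
  then have "AE x in distr \<mu> \<mu> (T ^^ n). x \<in> X\<^sub>2" for n
    unfolding distr_iter_invariant[OF \<mu>] .
  then have "AE x in \<mu>. (T ^^ n) x \<in> X\<^sub>2" for n
    by (rule AE_distrD[OF measurable_iter_invariant[OF \<mu>]])
  then have "AE x in \<mu>. \<forall>n. (T ^^ n) x \<in> X\<^sub>2" by (simp add: AE_all_countable)
  then have X0_ae: "AE x in \<mu>. x \<in> X\<^sub>0"
    using AE_space by eventually_elim (simp add: X\<^sub>0_def sp)
  then have X0_one: "emeasure \<mu> X\<^sub>0 = 1"
    using \<mu>.emeasure_eq_1_AE[OF X0_sets] by blast
  have bij: "bij_betw \<pi> X\<^sub>0 Z\<^sub>0"
  proof (rule bij_betw_byWitness[where f'=\<sigma>])
    show "\<forall>x\<in>X\<^sub>0. \<sigma> (\<pi> x) = x" using X2D X0_sub by blast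
    show "\<forall>z\<in>Z\<^sub>0. \<pi> (\<sigma> z) = z" using Z2D by (simp add: Z\<^sub>0_def)
    show "\<pi> ` X\<^sub>0 \<subseteq> Z\<^sub>0"
    proof clarify
      fix x assume "x \<in> X\<^sub>0"
      then show "\<pi> x \<in> Z\<^sub>0" using X2D[of x] X0_sub by (auto simp: Z\<^sub>0_def)
    qed
    show "\<sigma> ` Z\<^sub>0 \<subseteq> X\<^sub>0" by (auto simp: Z\<^sub>0_def)
  qed
  have S_Z0: "S ` Z\<^sub>0 \<subseteq> Z\<^sub>0"
  proof clarify
    fix z assume "z \<in> Z\<^sub>0"
    then obtain x where x: "x \<in> X\<^sub>0" "z = \<pi> x" using bij by (auto simp: bij_betw_def)
    then have "S z = \<pi> (T x)" using \<pi>_T by (simp add: X\<^sub>0_def)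
    moreover have "T x \<in> X\<^sub>0" using T_X0 x(1) by blast
    ultimately show "S z \<in> Z\<^sub>0" using bij by (auto simp: bij_betw_def)
  qed
  have sigma_meas: "\<sigma> \<in> borel_measurable (restrict_space \<nu> Z\<^sub>2)"
  proof (rule borel_measurable_LIMSEQ_metric)
    show "s k \<in> borel_measurable (restrict_space \<nu> Z\<^sub>2)" for k
      by (rule measurable_restrict_space1[OF s_borel])
    show "(\<lambda>k. s k z) \<longlonglongrightarrow> \<sigma> z" if "z \<in> space (restrict_space \<nu> Z\<^sub>2)" for z
      using that by (intro lim_s) (simp add: space_restrict_space)
  qed
  have Z0_sets: "Z\<^sub>0 \<in> sets \<nu>"
  proof -
    obtain B where B: "B \<in> sets borel" "X\<^sub>0 = X \<inter> B"
      using X0_sets by (auto simp: sets_invariant[OF \<mu>] sets_restrict_space)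
    have "\<sigma> -` B \<inter> space (restrict_space \<nu> Z\<^sub>2) \<in> sets (restrict_space \<nu> Z\<^sub>2)"
      by (rule measurable_sets[OF sigma_meas B(1)])
    moreover have "\<sigma> -` B \<inter> space (restrict_space \<nu> Z\<^sub>2) = Z\<^sub>0"
      using lim_s(2) sets.sets_into_space[OF Z2_sets] by (auto simp: space_restrict_space Z\<^sub>0_def B(2))
    ultimately show ?thesis using Z2_sets by (simp add: sets_restrict_space_iff)
  qed
  have Z0_one: "emeasure \<nu> Z\<^sub>0 = 1"
  proof -
    have "AE x in \<mu>. \<pi> x \<in> Z\<^sub>0"
      using X0_ae by eventually_elim (use bij in \<open>auto simp: bij_betw_def\<close>)
    moreover have "{z \<in> space \<nu>. z \<in> Z\<^sub>0} \<in> sets \<nu>"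
      using Z0_sets sets.sets_into_space[OF Z0_sets] by (simp add: Collect_conj_eq Int_absorb1)
    ultimately have "AE z in distr \<mu> \<nu> \<pi>. z \<in> Z\<^sub>0"
      using AE_distr_iff[OF \<pi>\<nu>, of "\<lambda>z. z \<in> Z\<^sub>0"] by blast
    then have "AE z in \<nu>. z \<in> Z\<^sub>0" unfolding \<nu>(2) .
    then show ?thesis using \<nu>.emeasure_eq_1_AE[OF Z0_sets] by blast
  qed
  have \<pi>_rest: "\<pi> \<in> measurable (restrict_space \<mu> X\<^sub>0) (restrict_space \<nu> Z\<^sub>0)"
    using bij by (intro measurable_restrict_space3[OF \<pi>\<nu>]) (auto simp: bij_betw_def)
  have inv_eq: "the_inv_into X\<^sub>0 \<pi> z = \<sigma> z" if "z \<in> Z\<^sub>0" for z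
    using that bij Z2D by (intro the_inv_into_f_eq) (auto simp: bij_betw_def Z\<^sub>0_def)
  have inv_rest: "the_inv_into X\<^sub>0 \<pi> \<in> measurable (restrict_space \<nu> Z\<^sub>0) (restrict_space \<mu> X\<^sub>0)"
  proof -
    have "\<sigma> \<in> borel_measurable (restrict_space (restrict_space \<nu> Z\<^sub>2) Z\<^sub>0)"
      by (rule measurable_restrict_space1[OF sigma_meas])
    also have "restrict_space (restrict_space \<nu> Z\<^sub>2) Z\<^sub>0 = restrict_space \<nu> Z\<^sub>0"
    proof -
      have "Z\<^sub>2 \<inter> Z\<^sub>0 = Z\<^sub>0" by (auto simp: Z\<^sub>0_def)
      then show ?thesis using Z2_sets Z0_sets by (subst restrict_restrict_space) auto
    qed
    finally have "\<sigma> \<in> borel_measurable (restrict_space \<nu> Z\<^sub>0)" .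
    then have "\<sigma> \<in> measurable (restrict_space \<nu> Z\<^sub>0) (restrict_space borel X)"
      using lim_s(2) by (intro measurable_restrict_space2) (auto simp: space_restrict_space Z\<^sub>0_def)
    then have "\<sigma> \<in> measurable (restrict_space \<nu> Z\<^sub>0) \<mu>"
      using measurable_cong_sets[OF refl sets_invariant[OF \<mu>]] by blast
    then have "\<sigma> \<in> measurable (restrict_space \<nu> Z\<^sub>0) (restrict_space \<mu> X\<^sub>0)"
      by (intro measurable_restrict_space2) (auto simp: space_restrict_space Z\<^sub>0_def)
    then show ?thesis
      by (subst measurable_cong[where g=\<sigma>]) (auto simp: space_restrict_space inv_eq)
  qed
  show ?thesis
    unfolding measure_theoretic_isomorphism_def
    using X0_sets Z0_sets T_X0 S_Z0 X0_one Z0_one bij \<pi>_rest inv_rest by blast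
qed

end

theorem theorem4p3:
  fixes X :: "'a::metric_space set" and T :: "'a \<Rightarrow> 'a"
    and Z :: "'b::metric_space set" and S :: "'b \<Rightarrow> 'b"
    and \<pi> :: "'a \<Rightarrow> 'b"
  assumes "topological_dynamical_system X T"
    and "maximal_equicontinuous_factor X T Z S \<pi>"
  shows "(mean_equicontinuous X T \<longleftrightarrow> Banach_proximal_map X T \<pi>) \<and>
    (Banach_proximal_map X T \<pi> \<longleftrightarrow>
       Banach_proximal_pairs X T = proximal_pairs X T \<and>
       proximal_pairs X T = regionally_proximal_pairs X T) \<and>
    ((Banach_proximal_pairs X T = proximal_pairs X T \<and>
      proximal_pairs X T = regionally_proximal_pairs X T) \<longleftrightarrow>
       (\<forall>\<mu>\<in>invariant_measures X T. \<forall>\<nu>\<in>invariant_measures Z S.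
          distr \<mu> \<nu> \<pi> = \<nu> \<longrightarrow> measure_theoretic_isomorphism \<mu> T \<nu> S \<pi>)) \<and>
    ((\<forall>\<mu>\<in>invariant_measures X T. \<forall>\<nu>\<in>invariant_measures Z S.
          distr \<mu> \<nu> \<pi> = \<nu> \<longrightarrow> measure_theoretic_isomorphism \<mu> T \<nu> S \<pi>) \<longleftrightarrow>
       equicontinuous_in_the_mean X T)"
    (is "(?me \<longleftrightarrow> ?bp) \<and> (?bp \<longleftrightarrow> ?pairs) \<and> (?pairs \<longleftrightarrow> ?iso) \<and> (?iso \<longleftrightarrow> ?em)")
proof -
  interpret dynamical_system X T by unfold_locales (rule assms(1))
  interpret equicontinuous_factor X T Z S \<pi>
    by unfold_locales (use assms(2) in \<open>simp_all add: maximal_equicontinuous_factor_def\<close>)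
  have me: "?bp \<and> ?pairs" if ?me
  proof -
    interpret mean_equicontinuous_system X T by unfold_locales (rule that)
    show ?thesis using Banach_proximal_map_mef[OF assms(2)] proximal_relations_coincide by blast
  qed
  have "?bp \<Longrightarrow> ?em" by (rule Banach_proximal_map_imp_equicontinuous_in_the_mean)
  moreover have "?em \<Longrightarrow> ?me" by (rule equicontinuous_in_the_mean_imp_mean_equicontinuous)
  moreover have "?pairs \<Longrightarrow> ?em" by (rule BP_eq_Q_imp_equicontinuous_in_the_mean) simp
  moreover have "?bp \<Longrightarrow> ?iso" using Banach_proximal_map_imp_isomorphism by blast
  moreover have "?iso \<Longrightarrow> ?bp" by (rule isomorphism_imp_Banach_proximal_map) blast
  \<comment> \<open>\<open>?bp\<close> and \<open>?pairs\<close> each lead to \<open>?em\<close>,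
    which returns through \<open>?me\<close> to both; \<open>?iso\<close> is attached to the cycle
    at \<open>?bp\<close>.\<close>
  ultimately show ?thesis using me by argo
qed

end
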